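(* If the correlation length condition (CL) holds then \[\mathbb{P}_{\beta_c}(x\leftrightarrow y)\asymp \|x-y\|^{-d+\alpha}\] for every distinct $x,y\in \mathbb{Z}^d$. Moreover, (CL) holds if and only if $\beta_c<\infty$ and there exists a decreasing function $h:(0,\infty)\to (0,1]$ decaying faster than any power (i.e. $h(t)=o(t^{-p})$ as $t\to\infty$ for every $p>0$) such that \[\mathbb{P}_{\beta_c,r}(x\leftrightarrow y)\preceq \|x-y\|^{-d+\alpha} \,h\Biggl(\frac{\|x-y\|}{r}\Biggr)\] for every $r\geq 1$ and distinct $x,y\in \mathbb{Z}^d$.
   Context: Setting: fix an integer $d\geq 1$, a real $\alpha>0$, a norm $\|\cdot\|$ on $\mathbb{R}^d$, and a kernel of the form $J(x,y)=\mathbf{1}(x\neq y)J(\|x-y\|)$ for $x,y\in\mathbb{Z}^d$, where $J:(0,\infty)\to(0,\infty)$ is decreasing and differentiable, tends to $0$ at infinity (so that $J(x,y)\sim \mathrm{const.}\,\|x-y\|^{-d-\alpha}$), and satisfies $|J'(r)|=C(1+\delta_r)r^{-d-\alpha-1}$ for some constant $C>0$ and some measurable error function $r\mapsto\delta_r$ with $\delta_r\to0$ as $r\to\infty$ and $\int_{r_0}^\infty \frac{|\delta_r|}{r}\,dr<\infty$ for some $r_0<\infty$. Long-range percolation with parameter $\beta\ge 0$ is the random graph on $\mathbb{Z}^d$ in which each pair of distinct vertices $x,y$ is joined by an (open) edge independently with probability $1-e^{-\beta J(x,y)}$; $\mathbb{P}_\beta$ denotes its law. The critical point is $\beta_c=\inf\{\beta\ge0:\mathbb{P}_\beta(\text{there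 is an infinite cluster})>0\}$, where clusters are connected components. $\{x\leftrightarrow y\}$ is the event that $x$ and $y$ are in the same cluster, and $K$ denotes the cluster of the origin. Cut-off measures: for $r>0$ let $J_r(x,y)=\mathbf{1}(x\neq y,\|x-y\|\le r)\int_{\|x-y\|}^r|J'(s)|\,ds$, and let $\mathbb{P}_{\beta,r},\mathbb{E}_{\beta,r}$ denote the law and expectation of long-range percolation with kernel $J_r$ at parameter $\beta$. $\beta_c$ always denotes the critical point of the original kernel $J$. For $p>0$ define the $L^p$ radius of gyration $\xi_p(\beta_c,r)=\left[\mathbb{E}_{\beta_c,r}\left[\sum_{x\in K}\|x\|_2^p\right]/\mathbb{E}_{\beta_c,r}|K|\right]^{1/p}$. Condition (CL): $\beta_c<\infty$ and for each $p>0$ there exists a constant $C_p<\infty$ such that $\xi_p(\beta_c,r)\le C_p r$ for every $r\ge1$. The notation $\asymp$ and $\preceq$ means equality/inequality up to positive multiplicative constants depending only on $d$, $\alpha$, and the kernel $J$ (including the norm), and in particular not on $x$, $y$, $r$. *)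

theory Defs
  imports "HOL-Probability.Probability" "HOL-Library.Landau_Symbols"
begin

section \<open>Percolation with a symmetric kernel on a vertex set\<close>

text \<open>An edge is a two-element set of vertices. For a symmetric kernel \<open>K\<close> the weight of the
  edge \<open>{x, y}\<close> is \<open>K x y\<close>, see \<open>edge_weight_pair\<close> below.\<close>

definition edges :: "'v set set" where
  "edges = {e. card e = 2}"

definition edge_weight :: "('v \<Rightarrow> 'v \<Rightarrow> real) \<Rightarrow> 'v set \<Rightarrow> real" where
  "edge_weight K e = (THE w. \<exists>x y. e = {x, y} \<and> w = K x y)"

lemma edge_weight_pair:
  assumes "\<And>x y. K x y = K y x"
  shows "edge_weight K {x, y} = K x y"
  unfolding edge_weight_def
  by (rule the_equality) (use assms in \<open>auto simp: doubleton_eq_iff\<close>)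

definition percolation :: "('v \<Rightarrow> 'v \<Rightarrow> real) \<Rightarrow> real \<Rightarrow> ('v set \<Rightarrow> bool) measure" where
  "percolation K \<beta> =
     PiM edges (\<lambda>e. measure_pmf (bernoulli_pmf (1 - exp (- \<beta> * edge_weight K e))))"

definition open_edges :: "('v set \<Rightarrow> bool) \<Rightarrow> ('v \<times> 'v) set" where
  "open_edges \<omega> = {(x, y). x \<noteq> y \<and> \<omega> {x, y}}"

definition cluster :: "('v set \<Rightarrow> bool) \<Rightarrow> 'v \<Rightarrow> 'v set" where
  "cluster \<omega> x = {y. (x, y) \<in> (open_edges \<omega>)\<^sup>*}"

text \<open>The critical point is extended-real valued, with value \<open>\<infinity>\<close> if there is never an infinite
  cluster.\<close>

definition critical_point :: "('v \<Rightarrow> 'v \<Rightarrow> real) \<Rightarrow> ereal" where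
  "critical_point K =
     Inf (ereal ` {\<beta>. 0 \<le> \<beta> \<and> \<P>(\<omega> in percolation K \<beta>. \<exists>x. infinite (cluster \<omega> x)) > 0})"

definition two_point :: "('v \<Rightarrow> 'v \<Rightarrow> real) \<Rightarrow> real \<Rightarrow> 'v \<Rightarrow> 'v \<Rightarrow> real" where
  "two_point K \<beta> x y = \<P>(\<omega> in percolation K \<beta>. y \<in> cluster \<omega> x)"


section \<open>Long-range percolation on the integer lattice\<close>

definition is_norm :: "('a::real_vector \<Rightarrow> real) \<Rightarrow> bool" where
  "is_norm N \<longleftrightarrow>
     (\<forall>x. N x \<ge> 0) \<and> (\<forall>x. N x = 0 \<longleftrightarrow> x = 0) \<and>
     (\<forall>a x. N (a *\<^sub>R x) = \<bar>a\<bar> * N x) \<and> (\<forall>x y. N (x + y) \<le> N x + N y)"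

definition real_vec :: "int ^ 'd \<Rightarrow> real ^ 'd" where
  "real_vec x = (\<chi> i. real_of_int (x $ i))"

definition lr_kernel ::
  "(real ^ 'd \<Rightarrow> real) \<Rightarrow> (real \<Rightarrow> real) \<Rightarrow> int ^ 'd \<Rightarrow> int ^ 'd \<Rightarrow> real" where
  "lr_kernel N J x y = (if x \<noteq> y then J (N (real_vec (x - y))) else 0)"

definition cutoff_kernel ::
  "(real ^ 'd \<Rightarrow> real) \<Rightarrow> (real \<Rightarrow> real) \<Rightarrow> real \<Rightarrow> int ^ 'd \<Rightarrow> int ^ 'd \<Rightarrow> real" where
  "cutoff_kernel N J r x y =
     (if x \<noteq> y \<and> N (real_vec (x - y)) \<le> r
      then (LINT s:{N (real_vec (x - y))..r}|lborel. \<bar>deriv J s\<bar>) else 0)"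

text \<open>The real number \<open>\<beta>\<^sub>c\<close> of the original kernel; meaningful only when the critical point is
  finite.\<close>

definition beta_c :: "(real ^ 'd \<Rightarrow> real) \<Rightarrow> (real \<Rightarrow> real) \<Rightarrow> real" where
  "beta_c N J = real_of_ereal (critical_point (lr_kernel N J))"

definition cluster_moment :: "(int ^ 'd \<Rightarrow> int ^ 'd \<Rightarrow> real) \<Rightarrow> real \<Rightarrow> real \<Rightarrow> ennreal" where
  "cluster_moment K \<beta> p =
     (\<integral>\<^sup>+ \<omega>. (\<integral>\<^sup>+ x. ennreal (norm (real_vec x) powr p) \<partial>count_space (cluster \<omega> 0))
       \<partial>percolation K \<beta>)"

definition susceptibility :: "(int ^ 'd \<Rightarrow> int ^ 'd \<Rightarrow> real) \<Rightarrow> real \<Rightarrow> ennreal" where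
  "susceptibility K \<beta> =
     (\<integral>\<^sup>+ \<omega>. emeasure (count_space UNIV) (cluster \<omega> 0) \<partial>percolation K \<beta>)"

text \<open>The radius of gyration takes values in \<open>[0, \<infinity>]\<close>. If the expected cluster size is
  infinite the quotient is undefined and the radius is set to \<open>\<infinity>\<close>, since division on
  \<^typ>\<open>ennreal\<close> or \<^typ>\<open>real\<close> would return the value \<open>0\<close>. The expected cluster size is never
  \<open>0\<close>, as the cluster contains the origin.\<close>

definition gyration_radius ::
  "(int ^ 'd \<Rightarrow> int ^ 'd \<Rightarrow> real) \<Rightarrow> real \<Rightarrow> real \<Rightarrow> ennreal" where
  "gyration_radius K \<beta> p =
     (if cluster_moment K \<beta> p = \<infinity> \<or> susceptibility K \<beta> = \<infinity> then \<infinity>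
      else ennreal ((enn2real (cluster_moment K \<beta> p) / enn2real (susceptibility K \<beta>))
                      powr (1 / p)))"

definition correlation_length_condition ::
  "(real ^ 'd \<Rightarrow> real) \<Rightarrow> (real \<Rightarrow> real) \<Rightarrow> bool" where
  "correlation_length_condition N J \<longleftrightarrow>
     critical_point (lr_kernel N J) < \<infinity> \<and>
     (\<forall>p>0. \<exists>C. \<forall>r\<ge>1.
        gyration_radius (cutoff_kernel N J r) (beta_c N J) p \<le> ennreal (C * r))"

end

theory Submission
  imports Defs
begin

text \<open>Write \<open>\<tau>\<^sub>r\<close> for the two-point function of the cut-off model at \<open>\<beta>\<^sub>c\<close> and \<open>\<chi>\<^sub>r\<close> for its sum. Cutting an
  open path where it last leaves the cluster of \<open>x\<close> in the \<open>r\<close>-model bounds \<open>\<tau>\<^sub>R(x, y)\<close> by \<open>\<tau>\<^sub>r(x, y)\<close> plus a convolution of \<open>\<tau>\<^sub>r\<close>, the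
  weights of the added edges and \<open>\<tau>\<^sub>R\<close>. At \<open>\<beta>\<^sub>c\<close> adding all long edges must make the susceptibility
  infinite, so this gives \<open>r\<^sup>\<alpha> \<preceq> \<chi>\<^sub>r\<close>.

  Assume (CL). Splitting a large cluster into two edge-disjoint pieces shows, via the disjoint
  occurrence inequality, that cluster sizes in a box have exponential tails beyond the median of their
  maximum. If clusters in a box of radius \<open>r\<close> were typically much larger than
  \<open>r\<^bsup>(d + \<alpha>) / 2\<^esup>\<close>, then a long row of boxes would contain clusters all joined by edges of length of order
  \<open>r\<close>, and a high moment of \<open>\<tau>\<close> would be too large for (CL). For clusters that are not larger, Harris'
  inequality and the possibility of joining two clusters by one new edge give
  \<open>\<tau>\<^sub>R(x, y) \<succeq> \<chi>\<^sub>r\<^sup>2 / r\<^bsup>d + \<alpha>\<^esup>\<close> for \<open>\<parallel>x - y\<parallel> \<le> r\<close> and \<open>R\<close> of order \<open>r\<close>. Summed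
  over \<open>y\<close>, an unbounded ratio \<open>\<chi>\<^sub>r / r\<^sup>\<alpha>\<close> would grow doubly exponentially along powers of a fixed number,
  hence \<open>\<chi>\<^sub>r\<close> is of order \<open>r\<^sup>\<alpha>\<close>, and the same estimate is then the lower bound on the two-point
  function. The upper bounds follow by iterating the convolution inequality over the dyadic
  scales. Conversely, a rapidly decaying profile bounds the moments of \<open>\<tau>\<^sub>r\<close> by lattice sums, and
  \<open>\<chi>\<^sub>r \<succeq> r\<^sup>\<alpha>\<close> turns this into a bound on the radius of gyration.\<close>

section \<open>Random subsets of a finite set\<close>

text \<open>The estimates are circular: (CL) controls the model with cut-off \<open>rho * r\<close>,
  whose susceptibility is not yet known, so the size beyond which clusters in a box are rare is
  bounded only in terms of \<open>A (rho * r)\<close>, the susceptibility divided by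
  \<open>r^\<alpha>\<close> at that scale. A high moment makes the loss small: with the 24th, the
  squared size exceeds \<open>r^(d + \<alpha>)\<close> by at most a constant times
  \<open>A (rho * r) powr (1 / 4)\<close>. The outcome is that \<open>(A r)^2\<close> is at most a
  constant times \<open>A (rho * r) powr (5 / 4)\<close>, and 5 / 4 < 2 is what makes the growth
  doubly exponential. Rarity means probability at most 1/9: cutting a cluster in two costs a factor
  3 in size, and layers of sizes growing by 3 must have probabilities falling faster than 1/3.
  Raising the cut-off adds an independent layer of edges, because weights add in the exponent of
  \<open>1 - exp (- w)\<close>. The two layers live on two disjoint copies of the edge set, so that
  disjoint occurrence treats them as separate coordinates. Convolutions and susceptibilities on the
  lattice are handled through bounds on all finite partial sums, which avoids summability
  questions.\<close>

definition ber :: "('i \<Rightarrow> real) \<Rightarrow> 'i set \<Rightarrow> ('i set \<Rightarrow> real) \<Rightarrow> real" where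
  "ber p I g = (\<Sum>S\<in>Pow I. (\<Prod>i\<in>S. p i) * (\<Prod>i\<in>I - S. 1 - p i) * g S)"

lemma ber_empty [simp]: "ber p {} g = g {}"
  by (simp add: ber_def)

text \<open>Conditioning on whether the random set contains \<open>i\<close>;
  \<open>ber p I g\<close> is the expectation of \<open>g\<close> when each element of
  \<open>I\<close> is included independently with its own probability. This recursion drives the
  inductions below.\<close>

lemma ber_insert:
  assumes "finite I" "i \<notin> I"
  shows "ber p (insert i I) g = p i * ber p I (\<lambda>S. g (insert i S)) + (1 - p i) * ber p I g"
proof -
  let ?w = "\<lambda>I S. (\<Prod>i\<in>S. p i) * (\<Prod>i\<in>I - S. 1 - p i)"
  have disj: "Pow I \<inter> insert i ` Pow I = {}"
    using assms by auto
  have inj: "inj_on (insert i) (Pow I)"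
    using assms by (auto simp: inj_on_def)
  have a: "?w (insert i I) S = (1 - p i) * ?w I S" if "S \<in> Pow I" for S
  proof -
    have "insert i I - S = insert i (I - S)" using that assms by auto
    then show ?thesis using assms by (simp add: ac_simps)
  qed
  have b: "?w (insert i I) (insert i S) = p i * ?w I S" if "S \<in> Pow I" for S
  proof -
    have "insert i I - insert i S = I - S" "i \<notin> S" "finite S"
      using that assms by (auto intro: finite_subset)
    then show ?thesis by (simp add: ac_simps)
  qed
  have "ber p (insert i I) g =
      (\<Sum>S\<in>Pow I. ?w (insert i I) S * g S) + (\<Sum>S\<in>insert i ` Pow I. ?w (insert i I) S * g S)"
    unfolding ber_def Pow_insert using assms disj by (intro sum.union_disjoint) auto
  also have "(\<Sum>S\<in>insert i ` Pow I. ?w (insert i I) S * g S) =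
      (\<Sum>S\<in>Pow I. ?w (insert i I) (insert i S) * g (insert i S))"
    by (simp add: sum.reindex[OF inj])
  also have "\<dots> = p i * ber p I (\<lambda>S. g (insert i S))"
    unfolding ber_def sum_distrib_left by (intro sum.cong) (simp_all only: b mult.assoc)
  also have "(\<Sum>S\<in>Pow I. ?w (insert i I) S * g S) = (1 - p i) * ber p I g"
    unfolding ber_def sum_distrib_left by (intro sum.cong) (simp_all only: a mult.assoc)
  finally show ?thesis by simp
qed

lemma ber_add: "ber p I (\<lambda>S. f S + g S) = ber p I f + ber p I g"
  by (simp add: ber_def algebra_simps sum.distrib)

lemma ber_cmult: "ber p I (\<lambda>S. c * g S) = c * ber p I g"
  by (simp add: ber_def sum_distrib_left ac_simps)

lemma ber_diff: "ber p I (\<lambda>S. f S - g S) = ber p I f - ber p I g"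
  by (simp add: ber_def algebra_simps sum_subtractf)

lemma ber_sum: "ber p I (\<lambda>S. \<Sum>k\<in>A. g k S) = (\<Sum>k\<in>A. ber p I (g k))"
  by (induction A rule: infinite_finite_induct) (auto simp: ber_add, auto simp: ber_def)

lemma ber_const [simp]: "finite I \<Longrightarrow> ber p I (\<lambda>_. c) = c"
  by (induction I rule: finite_induct) (auto simp: ber_insert algebra_simps)

lemma ber_cong: "(\<And>S. S \<subseteq> I \<Longrightarrow> f S = g S) \<Longrightarrow> ber p I f = ber p I g"
  unfolding ber_def by (intro sum.cong) auto

lemma ber_mono:
  assumes "\<And>i. 0 \<le> p i" "\<And>i. p i \<le> 1" "\<And>S. S \<subseteq> I \<Longrightarrow> f S \<le> g S"
  shows "ber p I f \<le> ber p I g"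
  unfolding ber_def using assms
  by (intro sum_mono mult_left_mono mult_nonneg_nonneg prod_nonneg) auto

lemma ber_nonneg:
  assumes "\<And>i. 0 \<le> p i" "\<And>i. p i \<le> 1" "\<And>S. S \<subseteq> I \<Longrightarrow> 0 \<le> g S"
  shows "0 \<le> ber p I g"
  unfolding ber_def using assms
  by (intro sum_nonneg mult_nonneg_nonneg prod_nonneg) auto

lemma ber_le_const:
  assumes "finite I" "\<And>i. 0 \<le> p i" "\<And>i. p i \<le> 1" "\<And>S. S \<subseteq> I \<Longrightarrow> g S \<le> c"
  shows "ber p I g \<le> c"
  using ber_mono[of p I g "\<lambda>_. c"] assms by simp

lemma ber_mono_set:
  assumes "finite I'" "I \<subseteq> I'" "\<And>i. 0 \<le> p i" "\<And>i. p i \<le> 1" "mono g"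
  shows "ber p I g \<le> ber p I' g"
proof -
  have "finite D \<Longrightarrow> D \<inter> I = {} \<Longrightarrow> ber p I g \<le> ber p (I \<union> D) g" for D
  proof (induction D rule: finite_induct)
    case (insert i D)
    have fin: "finite (I \<union> D)" using assms insert by (auto intro: finite_subset)
    have "ber p (I \<union> D) g \<le> ber p (I \<union> D) (\<lambda>S. g (insert i S))"
      by (intro ber_mono assms monoD[OF assms(5)]) auto
    then have "p i * ber p (I \<union> D) g \<le> p i * ber p (I \<union> D) (\<lambda>S. g (insert i S))"
      using assms by (intro mult_left_mono)
    then have "ber p (I \<union> D) g \<le> ber p (insert i (I \<union> D)) g"
      using insert fin by (subst ber_insert) (auto simp: algebra_simps)
    then show ?case using insert by auto
  qed auto
  from this[of "I' - I"] show ?thesis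
    using assms by (auto simp: Un_absorb1)
qed

lemma mono_compose_insert:
  assumes "mono f"
  shows "mono (\<lambda>S. f (insert i S))"
  by (rule monoI, rule monoD[OF assms]) auto

text \<open>Conditioning on coordinate \<open>i\<close> splits the covariance into conditional
  covariances, nonnegative by induction, and the covariance of the conditional means, a product of
  two increments of the same sign.\<close>

lemma ber_harris:
  assumes "finite I" "\<And>i. 0 \<le> p i" "\<And>i. p i \<le> 1" "mono f" "mono g"
  shows "ber p I f * ber p I g \<le> ber p I (\<lambda>S. f S * g S)"
  using assms(1,4,5)
proof (induction I arbitrary: f g rule: finite_induct)
  case (insert i I)
  let ?f = "\<lambda>S. f (insert i S)" and ?g = "\<lambda>S. g (insert i S)"
  have m: "mono ?f" "mono ?g"
    using insert.prems by (auto intro: mono_compose_insert)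
  have "ber p I f \<le> ber p I ?f" "ber p I g \<le> ber p I ?g"
    by (intro ber_mono assms monoD[OF insert.prems(1)] monoD[OF insert.prems(2)] subset_insertI)+
  then have "0 \<le> (p i * (1 - p i)) * ((ber p I ?f - ber p I f) * (ber p I ?g - ber p I g))"
    using assms by (intro mult_nonneg_nonneg) auto
  moreover have "p i * (ber p I ?f * ber p I ?g) \<le> p i * ber p I (\<lambda>S. ?f S * ?g S)"
    using assms by (intro mult_left_mono insert.IH m)
  moreover have "(1 - p i) * (ber p I f * ber p I g) \<le> (1 - p i) * ber p I (\<lambda>S. f S * g S)"
    using assms insert.prems by (intro mult_left_mono insert.IH) auto
  ultimately show ?case
    using insert.hyps by (simp add: ber_insert algebra_simps)
qed auto

text \<open>The disjoint occurrence inequality: every coordinate of the shared set is replaced in turn by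
  two independent copies, one for each of the two witnesses. Stating it for a monotone relation
  \<open>Q\<close> instead of a product event makes the induction on the index set immediate.\<close>

lemma ber_disjoint_occurrence:
  assumes "finite I" "\<And>i. 0 \<le> p i" "\<And>i. p i \<le> 1"
    and "\<And>F G F' G'. Q F G \<Longrightarrow> F \<subseteq> F' \<Longrightarrow> G \<subseteq> G' \<Longrightarrow> Q F' G'"
  shows "ber p I (\<lambda>S. of_bool (\<exists>F G. F \<inter> G = {} \<and> F \<subseteq> S \<and> G \<subseteq> S \<and> Q F G))
           \<le> ber p I (\<lambda>S. ber p I (\<lambda>T. of_bool (Q S T)))"
  using assms(1,4)
proof (induction I arbitrary: Q rule: finite_induct)
  case empty
  then show ?case by auto
next
  case (insert i I Q)
  let ?D = "\<lambda>Q S. \<exists>F G. F \<inter> G = {} \<and> F \<subseteq> S \<and> G \<subseteq> S \<and> Q F G"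
  \<comment> \<open>A present coordinate \<open>i\<close> may serve one of the two disjoint
    witnesses, but not both.\<close>
  define Q' where "Q' F G \<longleftrightarrow> Q (insert i F) G \<or> Q F (insert i G)" for F G
  note mono = insert.prems
  have mono': "Q' F G \<Longrightarrow> F \<subseteq> F' \<Longrightarrow> G \<subseteq> G' \<Longrightarrow> Q' F' G'" for F G F' G'
    unfolding Q'_def using mono[of "insert i F" G "insert i F'" G'] mono[of F "insert i G" F' "insert i G'"]
    by (auto simp: insert_mono)
  have D1: "?D Q (insert i S) \<longrightarrow> ?D Q' S" for S
  proof
    assume "?D Q (insert i S)"
    then obtain F G where FG: "F \<inter> G = {}" "F \<subseteq> insert i S" "G \<subseteq> insert i S" "Q F G" by auto
    have "Q' (F - {i}) (G - {i})"
    proof (cases "i \<in> F")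
      case True
      then have "G - {i} = G" "insert i (F - {i}) = F" using FG by auto
      then show ?thesis unfolding Q'_def using FG by simp
    next
      case False
      then show ?thesis unfolding Q'_def using FG(4) by (auto intro: mono[OF FG(4)])
    qed
    then show "?D Q' S"
      using FG by (intro exI[of _ "F - {i}"] exI[of _ "G - {i}"]) auto
  qed
  have "ber p (insert i I) (\<lambda>S. of_bool (?D Q S)) \<le>
     p i * ber p I (\<lambda>S. of_bool (?D Q' S)) + (1 - p i) * ber p I (\<lambda>S. of_bool (?D Q S))"
    unfolding ber_insert[OF insert.hyps(1,2)]
    using assms(2,3) D1 by (intro add_mono mult_left_mono ber_mono) auto
  also have "\<dots> \<le> p i * ber p I (\<lambda>S. ber p I (\<lambda>T. of_bool (Q' S T)))
                + (1 - p i) * ber p I (\<lambda>S. ber p I (\<lambda>T. of_bool (Q S T)))"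
    using assms(2,3) mono' mono
    by (intro add_mono mult_left_mono insert.IH) auto
  also have "\<dots> = ber p I (\<lambda>S. ber p I (\<lambda>T. p i * of_bool (Q' S T) + (1 - p i) * of_bool (Q S T)))"
    by (simp add: ber_add ber_cmult)
  \<comment> \<open>Here the shared coordinate becomes two independent copies. In the only delicate
    case \<open>Q S T\<close> fails and one copy alone suffices; its probability \<open>p i\<close>
    is exactly the weight on the left.\<close>
  also have "\<dots> \<le> ber p I (\<lambda>S. ber p I (\<lambda>T.
       p i * (p i * of_bool (Q (insert i S) (insert i T)) + (1 - p i) * of_bool (Q (insert i S) T))
       + (1 - p i) * (p i * of_bool (Q S (insert i T)) + (1 - p i) * of_bool (Q S T))))"
  proof (intro ber_mono assms)
    fix S T :: "'a set"
    let ?l = "p i * of_bool (Q' S T) + (1 - p i) * of_bool (Q S T)"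
    let ?r = "p i * (p i * of_bool (Q (insert i S) (insert i T)) + (1 - p i) * of_bool (Q (insert i S) T))
       + (1 - p i) * (p i * of_bool (Q S (insert i T)) + (1 - p i) * of_bool (Q S T))"
    have p: "0 \<le> p i" "p i \<le> 1" using assms by auto
    have pp: "0 \<le> p i * (1 - p i)" using p by simp
    show "?l \<le> ?r"
    proof (cases "Q S T")
      case True
      then have "Q (insert i S) T" "Q S (insert i T)" "Q (insert i S) (insert i T)"
        by (auto intro: mono[OF True])
      then show ?thesis using True p by (simp add: Q'_def algebra_simps)
    next
      case False
      note nQ = this
      show ?thesis
      proof (cases "Q' S T")
        case True
        then have "Q (insert i S) (insert i T)" unfolding Q'_def by (auto intro: mono)
        then show ?thesis using True nQ p pp unfolding Q'_def
          by (cases "Q (insert i S) T"; cases "Q S (insert i T)") (auto simp: algebra_simps)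
      next
        case False
        then show ?thesis using nQ p by simp
      qed
    qed
  qed
  also have "\<dots> = ber p (insert i I) (\<lambda>S. ber p (insert i I) (\<lambda>T. of_bool (Q S T)))"
    by (simp only: ber_insert[OF insert.hyps(1,2)] ber_add ber_cmult) (simp add: algebra_simps)
  finally show ?case .
qed

text \<open>For a product relation the two independent copies decouple, so the bound
  factorises.\<close>

lemma ber_BK:
  assumes "finite I" "\<And>i. 0 \<le> p i" "\<And>i. p i \<le> 1"
    and A: "\<And>F F'. A F \<Longrightarrow> F \<subseteq> F' \<Longrightarrow> A F'"
    and B: "\<And>F F'. B F \<Longrightarrow> F \<subseteq> F' \<Longrightarrow> B F'"
  shows "ber p I (\<lambda>S. of_bool (\<exists>F G. F \<inter> G = {} \<and> F \<subseteq> S \<and> G \<subseteq> S \<and> A F \<and> B G))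
           \<le> ber p I (\<lambda>S. of_bool (A S)) * ber p I (\<lambda>S. of_bool (B S))"
proof -
  have "ber p I (\<lambda>S. of_bool (\<exists>F G. F \<inter> G = {} \<and> F \<subseteq> S \<and> G \<subseteq> S \<and> A F \<and> B G))
      \<le> ber p I (\<lambda>S. ber p I (\<lambda>T. of_bool (A S \<and> B T)))"
    by (rule ber_disjoint_occurrence) (use assms in blast)+
  also have "\<dots> = ber p I (\<lambda>S. ber p I (\<lambda>T. of_bool (B T)) * of_bool (A S))"
    by (simp add: of_bool_conj ber_cmult mult.commute)
  also have "\<dots> = ber p I (\<lambda>S. of_bool (A S)) * ber p I (\<lambda>S. of_bool (B S))"
    by (simp add: ber_cmult)
  finally show ?thesis .
qed

text \<open>The union of two independent random sets misses \<open>i\<close> exactly when both do,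
  which is the hypothesis on the probabilities.\<close>

lemma ber_sprinkle:
  assumes "finite I" "\<And>i. 1 - p i = (1 - p1 i) * (1 - p2 i)"
  shows "ber p I g = ber p1 I (\<lambda>S. ber p2 I (\<lambda>T. g (S \<union> T)))"
  using assms(1)
proof (induction I arbitrary: g rule: finite_induct)
  case (insert i I)
  have p: "p i = p1 i + p2 i - p1 i * p2 i" using assms(2)[of i] by (simp add: algebra_simps)
  show ?case
    using insert.hyps
    by (simp add: ber_insert insert.IH p ber_add ber_cmult) (simp add: algebra_simps)
qed auto

text \<open>A pair of independent random sets is presented as one random subset of a disjoint union,
  so that results about a single index set, in particular \<open>ber_BK\<close>, apply to
  pairs.\<close>

lemma ber_Plus:
  fixes p :: "'i \<Rightarrow> real" and q :: "'j \<Rightarrow> real"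
  assumes "finite I" "finite J"
  shows "ber (case_sum p q) (I <+> J) g = ber p I (\<lambda>S. ber q J (\<lambda>T. g (S <+> T)))"
proof -
  have 1: "ber (case_sum p q) (({} :: 'i set) <+> J) g = ber q J (\<lambda>T. g ({} <+> T))" for g
    using assms(2)
  proof (induction J arbitrary: g rule: finite_induct)
    case (insert j J)
    have "({} :: 'i set) <+> insert j T = insert (Inr j) ({} <+> T)" for T :: "'j set" by auto
    moreover have "Inr j \<notin> ({} :: 'i set) <+> J" using insert by auto
    ultimately show ?case using insert by (simp add: ber_insert finite_Plus)
  qed (auto simp: Plus_def)
  show ?thesis
    using assms(1)
  proof (induction I arbitrary: g rule: finite_induct)
    case empty
    then show ?case by (simp add: 1)
  next
    case (insert i I)
    have e: "insert i S <+> T = insert (Inl i) (S <+> T)" for S :: "'i set" and T :: "'j set" by auto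
    moreover have "Inl i \<notin> I <+> J" using insert by auto
    ultimately show ?case using insert assms(2) by (simp add: ber_insert ber_add ber_cmult)
  qed
qed

lemma ber_avoid:
  assumes "finite I"
  shows "ber p I (\<lambda>T. of_bool (T \<inter> X = {})) = (\<Prod>i\<in>I \<inter> X. 1 - p i)"
  using assms
proof (induction I rule: finite_induct)
  case (insert i I)
  show ?case
  proof (cases "i \<in> X")
    case True
    then have "insert i I \<inter> X = insert i (I \<inter> X)" by auto
    then show ?thesis using insert True by (simp add: ber_insert)
  next
    case False
    then have "insert i I \<inter> X = I \<inter> X" by auto
    then show ?thesis using insert False by (simp add: ber_insert algebra_simps)
  qed
qed auto

lemma ber_image:
  assumes "finite I" "inj_on f I"
  shows "ber p (f ` I) g = ber (p \<circ> f) I (\<lambda>S. g (f ` S))"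
  using assms
proof (induction I arbitrary: g rule: finite_induct)
  case (insert i I)
  then have "f i \<notin> f ` I" by auto
  then show ?case using insert by (simp add: ber_insert)
qed auto

lemma ber_mono_weights:
  assumes "finite I" "\<And>i. 0 \<le> p i" "\<And>i. p i \<le> q i" "\<And>i. q i \<le> 1" "mono g"
  shows "ber p I g \<le> ber q I g"
  using assms(1,5)
proof (induction I arbitrary: g rule: finite_induct)
  case (insert i I)
  let ?g = "\<lambda>S. g (insert i S)"
  have p: "0 \<le> p i" "p i \<le> q i" "q i \<le> 1" "p i \<le> 1"
    using assms(2-4)[of i] by auto
  have m: "mono ?g" by (rule mono_compose_insert[OF insert.prems])
  have 1: "ber p I ?g \<le> ber q I ?g" "ber p I g \<le> ber q I g"
    using insert.IH m insert.prems by auto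
  have 2: "ber q I g \<le> ber q I ?g"
    by (rule ber_mono[OF order_trans[OF assms(2,3)] assms(4)], rule monoD[OF insert.prems]) auto
  have "p i * ber p I ?g + (1 - p i) * ber p I g \<le> p i * ber q I ?g + (1 - p i) * ber q I g"
    using p 1 by (intro add_mono mult_left_mono) auto
  also have "\<dots> = ber q I g + p i * (ber q I ?g - ber q I g)" by (simp add: algebra_simps)
  also have "\<dots> \<le> ber q I g + q i * (ber q I ?g - ber q I g)"
    using p 2 by (intro add_mono mult_right_mono) auto
  also have "\<dots> = q i * ber q I ?g + (1 - q i) * ber q I g" by (simp add: algebra_simps)
  finally show ?case using insert.hyps by (simp add: ber_insert)
qed auto

section \<open>Connected components\<close>

definition conn :: "'v set set \<Rightarrow> 'v \<Rightarrow> 'v set" where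
  "conn S x = {y. (x, y) \<in> {(a, b). a \<noteq> b \<and> {a, b} \<in> S}\<^sup>*}"

lemma cluster_eq_conn: "cluster \<omega> x = conn {e. \<omega> e} x"
  by (simp add: cluster_def conn_def open_edges_def)

lemma conn_refl [simp, intro]: "x \<in> conn S x"
  by (simp add: conn_def)

lemma conn_step: "y \<in> conn S x \<Longrightarrow> y \<noteq> z \<Longrightarrow> {y, z} \<in> S \<Longrightarrow> z \<in> conn S x"
  unfolding conn_def by (auto intro: rtrancl_into_rtrancl)

lemma conn_trans: "y \<in> conn S x \<Longrightarrow> z \<in> conn S y \<Longrightarrow> z \<in> conn S x"
  unfolding conn_def by auto

lemma conn_induct [consumes 1, case_names refl step]:
  assumes "y \<in> conn S x" "P x"
    and "\<And>y z. y \<in> conn S x \<Longrightarrow> P y \<Longrightarrow> y \<noteq> z \<Longrightarrow> {y, z} \<in> S \<Longrightarrow> P z"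
  shows "P y"
  using assms(1) unfolding conn_def mem_Collect_eq
proof (induction rule: rtrancl_induct)
  case base
  then show ?case using assms(2) by simp
next
  case (step y z)
  then show ?case using assms(3)[of y z] by (auto simp: conn_def)
qed

lemma conn_mono: "S \<subseteq> T \<Longrightarrow> conn S x \<subseteq> conn T x"
proof
  fix y assume "S \<subseteq> T" "y \<in> conn S x"
  from this(2) show "y \<in> conn T x"
    by (induction rule: conn_induct) (use \<open>S \<subseteq> T\<close> in \<open>auto intro: conn_step\<close>)
qed

lemma conn_sym: "y \<in> conn S x \<Longrightarrow> x \<in> conn S y"
proof (induction rule: conn_induct)
  case (step y z)
  then have "y \<in> conn S z" by (intro conn_step[of z S z y]) (auto simp: insert_commute)
  then show ?case using step conn_trans by metis
qed auto

lemma conn_eq: "y \<in> conn S x \<Longrightarrow> conn S y = conn S x"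
  by (meson conn_sym conn_trans subsetI subset_antisym)

text \<open>Makes a connection event a union of events that depend on finitely many edges, which
  gives both measurability and the limit over finite edge sets.\<close>

lemma conn_finite_support:
  assumes "y \<in> conn S x"
  shows "\<exists>F\<subseteq>S. finite F \<and> y \<in> conn F x"
  using assms
proof (induction rule: conn_induct)
  case refl
  then show ?case by auto
next
  case (step y z)
  then obtain F where "F \<subseteq> S" "finite F" "y \<in> conn F x" by auto
  then show ?case using step.hyps(2,3) conn_mono[of F "insert {y, z} F" x]
    by (intro exI[of _ "insert {y, z} F"]) (auto intro: conn_step)
qed

text \<open>Provides a witness for the connection that shares no edge with anything avoiding the
  component.\<close>

lemma conn_within: "y \<in> conn S x \<Longrightarrow> y \<in> conn {e \<in> S. e \<subseteq> conn S x} x"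
proof (induction rule: conn_induct)
  case (step y z)
  then have "z \<in> conn S x" using conn_step by metis
  with step show ?case by (intro conn_step[OF step.IH]) auto
qed auto

lemma conn_insert_edge: "conn (insert {v, u} S) v \<subseteq> conn S v \<union> conn S u"
proof
  fix y assume "y \<in> conn (insert {v, u} S) v"
  then show "y \<in> conn S v \<union> conn S u"
  proof (induction rule: conn_induct)
    case (step y z)
    then show ?case by (auto simp: doubleton_eq_iff intro: conn_step)
  qed auto
qed

lemma conn_isolated:
  assumes "\<And>u. v \<noteq> u \<Longrightarrow> {v, u} \<notin> S"
  shows "conn S v = {v}"
proof -
  have "y = v" if "y \<in> conn S v" for y
    using that by (induction rule: conn_induct) (use assms in auto)
  then show ?thesis by auto
qed

lemma conn_image:
  assumes "inj f"
  shows "conn ((`) f ` S) (f x) = f ` conn S x"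
proof (intro subset_antisym subsetI)
  fix y assume "y \<in> conn ((`) f ` S) (f x)"
  then show "y \<in> f ` conn S x"
  proof (induction rule: conn_induct)
    case (step y z)
    then obtain y' e where y': "y = f y'" "y' \<in> conn S x" "e \<in> S" "{y, z} = f ` e" by auto
    then obtain z' where z': "z = f z'" "z' \<in> e" by (metis imageE insertI1 insert_commute)
    have "f ` {y', z'} = f ` e" using y' z' by auto
    then have "e = {y', z'}" using assms by (metis inj_image_eq_iff)
    then show ?case using step.hyps(2) y' z' conn_step[of y' S x z'] by auto
  qed auto
next
  fix y assume "y \<in> f ` conn S x"
  then obtain y' where y: "y = f y'" "y' \<in> conn S x" by auto
  show "y \<in> conn ((`) f ` S) (f x)"
    unfolding y(1) using y(2)
  proof (induction rule: conn_induct)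
    case (step y z)
    have "{f y, f z} \<in> (`) f ` S" using step.hyps(3) by (intro image_eqI[of _ _ "{y, z}"]) auto
    then show ?case using step.hyps assms by (intro conn_step[OF step.IH]) (auto simp: inj_eq)
  qed auto
qed

text \<open>Because the last exit is taken, the rest of the path avoids the
  \<open>S\<close>-component of \<open>x\<close> altogether; this is what makes it edge-disjoint
  from the initial part, which can be kept inside that component.\<close>

lemma conn_last_exit:
  assumes "y \<in> conn (S \<union> T) x"
  shows "y \<in> conn S x \<or> (\<exists>a b. a \<in> conn S x \<and> b \<notin> conn S x \<and> {a, b} \<in> T \<and>
           y \<in> conn {e \<in> S \<union> T. e \<inter> conn S x = {}} b)"
  using assms
proof (induction rule: conn_induct)
  case refl
  then show ?case by auto
next
  case (step y z)
  show ?case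
  proof (cases "z \<in> conn S x")
    case False
    note nz = this
    show ?thesis
    proof (cases "y \<in> conn S x")
      case True
      then have "{y, z} \<in> T" using step False conn_step by (metis UnE)
      then show ?thesis using True False by auto
    next
      case False
      then obtain a b where ab: "a \<in> conn S x" "b \<notin> conn S x" "{a, b} \<in> T"
        "y \<in> conn {e \<in> S \<union> T. e \<inter> conn S x = {}} b"
        using step by auto
      have "z \<in> conn {e \<in> S \<union> T. e \<inter> conn S x = {}} b"
        using step.hyps(2,3) nz False by (intro conn_step[OF ab(4)]) auto
      then show ?thesis using ab by blast
    qed
  qed auto
qed

section \<open>Splitting a finite component into two edge-disjoint pieces\<close>

lemma conn_remove_empty: "conn (S - {{}}) x = conn S x"
proof -
  have "{(a, b). a \<noteq> b \<and> {a, b} \<in> S - {{}}} = {(a, b). a \<noteq> b \<and> {a, b} \<in> S}" by auto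
  then show ?thesis by (simp only: conn_def)
qed

text \<open>Induction on the number of edges: when a bridge \<open>{v, u}\<close> is removed from a component of weight at
  least \<open>2 m\<close>, one of the two sides has weight at least \<open>m\<close> and is split, the other stays with \<open>v\<close>.\<close>

lemma conn_split:
  fixes m :: real
  assumes "finite F" "1 \<le> m" "finite L" "m \<le> card (conn F v \<inter> L)"
  shows "\<exists>F1 F2 w. F1 \<subseteq> F \<and> F2 \<subseteq> F \<and> F1 \<inter> F2 = {} \<and> m \<le> card (conn F2 w \<inter> L) \<and>
           card (conn F2 w \<inter> L) < 2 * m \<and> conn F v \<subseteq> conn F1 v \<union> conn F2 w"
  using assms(1,4)
proof (induction "card F" arbitrary: F v rule: less_induct)
  case less
  show ?case
  proof (cases "card (conn F v \<inter> L) < 2 * m")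
    case True
    then show ?thesis using less.prems by (intro exI[of _ "{}"] exI[of _ F] exI[of _ v]) auto
  next
    case False
    note big = this
    have "\<exists>u. v \<noteq> u \<and> {v, u} \<in> F"
    proof (rule ccontr)
      assume "\<not> ?thesis"
      then have "conn F v = {v}" by (intro conn_isolated) auto
      then have "card (conn F v \<inter> L) \<le> card {v}" by (intro card_mono) auto
      then show False using False assms(2) by simp
    qed
    then obtain u where u: "v \<noteq> u" "{v, u} \<in> F" by auto
    define F' where "F' = F - {{v, u}}"
    have F: "F = insert {v, u} F'" "finite F'" using u less.prems by (auto simp: F'_def)
    have Fv: "conn F v \<subseteq> conn F' v \<union> conn F' u" using conn_insert_edge F by metis
    have c': "card G < card F" if "G \<subseteq> F'" for G
      using that u less.prems by (intro psubset_card_mono) (auto simp: F'_def)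
    have sub: "conn F' x \<subseteq> conn {e \<in> F'. e \<subseteq> conn F' x} x" for x
      by (rule subsetI, rule conn_within)
    show ?thesis
    proof (cases "u \<in> conn F' v")
      case True
      then have "conn F v \<subseteq> conn F' v" using Fv conn_eq by (metis Un_absorb)
      moreover have "conn F' v \<subseteq> conn F v" using F by (intro conn_mono) auto
      ultimately have eq: "conn F v = conn F' v" by auto
      from less.hyps[OF c'[OF order_refl] F(2) less.prems(2)[unfolded eq]]
      obtain F1 F2 w where "F1 \<subseteq> F'" "F2 \<subseteq> F'" "F1 \<inter> F2 = {}" "m \<le> card (conn F2 w \<inter> L)"
        "card (conn F2 w \<inter> L) < 2 * m" "conn F' v \<subseteq> conn F1 v \<union> conn F2 w" by blast
      moreover have "F' \<subseteq> F" using F by auto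
      ultimately show ?thesis unfolding eq by (intro exI[of _ F1] exI[of _ F2] exI[of _ w]) auto
    next
      case False
      define Fu where "Fu = {e \<in> F'. e \<subseteq> conn F' u}"
      define Gv where "Gv = {e \<in> F'. e \<subseteq> conn F' v}"
      have disjC: "conn F' u \<inter> conn F' v = {}"
        using False conn_trans[of _ F' v u] conn_sym[of _ F' u] by blast
      have cu: "conn F' u \<subseteq> conn Fu u" and cv: "conn F' v \<subseteq> conn Gv v"
        using sub unfolding Fu_def Gv_def by auto
      have sFu: "Fu \<subseteq> F'" "finite Fu" and sGv: "Gv \<subseteq> F'" "finite Gv"
        using F(2) unfolding Fu_def Gv_def by auto
      have ne: "conn F' u \<inter> L \<subseteq> L" by auto
      have disjF: "e \<notin> Gv" if "e \<in> Fu" "e \<noteq> {}" for e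
        using that disjC unfolding Fu_def Gv_def by blast
      have "card (conn F v \<inter> L) \<le> card ((conn F' v \<inter> L) \<union> (conn F' u \<inter> L))"
        using Fv assms(3) by (intro card_mono) auto
      also have "\<dots> \<le> card (conn F' v \<inter> L) + card (conn F' u \<inter> L)" by (rule card_Un_le)
      finally have "2 * m \<le> card (conn F' v \<inter> L) + card (conn F' u \<inter> L)" using big by linarith
      then consider "m \<le> card (conn F' u \<inter> L)" | "m \<le> card (conn F' v \<inter> L)" by linarith
      then show ?thesis
      proof cases
        case 1
        then have "m \<le> card (conn Fu u \<inter> L)"
          using cu assms(3) card_mono[of "conn Fu u \<inter> L" "conn F' u \<inter> L"] by fastforce
        from less.hyps[OF c'[OF sFu(1)] sFu(2) this]
        obtain F1 F2 w where h: "F1 \<subseteq> Fu" "F2 \<subseteq> Fu" "F1 \<inter> F2 = {}" "m \<le> card (conn F2 w \<inter> L)"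
          "card (conn F2 w \<inter> L) < 2 * m" "conn Fu u \<subseteq> conn F1 u \<union> conn F2 w" by blast
        \<comment> \<open>\<open>F\<close> is an arbitrary family of sets, so the empty set may
          belong to both \<open>Fu\<close> and \<open>Gv\<close>. Subtracting \<open>Fu\<close>
          removes at most this set, keeps \<open>F1'\<close> disjoint from \<open>F2\<close>, and
          changes no component by \<open>conn_remove_empty\<close>.\<close>
        define F1' where "F1' = insert {v, u} (F1 \<union> (Gv - Fu))"
        have "Gv - {{}} \<subseteq> Gv - Fu" using disjF by blast
        from conn_mono[OF this, of v] have "conn Gv v \<subseteq> conn (Gv - Fu) v"
          by (simp only: conn_remove_empty)
        moreover have "conn (Gv - Fu) v \<subseteq> conn F1' v"
          unfolding F1'_def by (rule conn_mono) blast
        ultimately have "conn F' v \<subseteq> conn F1' v"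
          using cv by blast
        moreover have "conn F1 u \<subseteq> conn F1' v"
        proof -
          have "conn F1' u = conn F1' v"
            using u(1) by (intro conn_eq, intro conn_step[OF conn_refl]) (simp_all add: F1'_def)
          moreover have "conn F1 u \<subseteq> conn F1' u" by (intro conn_mono) (auto simp: F1'_def)
          ultimately show ?thesis by simp
        qed
        ultimately have "conn F v \<subseteq> conn F1' v \<union> conn F2 w" using Fv cu h(6) by blast
        moreover have "F1' \<inter> F2 = {}"
          using h(1-3) sFu sGv unfolding F1'_def F'_def by blast
        moreover have "F1' \<subseteq> F" "F2 \<subseteq> F"
          using h(1,2) sFu sGv u(2) unfolding F1'_def F'_def by blast+
        ultimately show ?thesis using h(4,5) by blast
      next
        case 2
        then have "m \<le> card (conn Gv v \<inter> L)"
          using cv assms(3) card_mono[of "conn Gv v \<inter> L" "conn F' v \<inter> L"] by fastforce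
        from less.hyps[OF c'[OF sGv(1)] sGv(2) this]
        obtain F1 F2 w where h: "F1 \<subseteq> Gv" "F2 \<subseteq> Gv" "F1 \<inter> F2 = {}" "m \<le> card (conn F2 w \<inter> L)"
          "card (conn F2 w \<inter> L) < 2 * m" "conn Gv v \<subseteq> conn F1 v \<union> conn F2 w" by blast
        define F1' where "F1' = insert {v, u} (F1 \<union> (Fu - Gv))"
        have "Fu - {{}} \<subseteq> Fu - Gv" using disjF by blast
        from conn_mono[OF this, of u] have "conn Fu u \<subseteq> conn (Fu - Gv) u"
          by (simp only: conn_remove_empty)
        moreover have "conn (Fu - Gv) u \<subseteq> conn F1' u"
          unfolding F1'_def by (rule conn_mono) blast
        moreover have "conn F1' u = conn F1' v"
          using u(1) by (intro conn_eq, intro conn_step[OF conn_refl]) (simp_all add: F1'_def)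
        ultimately have "conn F' u \<subseteq> conn F1' v" using cu by simp
        moreover have "conn F1 v \<subseteq> conn F1' v" by (intro conn_mono) (auto simp: F1'_def)
        ultimately have "conn F v \<subseteq> conn F1' v \<union> conn F2 w" using Fv cv h(6) by blast
        moreover have "F1' \<inter> F2 = {}"
          using h(1-3) sFu sGv unfolding F1'_def F'_def by blast
        moreover have "F1' \<subseteq> F" "F2 \<subseteq> F"
          using h(1,2) sFu sGv u(2) unfolding F1'_def F'_def by blast+
        ultimately show ?thesis using h(4,5) by blast
      qed
    qed
  qed
qed

text \<open>The piece split off has weight below \<open>2 * m\<close>, so at least \<open>m\<close>
  of the \<open>3 * m\<close> remains attached to \<open>v\<close>.\<close>

lemma conn_split3:
  fixes m :: real
  assumes "finite F" "1 \<le> m" "finite L" "3 * m \<le> card (conn F v \<inter> L)"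
  shows "\<exists>F1 F2. F1 \<inter> F2 = {} \<and> F1 \<subseteq> F \<and> F2 \<subseteq> F \<and> m \<le> card (conn F1 v \<inter> L) \<and>
           (\<exists>w. m \<le> card (conn F2 w \<inter> L))"
proof -
  have "m \<le> card (conn F v \<inter> L)" using assms by linarith
  from conn_split[OF assms(1-3) this] obtain F1 F2 w where h: "F1 \<subseteq> F" "F2 \<subseteq> F" "F1 \<inter> F2 = {}"
    "m \<le> card (conn F2 w \<inter> L)" "card (conn F2 w \<inter> L) < 2 * m" "conn F v \<subseteq> conn F1 v \<union> conn F2 w"
    by auto
  have "card (conn F v \<inter> L) \<le> card ((conn F1 v \<inter> L) \<union> (conn F2 w \<inter> L))"
    using h(6) assms(3) by (intro card_mono) auto
  also have "\<dots> \<le> card (conn F1 v \<inter> L) + card (conn F2 w \<inter> L)" by (rule card_Un_le)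
  finally have "m \<le> card (conn F1 v \<inter> L)" using h(5) assms(4) by linarith
  then show ?thesis using h by (intro exI[of _ F1] exI[of _ F2]) auto
qed

section \<open>Percolation on finitely many edges\<close>

definition pw :: "('e \<Rightarrow> real) \<Rightarrow> 'e \<Rightarrow> real" where
  "pw w e = 1 - exp (- w e)"

lemma pw_bounds:
  assumes "\<And>e. 0 \<le> w e"
  shows "0 \<le> pw w e" "pw w e \<le> 1" "pw w e \<le> w e"
  using assms[of e] exp_ge_add_one_self[of "- w e"] by (auto simp: pw_def)

lemma pw_mono: "w e \<le> w' e \<Longrightarrow> pw w e \<le> pw w' e"
  by (simp add: pw_def)

definition tau :: "('v set \<Rightarrow> real) \<Rightarrow> 'v set set \<Rightarrow> 'v \<Rightarrow> 'v \<Rightarrow> real" where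
  "tau w E x y = ber (pw w) E (\<lambda>S. of_bool (y \<in> conn S x))"

lemma mono_of_bool: "(\<And>S T. S \<subseteq> T \<Longrightarrow> P S \<Longrightarrow> P T) \<Longrightarrow> mono (\<lambda>S. of_bool (P S) :: real)"
  by (intro monoI) (auto simp: of_bool_def)

lemma mono_conn: "mono (\<lambda>S. of_bool (y \<in> conn S x) :: real)"
  by (rule mono_of_bool) (rule subsetD[OF conn_mono])

lemma card_conn_mono: "finite L \<Longrightarrow> S \<subseteq> T \<Longrightarrow> card (conn S x \<inter> L) \<le> card (conn T x \<inter> L)"
  by (intro card_mono) (use conn_mono[of S T x] in auto)

section \<open>Two independent layers of edges: convolution bound, sprinkling and cluster
  tails\<close>

context
  fixes w1 w2 :: "'v set \<Rightarrow> real" and E :: "'v set set"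
  assumes w1: "\<And>e. 0 \<le> w1 e" and w2: "\<And>e. 0 \<le> w2 e"
    and fE: "finite E"
begin

lemma tau_nonneg: "0 \<le> tau w1 E x y"
  unfolding tau_def by (intro ber_nonneg pw_bounds w1) auto

lemma tau_le_1: "tau w1 E x y \<le> 1"
  unfolding tau_def by (intro ber_le_const pw_bounds w1 fE) auto

lemma ber_add_weights:
  "ber (pw (\<lambda>e. w1 e + w2 e)) E g = ber (pw w1) E (\<lambda>S. ber (pw w2) E (\<lambda>T. g (S \<union> T)))"
  by (intro ber_sprinkle fE) (simp add: pw_def flip: exp_add)

lemma finite_edge_pairs:
  assumes "E \<subseteq> edges"
  shows "finite {(a, b). a \<noteq> b \<and> {a, b} \<in> E}"
proof -
  have "finite e" if "e \<in> E" for e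
    using that assms by (intro card_ge_0_finite) (auto simp: edges_def)
  then have "finite (\<Union>E \<times> \<Union>E)" using fE by auto
  then show ?thesis by (rule rev_finite_subset) auto
qed

text \<open>The three events along the cut path (reaching \<open>a\<close> in the first layer, the
  second-layer edge \<open>{a, b}\<close>, going from \<open>b\<close> to \<open>y\<close> in both
  layers) occur on disjoint coordinates, so \<open>ber_BK\<close> is applied twice; the edge
  contributes at most its weight.\<close>

lemma tau_two_step:
  assumes "E \<subseteq> edges"
  shows "tau (\<lambda>e. w1 e + w2 e) E x y \<le> tau w1 E x y +
    (\<Sum>(a, b)\<in>{(a, b). a \<noteq> b \<and> {a, b} \<in> E}.
       w2 {a, b} * tau w1 E x a * tau (\<lambda>e. w1 e + w2 e) E b y)"
proof -
  define D where "D = {(a, b). a \<noteq> b \<and> {a, b} \<in> E}"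
  define q where "q = case_sum (pw w1) (pw w2)"
  \<comment> \<open>The left copy of an edge belongs to the layer of \<open>w1\<close>, the right
    copy to that of \<open>w2\<close>; \<open>L\<close> and \<open>R\<close> read off the two
    layers.\<close>
  define I where "I = E <+> E"
  define L where "L = (\<lambda>S :: ('v set + 'v set) set. Inl -` S)"
  define R where "R = (\<lambda>S :: ('v set + 'v set) set. Inr -` S)"
  have LR: "L (S <+> T) = S" "R (S <+> T) = T" for S T unfolding L_def R_def by auto
  have LRm: "F \<subseteq> G \<Longrightarrow> L F \<subseteq> L G" "F \<subseteq> G \<Longrightarrow> R F \<subseteq> R G" for F G unfolding L_def R_def by auto
  have q: "0 \<le> q i" "q i \<le> 1" for i
    unfolding q_def using pw_bounds(1,2)[OF w1] pw_bounds(1,2)[OF w2] by (auto split: sum.split)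
  have fI: "finite I" unfolding I_def using fE by simp
  have fD: "finite D" unfolding D_def by (rule finite_edge_pairs[OF assms])
  have berI: "ber q I g = ber (pw w1) E (\<lambda>S. ber (pw w2) E (\<lambda>T. g (S <+> T)))" for g
    unfolding q_def I_def by (intro ber_Plus fE)
  define A where "A = (\<lambda>a F. a \<in> conn (L F) x)"
  define B where "B = (\<lambda>a b F. {a, b} \<in> R F)"
  define C where "C = (\<lambda>b F. y \<in> conn (L F \<union> R F) b)"
  define BC where "BC = (\<lambda>a b F. \<exists>G H. G \<inter> H = {} \<and> G \<subseteq> F \<and> H \<subseteq> F \<and> B a b G \<and> C b H)"
  have Am: "A a F \<Longrightarrow> F \<subseteq> G \<Longrightarrow> A a G" for a F G
    unfolding A_def using conn_mono[OF LRm(1)] by blast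
  have Bm: "B a b F \<Longrightarrow> F \<subseteq> G \<Longrightarrow> B a b G" for a b F G
    unfolding B_def using LRm(2) by blast
  have Cm: "C b F \<Longrightarrow> F \<subseteq> G \<Longrightarrow> C b G" for b F G
    unfolding C_def using conn_mono[OF Un_mono[OF LRm]] by blast
  have BCm: "BC a b F \<Longrightarrow> F \<subseteq> G \<Longrightarrow> BC a b G" for a b F G
    unfolding BC_def by (meson order_trans)
  have bA: "ber q I (\<lambda>S. of_bool (A a S)) = tau w1 E x a" for a
    unfolding berI A_def LR tau_def using fE by simp
  have bC: "ber q I (\<lambda>S. of_bool (C b S)) = tau (\<lambda>e. w1 e + w2 e) E b y" for b
    unfolding berI C_def LR tau_def ber_add_weights by simp
  have bB: "ber q I (\<lambda>S. of_bool (B a b S)) = pw w2 {a, b}" if "(a, b) \<in> D" for a b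
  proof -
    have "ber (pw w2) E (\<lambda>T. of_bool ({a, b} \<in> T)) =
        ber (pw w2) E (\<lambda>T. 1 - of_bool (T \<inter> {{a, b}} = {}))"
      by (intro ber_cong) auto
    also have "\<dots> = 1 - (\<Prod>i\<in>E \<inter> {{a, b}}. 1 - pw w2 i)"
      by (simp only: ber_diff ber_avoid[OF fE] ber_const[OF fE])
    also have "E \<inter> {{a, b}} = {{a, b}}" using that unfolding D_def by auto
    finally show ?thesis unfolding berI B_def LR using fE by simp
  qed
  have pt: "of_bool (y \<in> conn (L S \<union> R S) x) \<le> (of_bool (A y S) :: real) +
     (\<Sum>(a, b)\<in>D. of_bool (\<exists>F G. F \<inter> G = {} \<and> F \<subseteq> S \<and> G \<subseteq> S \<and> A a F \<and> BC a b G))"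
    (is "_ \<le> _ + (\<Sum>(a, b)\<in>D. ?o a b)") if "S \<subseteq> I" for S
  proof (cases "y \<in> conn (L S \<union> R S) x \<and> \<not> A y S")
    case True
    have "L S \<subseteq> E" "R S \<subseteq> E" using that unfolding L_def R_def I_def by auto
    from conn_last_exit[of y "L S" "R S" x] True obtain a b where ab:
      "a \<in> conn (L S) x" "b \<notin> conn (L S) x" "{a, b} \<in> R S"
      "y \<in> conn {e \<in> L S \<union> R S. e \<inter> conn (L S) x = {}} b" unfolding A_def by auto
    have "a \<noteq> b" using ab by auto
    then have abD: "(a, b) \<in> D" using ab \<open>R S \<subseteq> E\<close> unfolding D_def by auto
    \<comment> \<open>Three witnesses: left copies inside the cluster, the crossing edge as a right
      copy, and all copies of edges avoiding the cluster.\<close>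
    define F :: "('v set + 'v set) set" where "F = Inl ` {e \<in> L S. e \<subseteq> conn (L S) x}"
    define H where "H = {i \<in> S. (case i of Inl e \<Rightarrow> e | Inr e \<Rightarrow> e) \<inter> conn (L S) x = {}}"
    define G where "G = {Inr {a, b} :: 'v set + 'v set}"
    have "L F = {e \<in> L S. e \<subseteq> conn (L S) x}" unfolding F_def L_def by auto
    then have "A a F" unfolding A_def using conn_within[OF ab(1)] by simp
    moreover have "B a b G" unfolding B_def G_def R_def by simp
    moreover have "L H \<union> R H = {e \<in> L S \<union> R S. e \<inter> conn (L S) x = {}}"
      unfolding H_def L_def R_def by auto
    then have "C b H" unfolding C_def using ab(4) by simp
    moreover have "G \<inter> H = {}" using ab(1) unfolding G_def H_def by auto
    moreover have "F \<subseteq> S" "H \<subseteq> S" "G \<subseteq> S"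
      using ab(3) unfolding F_def H_def G_def L_def R_def by auto
    \<comment> \<open>An edge that lies inside the cluster and also avoids it would be empty,
      whereas elements of \<open>E\<close> have two vertices.\<close>
    moreover have "F \<inter> (G \<union> H) = {}"
    proof -
      have "e \<noteq> {}" if "e \<in> L S" for e
        using that \<open>L S \<subseteq> E\<close> assms by (auto simp: edges_def)
      moreover have "e \<inter> U = {} \<longrightarrow> e \<subseteq> U \<longrightarrow> e = {}" for e U :: "'v set" by blast
      ultimately show ?thesis unfolding F_def G_def H_def by fastforce
    qed
    ultimately have "A a F" "BC a b (G \<union> H)" "F \<inter> (G \<union> H) = {}" "F \<subseteq> S" "G \<union> H \<subseteq> S"
      unfolding BC_def by blast+
    then have "\<exists>F G. F \<inter> G = {} \<and> F \<subseteq> S \<and> G \<subseteq> S \<and> A a F \<and> BC a b G" by blast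
    then have "?o a b = 1" by simp
    moreover have "(case (a, b) of (a, b) \<Rightarrow> ?o a b) \<le> (\<Sum>d\<in>D. case d of (a, b) \<Rightarrow> ?o a b)"
      using fD by (intro member_le_sum abD) (auto split: prod.split)
    ultimately have "1 \<le> (\<Sum>(a, b)\<in>D. ?o a b)" by (simp only: prod.case)
    then show ?thesis using True by simp
  next
    case False
    have "0 \<le> (\<Sum>(a, b)\<in>D. ?o a b)" by (intro sum_nonneg) auto
    then show ?thesis using False by (auto simp: of_bool_def)
  qed
  have "tau (\<lambda>e. w1 e + w2 e) E x y = ber q I (\<lambda>S. of_bool (y \<in> conn (L S \<union> R S) x))"
    unfolding tau_def ber_add_weights berI LR by simp
  also have "\<dots> \<le> ber q I (\<lambda>S. of_bool (A y S) + (\<Sum>d\<in>D. case d of (a, b) \<Rightarrow>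
      of_bool (\<exists>F G. F \<inter> G = {} \<and> F \<subseteq> S \<and> G \<subseteq> S \<and> A a F \<and> BC a b G)))"
    by (intro ber_mono q pt)
  also have "\<dots> = tau w1 E x y + (\<Sum>d\<in>D. ber q I (\<lambda>S. case d of (a, b) \<Rightarrow>
      of_bool (\<exists>F G. F \<inter> G = {} \<and> F \<subseteq> S \<and> G \<subseteq> S \<and> A a F \<and> BC a b G)))"
    by (simp add: ber_add ber_sum bA)
  also have "(\<Sum>d\<in>D. ber q I (\<lambda>S. case d of (a, b) \<Rightarrow>
      of_bool (\<exists>F G. F \<inter> G = {} \<and> F \<subseteq> S \<and> G \<subseteq> S \<and> A a F \<and> BC a b G))) \<le>
      (\<Sum>(a, b)\<in>D. w2 {a, b} * tau w1 E x a * tau (\<lambda>e. w1 e + w2 e) E b y)"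
  proof (intro sum_mono, clarify)
    fix a b assume ab: "(a, b) \<in> D"
    have nn: "0 \<le> tau w1 E x a" "0 \<le> tau (\<lambda>e. w1 e + w2 e) E b y"
      unfolding bA[symmetric] bC[symmetric] by (intro ber_nonneg q; simp)+
    have "ber q I (\<lambda>S. of_bool (\<exists>F G. F \<inter> G = {} \<and> F \<subseteq> S \<and> G \<subseteq> S \<and> A a F \<and> BC a b G))
        \<le> tau w1 E x a * ber q I (\<lambda>S. of_bool (BC a b S))"
      unfolding bA[symmetric] by (intro ber_BK fI q) (fact Am, fact BCm)
    also have "\<dots> \<le> tau w1 E x a * (w2 {a, b} * tau (\<lambda>e. w1 e + w2 e) E b y)"
    proof (intro mult_left_mono nn(1))
    have "ber q I (\<lambda>S. of_bool (BC a b S)) \<le> pw w2 {a, b} * tau (\<lambda>e. w1 e + w2 e) E b y"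
      unfolding bB[OF ab, symmetric] bC[symmetric] BC_def by (intro ber_BK fI q) (fact Bm, fact Cm)
    also have "\<dots> \<le> w2 {a, b} * tau (\<lambda>e. w1 e + w2 e) E b y"
      using pw_bounds[OF w2] nn by (intro mult_right_mono) auto
    finally show "ber q I (\<lambda>S. of_bool (BC a b S)) \<le> w2 {a, b} * tau (\<lambda>e. w1 e + w2 e) E b y" .
    qed
    finally show "ber q I (\<lambda>S. of_bool (\<exists>F G. F \<inter> G = {} \<and> F \<subseteq> S \<and> G \<subseteq> S \<and> A a F \<and> BC a b G))
       \<le> w2 {a, b} * tau w1 E x a * tau (\<lambda>e. w1 e + w2 e) E b y"
      by (simp add: mult_ac)
  qed
  finally show ?thesis unfolding D_def by simp
qed

text \<open>Disjointness of \<open>A\<close> and \<open>B\<close> makes the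
  \<open>card A * card B\<close> connecting edges distinct, and all of them are closed with
  probability at most \<open>exp (- \<kappa> * (card A * card B))\<close>.\<close>

lemma sprinkle_connects:
  fixes \<kappa> :: real
  assumes "finite A" "finite B" "A \<inter> B = {}" "A \<subseteq> conn S x" "B \<subseteq> conn S z"
    and "\<And>a b. a \<in> A \<Longrightarrow> b \<in> B \<Longrightarrow> {a, b} \<in> E \<and> \<kappa> \<le> w2 {a, b}"
  shows "1 - exp (- \<kappa> * (card A * card B)) \<le> ber (pw w2) E (\<lambda>T. of_bool (z \<in> conn (S \<union> T) x))"
proof -
  define X where "X = (\<lambda>(a, b). {a, b}) ` (A \<times> B)"
  have inj: "inj_on (\<lambda>(a, b). {a, b}) (A \<times> B)"
    using assms(3) by (auto simp: inj_on_def doubleton_eq_iff)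
  have cX: "card X = card A * card B" unfolding X_def using inj assms(1,2)
    by (simp add: card_image card_cartesian_product)
  have XE: "E \<inter> X = X" unfolding X_def using assms(6) by auto
  have fX: "finite X" unfolding X_def using assms(1,2) by auto
  have wX: "\<kappa> \<le> w2 e" if "e \<in> X" for e using that assms(6) unfolding X_def by auto
  have "(\<Prod>e\<in>E \<inter> X. 1 - pw w2 e) = exp (- (\<Sum>e\<in>X. w2 e))"
    unfolding XE pw_def using exp_sum[OF fX, of "\<lambda>e. - w2 e"] by (simp add: sum_negf)
  also have "\<dots> \<le> exp (- (\<kappa> * (card A * card B)))"
    using sum_bounded_below[of X \<kappa> w2] wX by (simp add: cX mult.commute)
  finally have "1 - exp (- \<kappa> * (card A * card B)) \<le> 1 - (\<Prod>e\<in>E \<inter> X. 1 - pw w2 e)" by simp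
  also have "\<dots> = ber (pw w2) E (\<lambda>T. 1 - of_bool (T \<inter> X = {}))"
    using fE by (simp add: ber_diff ber_avoid)
  also have "\<dots> \<le> ber (pw w2) E (\<lambda>T. of_bool (z \<in> conn (S \<union> T) x))"
  proof (intro ber_mono pw_bounds w2)
    fix T
    show "1 - of_bool (T \<inter> X = {}) \<le> (of_bool (z \<in> conn (S \<union> T) x) :: real)"
    proof (cases "T \<inter> X = {}")
      case False
      then obtain a b where ab: "a \<in> A" "b \<in> B" "{a, b} \<in> T" unfolding X_def by auto
      have "a \<in> conn (S \<union> T) x" using ab assms(4) conn_mono[of S "S \<union> T" x] by auto
      moreover have "b \<in> conn (S \<union> T) a"
        using ab assms(3) by (intro conn_step[OF conn_refl]) auto
      moreover have "z \<in> conn (S \<union> T) b"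
        using ab assms(5) conn_mono[of S "S \<union> T" z] by (auto intro!: conn_sym[of b _ z])
      ultimately have "z \<in> conn (S \<union> T) x" by (blast intro: conn_trans)
      then show ?thesis by simp
    qed simp
  qed
  finally show ?thesis .
qed

text \<open>Truncated cluster sizes are increasing, so Harris' inequality bounds the mean of their
  product from below. Given the first layer, the second one joins the two clusters with a
  probability bounded below by a linear function of that product. Truncation at \<open>m\<close> is
  what permits the linear bound.\<close>

lemma tau_ge_truncated:
  fixes \<kappa> m :: real
  assumes L: "finite L0" "finite Lz" and m: "0 < m" and \<kappa>: "0 \<le> \<kappa>"
    and "\<And>a b. a \<in> L0 \<Longrightarrow> b \<in> Lz \<Longrightarrow> a \<noteq> b \<Longrightarrow> {a, b} \<in> E \<and> \<kappa> \<le> w2 {a, b}"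
  shows "(1 - exp (- \<kappa> * m\<^sup>2)) / m\<^sup>2 *
      (ber (pw w1) E (\<lambda>S. min (card (conn S x \<inter> L0)) m) *
       ber (pw w1) E (\<lambda>S. min (card (conn S z \<inter> Lz)) m)) \<le> tau (\<lambda>e. w1 e + w2 e) E x z"
proof -
  define f where "f = (\<lambda>S. min (real (card (conn S x \<inter> L0))) m)"
  define g where "g = (\<lambda>S. min (real (card (conn S z \<inter> Lz))) m)"
  define c where "c = (1 - exp (- \<kappa> * m\<^sup>2)) / m\<^sup>2"
  have fg: "0 \<le> f S" "f S \<le> m" "0 \<le> g S" "g S \<le> m" for S using m unfolding f_def g_def by auto
  have c: "0 \<le> c" unfolding c_def using \<kappa> by simp
  have mf: "mono f" "mono g"
    unfolding f_def g_def by (auto intro!: monoI min.mono card_conn_mono L)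
  have "c * (ber (pw w1) E f * ber (pw w1) E g) \<le> c * ber (pw w1) E (\<lambda>S. f S * g S)"
    by (intro mult_left_mono ber_harris fE pw_bounds w1 mf c)
  also have "\<dots> = ber (pw w1) E (\<lambda>S. c * (f S * g S))" by (simp add: ber_cmult)
  also have "\<dots> \<le> ber (pw w1) E (\<lambda>S. ber (pw w2) E (\<lambda>T. of_bool (z \<in> conn (S \<union> T) x)))"
  proof (intro ber_mono pw_bounds w1)
    fix S
    define u where "u = f S * g S / m\<^sup>2"
    have "f S * g S \<le> m * m" by (intro mult_mono fg) (use m in auto)
    then have u: "0 \<le> u" "u \<le> 1" using fg[of S] m unfolding u_def by (auto simp: power2_eq_square)
    have cu: "c * (f S * g S) = u * (1 - exp (- \<kappa> * m\<^sup>2))" unfolding c_def u_def by simp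
    show "c * (f S * g S) \<le> ber (pw w2) E (\<lambda>T. of_bool (z \<in> conn (S \<union> T) x))"
    proof (cases "z \<in> conn S x")
      case True
      have "z \<in> conn (S \<union> T) x" for T using True conn_mono[of S "S \<union> T" x] by auto
      then have "ber (pw w2) E (\<lambda>T. of_bool (z \<in> conn (S \<union> T) x)) = 1" using fE by simp
      moreover have "u * (1 - exp (- \<kappa> * m\<^sup>2)) \<le> 1 * 1" using u \<kappa> by (intro mult_mono) auto
      ultimately show ?thesis unfolding cu by simp
    next
      case False
      then have disj: "conn S x \<inter> conn S z = {}" by (blast intro: conn_trans conn_sym)
      \<comment> \<open>Convexity of \<open>exp\<close> on the segment from 0 to
        \<open>- \<kappa> * m^2\<close>, at the point with parameter \<open>u\<close> in
        [0, 1].\<close>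
      have "u * (1 - exp (- \<kappa> * m\<^sup>2)) \<le> 1 - exp (- \<kappa> * (f S * g S))"
      proof -
        have "exp (- \<kappa> * (f S * g S)) = exp ((1 - u) *\<^sub>R 0 + u *\<^sub>R (- \<kappa> * m\<^sup>2))"
          using m unfolding u_def by simp
        also have "\<dots> \<le> (1 - u) * exp 0 + u * exp (- \<kappa> * m\<^sup>2)"
          by (rule convex_onD[OF exp_convex u]) auto
        finally show ?thesis by (simp add: algebra_simps)
      qed
      also have "\<dots> \<le> 1 - exp (- \<kappa> * (card (conn S x \<inter> L0) * card (conn S z \<inter> Lz)))"
      proof -
        have "f S * g S \<le> real (card (conn S x \<inter> L0)) * real (card (conn S z \<inter> Lz))"
          unfolding f_def g_def using m by (intro mult_mono) auto
        then show ?thesis using \<kappa> by (simp add: mult_left_mono)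
      qed
      also have "\<dots> \<le> ber (pw w2) E (\<lambda>T. of_bool (z \<in> conn (S \<union> T) x))"
        using L disj by (intro sprinkle_connects assms(5)) auto
      finally show ?thesis unfolding cu .
    qed
  qed
  also have "\<dots> = tau (\<lambda>e. w1 e + w2 e) E x z" unfolding tau_def ber_add_weights ..
  finally show ?thesis unfolding c_def f_def g_def .
qed

text \<open>Two union bounds: one over the boxes lacking a cluster of size \<open>m\<close> in the
  first layer, one over the neighbouring pairs that the second layer fails to join. On the remaining
  event at least \<open>m^2\<close> pairs of points in the two end boxes are connected.\<close>

lemma tau_chain:
  fixes \<kappa> \<epsilon> m :: real and Lam :: "nat \<Rightarrow> 'v set"
  assumes L: "\<And>i. finite (Lam i)" and m: "0 \<le> m" and \<kappa>: "0 \<le> \<kappa>"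
    and big: "\<And>i. i \<le> D \<Longrightarrow> 1 - \<epsilon> \<le> ber (pw w1) E (\<lambda>S. of_bool (\<exists>v. m \<le> card (conn S v \<inter> Lam i)))"
    and edge: "\<And>i a b. i < D \<Longrightarrow> a \<in> Lam i \<Longrightarrow> b \<in> Lam (Suc i) \<Longrightarrow> a \<noteq> b \<Longrightarrow> {a, b} \<in> E \<and> \<kappa> \<le> w2 {a, b}"
  shows "m\<^sup>2 * (1 - (real D + 1) * \<epsilon> - D * exp (- \<kappa> * m\<^sup>2)) \<le>
     (\<Sum>x\<in>Lam 0. \<Sum>y\<in>Lam D. tau (\<lambda>e. w1 e + w2 e) E x y)"
proof -
  define good where "good = (\<lambda>S i. \<exists>v. m \<le> card (conn S v \<inter> Lam i))"
  define G where "G = (\<lambda>S. \<forall>i\<le>D. good S i)"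
  have exp0: "0 \<le> D * exp (- \<kappa> * m\<^sup>2)" by simp
  have PG: "1 - (real D + 1) * \<epsilon> \<le> ber (pw w1) E (\<lambda>S. of_bool (G S))"
  proof -
    have pt: "1 - of_bool (G S) \<le> (\<Sum>i\<le>D. 1 - of_bool (good S i) :: real)" for S
    proof (cases "G S")
      case False
      then obtain i where i: "i \<le> D" "\<not> good S i" unfolding G_def by auto
      then have "(1 :: real) - of_bool (good S i) \<le> (\<Sum>i\<le>D. 1 - of_bool (good S i) :: real)"
        by (intro member_le_sum) auto
      then show ?thesis using i False by simp
    qed (auto intro!: sum_nonneg)
    have "1 - ber (pw w1) E (\<lambda>S. of_bool (G S)) = ber (pw w1) E (\<lambda>S. 1 - of_bool (G S))"
      using fE by (simp add: ber_diff)
    also have "\<dots> \<le> ber (pw w1) E (\<lambda>S. \<Sum>i\<le>D. 1 - of_bool (good S i))"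
      by (intro ber_mono pw_bounds w1 pt)
    also have "\<dots> = (\<Sum>i\<le>D. 1 - ber (pw w1) E (\<lambda>S. of_bool (good S i)))"
      using fE by (simp add: ber_sum ber_diff)
    also have "\<dots> \<le> (\<Sum>i\<le>D. \<epsilon>)"
      using big unfolding good_def by (intro sum_mono) (simp add: algebra_simps)
    finally show ?thesis by (simp add: algebra_simps)
  qed
  have main: "m\<^sup>2 * (of_bool (G S) - D * exp (- \<kappa> * m\<^sup>2)) \<le>
      ber (pw w2) E (\<lambda>T. \<Sum>x\<in>Lam 0. \<Sum>y\<in>Lam D. of_bool (y \<in> conn (S \<union> T) x))" for S
  proof (cases "G S")
    case True
    \<comment> \<open>One large cluster per box is fixed as a function of the first layer only, so
      the second layer remains independent of the choice.\<close>
    then have "\<forall>i. \<exists>v. i \<le> D \<longrightarrow> m \<le> card (conn S v \<inter> Lam i)" unfolding G_def good_def by auto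
    then obtain v where v: "\<And>i. i \<le> D \<Longrightarrow> m \<le> card (conn S (v i) \<inter> Lam i)" by metis
    have link: "1 - exp (- \<kappa> * m\<^sup>2) \<le> ber (pw w2) E (\<lambda>T. of_bool (v (Suc i) \<in> conn (S \<union> T) (v i)))"
      if "i < D" for i
    proof (cases "v (Suc i) \<in> conn S (v i)")
      case True
      have "v (Suc i) \<in> conn (S \<union> T) (v i)" for T using True conn_mono[of S "S \<union> T"] by auto
      then show ?thesis using fE by simp
    next
      case False
      then have disj: "conn S (v i) \<inter> conn S (v (Suc i)) = {}"
        by (blast intro: conn_trans conn_sym)
      have "m * m \<le> real (card (conn S (v i) \<inter> Lam i)) * real (card (conn S (v (Suc i)) \<inter> Lam (Suc i)))"
        using v[of i] v[of "Suc i"] that m by (intro mult_mono) auto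
      then have "1 - exp (- \<kappa> * m\<^sup>2) \<le>
          1 - exp (- \<kappa> * (card (conn S (v i) \<inter> Lam i) * card (conn S (v (Suc i)) \<inter> Lam (Suc i))))"
        using \<kappa> by (simp add: mult_left_mono power2_eq_square)
      also have "\<dots> \<le> ber (pw w2) E (\<lambda>T. of_bool (v (Suc i) \<in> conn (S \<union> T) (v i)))"
        using L disj that by (intro sprinkle_connects edge) auto
      finally show ?thesis .
    qed
    define Q where "Q = (\<lambda>T. \<forall>i<D. v (Suc i) \<in> conn (S \<union> T) (v i))"
    have "1 - ber (pw w2) E (\<lambda>T. of_bool (Q T)) = ber (pw w2) E (\<lambda>T. 1 - of_bool (Q T))"
      using fE by (simp add: ber_diff)
    also have "\<dots> \<le> ber (pw w2) E (\<lambda>T. \<Sum>i<D. 1 - of_bool (v (Suc i) \<in> conn (S \<union> T) (v i)))"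
    proof (intro ber_mono pw_bounds w2)
      fix T
      show "1 - of_bool (Q T) \<le> (\<Sum>i<D. 1 - of_bool (v (Suc i) \<in> conn (S \<union> T) (v i)) :: real)"
      proof (cases "Q T")
        case False
        then obtain i where i: "i < D" "v (Suc i) \<notin> conn (S \<union> T) (v i)" unfolding Q_def by auto
        then have "(1 :: real) - of_bool (v (Suc i) \<in> conn (S \<union> T) (v i)) \<le>
            (\<Sum>i<D. 1 - of_bool (v (Suc i) \<in> conn (S \<union> T) (v i)) :: real)"
          by (intro member_le_sum) auto
        then show ?thesis using i False by simp
      qed (auto intro!: sum_nonneg)
    qed
    also have "\<dots> = (\<Sum>i<D. 1 - ber (pw w2) E (\<lambda>T. of_bool (v (Suc i) \<in> conn (S \<union> T) (v i))))"
      using fE by (simp add: ber_sum ber_diff)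
    also have "\<dots> \<le> (\<Sum>i<D. exp (- \<kappa> * m\<^sup>2))" using link by (intro sum_mono) (simp add: algebra_simps)
    finally have PQ: "1 - D * exp (- \<kappa> * m\<^sup>2) \<le> ber (pw w2) E (\<lambda>T. of_bool (Q T))" by simp
    have "m\<^sup>2 * (1 - D * exp (- \<kappa> * m\<^sup>2)) \<le> m\<^sup>2 * ber (pw w2) E (\<lambda>T. of_bool (Q T))"
      by (intro mult_left_mono PQ) auto
    also have "\<dots> = ber (pw w2) E (\<lambda>T. m\<^sup>2 * of_bool (Q T))" by (simp add: ber_cmult)
    also have "\<dots> \<le> ber (pw w2) E (\<lambda>T. \<Sum>x\<in>Lam 0. \<Sum>y\<in>Lam D. of_bool (y \<in> conn (S \<union> T) x))"
    proof (intro ber_mono pw_bounds w2)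
      fix T
      show "m\<^sup>2 * of_bool (Q T) \<le> (\<Sum>x\<in>Lam 0. \<Sum>y\<in>Lam D. of_bool (y \<in> conn (S \<union> T) x) :: real)"
      proof (cases "Q T")
        case True
        have all: "i \<le> D \<Longrightarrow> v i \<in> conn (S \<union> T) (v 0)" for i
        proof (induction i)
          case (Suc i)
          then show ?case using True conn_trans[of "v i" "S \<union> T" "v 0" "v (Suc i)"] unfolding Q_def by auto
        qed auto
        have in_conn: "y \<in> conn (S \<union> T) x" if "x \<in> conn S (v 0)" "y \<in> conn S (v D)" for x y
        proof -
          have "x \<in> conn (S \<union> T) (v 0)" "y \<in> conn (S \<union> T) (v D)"
            using that conn_mono[of S "S \<union> T"] by auto
          moreover have "v D \<in> conn (S \<union> T) (v 0)" using all by blast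
          ultimately show ?thesis by (blast intro: conn_trans conn_sym)
        qed
        have "m * m \<le> real (card (conn S (v 0) \<inter> Lam 0)) * real (card (conn S (v D) \<inter> Lam D))"
          using v[of 0] v[of D] m by (intro mult_mono) auto
        also have "\<dots> = (\<Sum>x\<in>conn S (v 0) \<inter> Lam 0. \<Sum>y\<in>conn S (v D) \<inter> Lam D. of_bool (y \<in> conn (S \<union> T) x))"
          using in_conn by simp
        also have "\<dots> \<le> (\<Sum>x\<in>conn S (v 0) \<inter> Lam 0. \<Sum>y\<in>Lam D. of_bool (y \<in> conn (S \<union> T) x))"
          by (intro sum_mono sum_mono2 L) auto
        also have "\<dots> \<le> (\<Sum>x\<in>Lam 0. \<Sum>y\<in>Lam D. of_bool (y \<in> conn (S \<union> T) x))"
          by (intro sum_mono2 L sum_nonneg) auto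
        finally show ?thesis using True by (simp add: power2_eq_square)
      qed (auto intro!: sum_nonneg)
    qed
    finally show ?thesis using True by simp
  next
    case False
    have "m\<^sup>2 * (of_bool (G S) - D * exp (- \<kappa> * m\<^sup>2)) \<le> 0"
      using False by (simp add: mult_nonneg_nonpos)
    also have "0 \<le> ber (pw w2) E (\<lambda>T. \<Sum>x\<in>Lam 0. \<Sum>y\<in>Lam D. of_bool (y \<in> conn (S \<union> T) x))"
      by (intro ber_nonneg pw_bounds w2 sum_nonneg) auto
    finally show ?thesis .
  qed
  have "m\<^sup>2 * (1 - (real D + 1) * \<epsilon> - D * exp (- \<kappa> * m\<^sup>2)) \<le>
      m\<^sup>2 * (ber (pw w1) E (\<lambda>S. of_bool (G S)) - D * exp (- \<kappa> * m\<^sup>2))"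
    using PG by (intro mult_left_mono) auto
  also have "\<dots> = ber (pw w1) E (\<lambda>S. m\<^sup>2 * (of_bool (G S) - D * exp (- \<kappa> * m\<^sup>2)))"
    using fE by (simp add: ber_diff ber_cmult)
  also have "\<dots> \<le> ber (pw w1) E (\<lambda>S. ber (pw w2) E (\<lambda>T. \<Sum>x\<in>Lam 0. \<Sum>y\<in>Lam D. of_bool (y \<in> conn (S \<union> T) x)))"
    by (intro ber_mono pw_bounds w1 main)
  also have "\<dots> = (\<Sum>x\<in>Lam 0. \<Sum>y\<in>Lam D. tau (\<lambda>e. w1 e + w2 e) E x y)"
    unfolding tau_def ber_add_weights by (simp add: ber_sum)
  finally show ?thesis .
qed

text \<open>One witness keeps the vertex \<open>v\<close>, so the tail at \<open>v\<close> contracts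
  by the probability that some large cluster exists, not merely by a bound on the maximum.\<close>

lemma tail_at_vertex:
  assumes "finite L" "1 \<le> (m :: real)"
  shows "ber (pw w1) E (\<lambda>S. of_bool (3 * m \<le> card (conn S v \<inter> L))) \<le>
    ber (pw w1) E (\<lambda>S. of_bool (m \<le> card (conn S v \<inter> L))) *
    ber (pw w1) E (\<lambda>S. of_bool (\<exists>w. m \<le> card (conn S w \<inter> L)))"
proof -
  have "ber (pw w1) E (\<lambda>S. of_bool (3 * m \<le> card (conn S v \<inter> L))) \<le>
     ber (pw w1) E (\<lambda>S. of_bool (\<exists>F G. F \<inter> G = {} \<and> F \<subseteq> S \<and> G \<subseteq> S \<and>
        m \<le> card (conn F v \<inter> L) \<and> (\<exists>w. m \<le> card (conn G w \<inter> L))))"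
  proof (intro ber_mono pw_bounds w1)
    fix S assume "S \<subseteq> E"
    then have "finite S" using fE finite_subset by auto
    from conn_split3[OF this assms(2,1), of v]
    show "of_bool (3 * m \<le> card (conn S v \<inter> L)) \<le> (of_bool (\<exists>F G. F \<inter> G = {} \<and> F \<subseteq> S \<and> G \<subseteq> S \<and>
        m \<le> card (conn F v \<inter> L) \<and> (\<exists>w. m \<le> card (conn G w \<inter> L))) :: real)"
      by (cases "3 * m \<le> card (conn S v \<inter> L)") auto
  qed
  also have "\<dots> \<le> ber (pw w1) E (\<lambda>S. of_bool (m \<le> card (conn S v \<inter> L))) *
    ber (pw w1) E (\<lambda>S. of_bool (\<exists>w. m \<le> card (conn S w \<inter> L)))"
    by (intro ber_BK fE pw_bounds w1)
      (meson card_conn_mono[OF assms(1)] of_nat_mono order_trans)+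
  finally show ?thesis .
qed

text \<open>Both pieces of a cluster of size \<open>3 * m\<close> are large, and they are
  edge-disjoint witnesses of the same event: tripling the size squares the probability.\<close>

lemma tail_of_maximum:
  assumes "finite L" "1 \<le> (m :: real)"
  shows "ber (pw w1) E (\<lambda>S. of_bool (\<exists>v. 3 * m \<le> card (conn S v \<inter> L))) \<le>
    (ber (pw w1) E (\<lambda>S. of_bool (\<exists>w. m \<le> card (conn S w \<inter> L))))\<^sup>2"
proof -
  have "ber (pw w1) E (\<lambda>S. of_bool (\<exists>v. 3 * m \<le> card (conn S v \<inter> L))) \<le>
     ber (pw w1) E (\<lambda>S. of_bool (\<exists>F G. F \<inter> G = {} \<and> F \<subseteq> S \<and> G \<subseteq> S \<and>
        (\<exists>w. m \<le> card (conn F w \<inter> L)) \<and> (\<exists>w. m \<le> card (conn G w \<inter> L))))"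
  proof (intro ber_mono pw_bounds w1)
    fix S assume "S \<subseteq> E"
    then have "finite S" using fE finite_subset by auto
    from conn_split3[OF this assms(2,1)]
    have "(\<exists>v. 3 * m \<le> card (conn S v \<inter> L)) \<longrightarrow> (\<exists>F G. F \<inter> G = {} \<and> F \<subseteq> S \<and> G \<subseteq> S \<and>
        (\<exists>w. m \<le> card (conn F w \<inter> L)) \<and> (\<exists>w. m \<le> card (conn G w \<inter> L)))" by meson
    then show "of_bool (\<exists>v. 3 * m \<le> card (conn S v \<inter> L)) \<le> (of_bool (\<exists>F G. F \<inter> G = {} \<and> F \<subseteq> S \<and> G \<subseteq> S \<and>
        (\<exists>w. m \<le> card (conn F w \<inter> L)) \<and> (\<exists>w. m \<le> card (conn G w \<inter> L))) :: real)"
      by (cases "\<exists>v. 3 * m \<le> card (conn S v \<inter> L)") auto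
  qed
  also have "\<dots> \<le> ber (pw w1) E (\<lambda>S. of_bool (\<exists>w. m \<le> card (conn S w \<inter> L))) *
    ber (pw w1) E (\<lambda>S. of_bool (\<exists>w. m \<le> card (conn S w \<inter> L)))"
    by (intro ber_BK fE pw_bounds w1)
      (meson card_conn_mono[OF assms(1)] of_nat_mono order_trans)+
  finally show ?thesis by (simp add: power2_eq_square)
qed

text \<open>Above \<open>m\<close>, the single layer with
  \<open>3^j * m \<le> X < 3^(j + 1) * m\<close> already dominates \<open>X\<close>.\<close>

lemma sum_layers:
  fixes X m :: real
  assumes "0 < m" "X < 3 ^ n * m"
  shows "X \<le> min X m + (\<Sum>j<n. 3 ^ (j + 1) * m * of_bool (3 ^ j * m \<le> X))"
  using assms(2)
proof (induction n)
  case (Suc n)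
  have nn: "0 \<le> (\<Sum>j<n. 3 ^ (j + 1) * m * of_bool (3 ^ j * m \<le> X))"
    using assms by (intro sum_nonneg) auto
  show ?case
  proof (cases "3 ^ n * m \<le> X")
    case True
    moreover have "1 * m \<le> 3 ^ n * m" using assms(1) by (intro mult_right_mono) auto
    ultimately show ?thesis using Suc.prems nn assms(1) by (simp add: min_def)
  qed (use Suc in auto)
qed (use assms in auto)

text \<open>Each tripling multiplies the tail at \<open>v\<close> by at most 1/9 and the size by 3,
  so the layers form a geometric series of ratio 1/3. The total is at most
  \<open>1 + 3 * (3 / 2) = 11 / 2\<close> truncated means, rounded up to 6.\<close>

lemma mean_le_truncated_mean:
  fixes m :: real
  assumes L: "finite L" and m: "1 \<le> m"
    and rare: "ber (pw w1) E (\<lambda>S. of_bool (\<exists>w. m \<le> card (conn S w \<inter> L))) \<le> 1 / 9"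
  shows "ber (pw w1) E (\<lambda>S. card (conn S v \<inter> L)) \<le> 6 * ber (pw w1) E (\<lambda>S. min (card (conn S v \<inter> L)) m)"
proof -
  define P where "P = (\<lambda>t. ber (pw w1) E (\<lambda>S. of_bool (t \<le> real (card (conn S v \<inter> L)))))"
  define f where "f = ber (pw w1) E (\<lambda>S. min (card (conn S v \<inter> L)) m)"
  have P0: "0 \<le> P t" for t unfolding P_def by (intro ber_nonneg pw_bounds w1) auto
  have step: "P (3 ^ Suc j * m) \<le> P (3 ^ j * m) * (1 / 9)" for j
  proof -
    have j1: "1 \<le> 3 ^ j * m" "m \<le> 3 ^ j * m"
      using m one_le_power[of "3::real" j] mult_mono[of 1 "3 ^ j" 1 m] mult_right_mono[of 1 "3 ^ j" m] by auto
    have "P (3 ^ Suc j * m) \<le> P (3 ^ j * m) * ber (pw w1) E (\<lambda>S. of_bool (\<exists>w. 3 ^ j * m \<le> card (conn S w \<inter> L)))"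
      using tail_at_vertex[OF L j1(1), of v] unfolding P_def by (simp add: mult.assoc)
    also have "ber (pw w1) E (\<lambda>S. of_bool (\<exists>w. 3 ^ j * m \<le> card (conn S w \<inter> L))) \<le>
       ber (pw w1) E (\<lambda>S. of_bool (\<exists>w. m \<le> card (conn S w \<inter> L)))"
      using j1(2) by (intro ber_mono pw_bounds w1) (auto simp: of_bool_def intro: order_trans)
    finally show ?thesis using rare P0[of "3 ^ j * m"] by (meson mult_left_mono order_trans)
  qed
  have Pj: "P (3 ^ j * m) \<le> (1 / 9) ^ j * P m" for j
  proof (induction j)
    case (Suc j)
    then show ?case using step[of j] by simp
  qed simp
  have fP: "m * P m \<le> f"
  proof -
    have "m * P m = ber (pw w1) E (\<lambda>S. m * of_bool (m \<le> card (conn S v \<inter> L)))"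
      unfolding P_def by (simp add: ber_cmult)
    also have "\<dots> \<le> f" unfolding f_def using m by (intro ber_mono pw_bounds w1) (auto simp: of_bool_def)
    finally show ?thesis .
  qed
  obtain n where n: "real (card L) < 3 ^ n"
    using real_arch_pow[of 3 "real (card L)"] by auto
  have Xn: "real (card (conn S v \<inter> L)) < 3 ^ n * m" for S
  proof -
    have "real (card (conn S v \<inter> L)) \<le> card L" using L by (intro of_nat_mono card_mono) auto
    also have "\<dots> < 3 ^ n * 1" using n by simp
    also have "\<dots> \<le> 3 ^ n * m" using m by (intro mult_left_mono) auto
    finally show ?thesis .
  qed
  have "ber (pw w1) E (\<lambda>S. card (conn S v \<inter> L)) \<le> ber (pw w1) E (\<lambda>S. min (card (conn S v \<inter> L)) m +
      (\<Sum>j<n. (3 ^ (j + 1) * m) * of_bool (3 ^ j * m \<le> real (card (conn S v \<inter> L)))))"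
    using m Xn by (intro ber_mono pw_bounds w1 sum_layers) auto
  also have "\<dots> = f + (\<Sum>j<n. 3 ^ (j + 1) * m * P (3 ^ j * m))"
    unfolding P_def f_def by (simp only: ber_add ber_sum ber_cmult)
  also have "(\<Sum>j<n. 3 ^ (j + 1) * m * P (3 ^ j * m)) \<le> (\<Sum>j<n. 3 * (m * P m) * (1 / 3) ^ j)"
  proof (intro sum_mono)
    fix j
    have "3 ^ (j + 1) * m * P (3 ^ j * m) \<le> 3 ^ (j + 1) * m * ((1 / 9) ^ j * P m)"
      using m by (intro mult_left_mono Pj) auto
    also have "\<dots> = 3 * (m * P m) * (3 ^ j * (1 / 9) ^ j)" by simp
    also have "(3 :: real) ^ j * (1 / 9) ^ j = (1 / 3) ^ j" by (simp flip: power_mult_distrib)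
    finally show "3 ^ (j + 1) * m * P (3 ^ j * m) \<le> 3 * (m * P m) * (1 / 3) ^ j" .
  qed
  also have "\<dots> = 3 * (m * P m) * (\<Sum>j<n. (1 / 3) ^ j)" by (simp add: sum_distrib_left)
  also have "\<dots> \<le> 3 * (m * P m) * (3 / 2)"
  proof (intro mult_left_mono)
    have "(\<Sum>j<n. (1 / 3 :: real) ^ j) \<le> (\<Sum>j. (1 / 3) ^ j)"
      by (intro sum_le_suminf) (auto intro: summable_geometric)
    then show "(\<Sum>j<n. (1 / 3 :: real) ^ j) \<le> 3 / 2" by (simp add: suminf_geometric)
  qed (use m P0 in auto)
  also have "\<dots> \<le> 3 * f * (3 / 2)" using fP by simp
  finally have "ber (pw w1) E (\<lambda>S. card (conn S v \<inter> L)) \<le> f + 3 * f * (3 / 2)" by simp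
  moreover have "0 \<le> f" unfolding f_def using m by (intro ber_nonneg pw_bounds w1) auto
  ultimately show ?thesis unfolding f_def[symmetric] by linarith
qed

end

section \<open>Infinite volume limits\<close>

abbreviation finite_edge_sets :: "'v set set filter" where
  "finite_edge_sets \<equiv> finite_subsets_at_top edges"

text \<open>For monotone \<open>g\<close> this supremum is the limit of the expectations over finite edge sets, which is
  what lets all probability be done on finite sets of edges.\<close>

definition expec :: "('v set \<Rightarrow> real) \<Rightarrow> ('v set set \<Rightarrow> real) \<Rightarrow> real" where
  "expec w g = (SUP E\<in>{E. finite E \<and> E \<subseteq> edges}. ber (pw w) E g)"

definition Tau :: "('v set \<Rightarrow> real) \<Rightarrow> 'v \<Rightarrow> 'v \<Rightarrow> real" where
  "Tau w x y = expec w (\<lambda>S. of_bool (y \<in> conn S x))"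

text \<open>Tail probability of the largest intersection of a cluster with \<open>L\<close>.\<close>

definition maxdist :: "('v set \<Rightarrow> real) \<Rightarrow> 'v set \<Rightarrow> real \<Rightarrow> real" where
  "maxdist w L m = expec w (\<lambda>S. of_bool (\<exists>v. m \<le> card (conn S v \<inter> L)))"

lemma mono_maximum:
  assumes "finite L"
  shows "mono (\<lambda>S. of_bool (\<exists>v. (m :: real) \<le> card (conn S v \<inter> L)) :: real)"
  by (rule mono_of_bool) (meson card_conn_mono[OF assms] of_nat_mono order_trans)

lemma finite_edge_sets_neq_bot [simp]: "finite_edge_sets \<noteq> bot"
  by simp

lemma eventually_finite_edge_sets: "\<forall>\<^sub>F E in finite_edge_sets. finite E \<and> E \<subseteq> edges"
  by (rule eventually_finite_subsets_at_top_weakI) auto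

lemma eventually_contains_edges:
  assumes "finite E0" "E0 \<subseteq> edges"
  shows "\<forall>\<^sub>F E in finite_edge_sets. finite E \<and> E \<subseteq> edges \<and> E0 \<subseteq> E"
  using assms by (auto simp: eventually_finite_subsets_at_top)

context
  fixes w :: "'v set \<Rightarrow> real"
  assumes w: "\<And>e. 0 \<le> w e"
begin

lemma ber_le_expec:
  assumes "\<And>S. g S \<le> B" "finite E" "E \<subseteq> edges"
  shows "ber (pw w) E g \<le> expec w g"
  unfolding expec_def
proof (intro cSUP_upper bdd_aboveI2)
  show "ber (pw w) E' g \<le> B" if "E' \<in> {E. finite E \<and> E \<subseteq> edges}" for E'
    using that by (intro ber_le_const pw_bounds w assms) auto
qed (use assms in auto)

lemma expec_le:
  assumes "\<And>E. finite E \<Longrightarrow> E \<subseteq> edges \<Longrightarrow> ber (pw w) E g \<le> B"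
  shows "expec w g \<le> B"
  unfolding expec_def using assms by (intro cSUP_least) auto

text \<open>By \<open>ber_mono_set\<close> the net is increasing, so the supremum is a limit.
  Inequalities that combine several expectations on the same finite edge set can thus be passed to
  the limit.\<close>

lemma expec_tendsto:
  assumes "mono g" "\<And>S. g S \<le> B"
  shows "((\<lambda>E. ber (pw w) E g) \<longlongrightarrow> expec w g) finite_edge_sets"
proof (rule increasing_tendsto)
  show "\<forall>\<^sub>F E in finite_edge_sets. ber (pw w) E g \<le> expec w g"
    using eventually_finite_edge_sets by eventually_elim (rule ber_le_expec[OF assms(2)], auto)
next
  fix c assume "c < expec w g"
  then obtain E0 where E0: "finite E0" "E0 \<subseteq> edges" "c < ber (pw w) E0 g"
    unfolding expec_def using expec_le by (metis expec_def linorder_not_less order_refl)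
  show "\<forall>\<^sub>F E in finite_edge_sets. c < ber (pw w) E g"
    using eventually_contains_edges[OF E0(1,2)]
  proof eventually_elim
    case (elim E)
    then have "ber (pw w) E0 g \<le> ber (pw w) E g"
      using assms by (intro ber_mono_set pw_bounds w) auto
    then show ?case using E0 by simp
  qed
qed

lemma Tau_tendsto: "((\<lambda>E. tau w E x y) \<longlongrightarrow> Tau w x y) finite_edge_sets"
  unfolding tau_def Tau_def by (rule expec_tendsto[OF mono_conn, of _ _ 1]) auto

lemma tau_le_Tau: "finite E \<Longrightarrow> E \<subseteq> edges \<Longrightarrow> tau w E x y \<le> Tau w x y"
  unfolding tau_def Tau_def by (rule ber_le_expec[of _ 1]) auto

lemma Tau_nonneg: "0 \<le> Tau w x y"
proof -
  have "0 \<le> tau w {} x y" by (rule tau_nonneg[OF w w finite.emptyI])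
  also have "\<dots> \<le> Tau w x y" by (rule tau_le_Tau) auto
  finally show ?thesis .
qed

lemma Tau_le_1: "Tau w x y \<le> 1"
  unfolding Tau_def by (intro expec_le ber_le_const pw_bounds w) auto

lemma Tau_self [simp]: "Tau w x x = 1"
proof (rule antisym[OF Tau_le_1])
  show "1 \<le> Tau w x x" using tau_le_Tau[of "{}" x x] by (simp add: tau_def)
qed

lemma maxdist_tendsto:
  fixes m :: real
  assumes "finite L"
  shows "((\<lambda>E. ber (pw w) E (\<lambda>S. of_bool (\<exists>v. m \<le> card (conn S v \<inter> L)))) \<longlongrightarrow> maxdist w L m)
           finite_edge_sets"
  unfolding maxdist_def by (rule expec_tendsto[OF mono_maximum[OF assms], of _ 1]) auto

lemma ber_le_maxdist:
  fixes m :: real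
  shows "finite E \<Longrightarrow> E \<subseteq> edges \<Longrightarrow>
    ber (pw w) E (\<lambda>S. of_bool (\<exists>v. m \<le> card (conn S v \<inter> L))) \<le> maxdist w L m"
  unfolding maxdist_def by (rule ber_le_expec[of _ 1]) auto

lemma maxdist_bounds: "0 \<le> maxdist w L m" "maxdist w L m \<le> 1"
proof -
  have "0 \<le> ber (pw w) {} (\<lambda>S. of_bool (\<exists>v. m \<le> card (conn S v \<inter> L)))" by simp
  also have "\<dots> \<le> maxdist w L m" by (rule ber_le_maxdist) auto
  finally show "0 \<le> maxdist w L m" .
  show "maxdist w L m \<le> 1"
    unfolding maxdist_def by (intro expec_le ber_le_const pw_bounds w) auto
qed

lemma maxdist_cube:
  assumes "finite L" "1 \<le> m"
  shows "maxdist w L (3 * m) \<le> (maxdist w L m)\<^sup>2"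
proof (rule tendsto_le[OF _ tendsto_power[OF maxdist_tendsto] maxdist_tendsto])
  show "\<forall>\<^sub>F E in finite_edge_sets. ber (pw w) E (\<lambda>S. of_bool (\<exists>v. 3 * m \<le> card (conn S v \<inter> L))) \<le>
     (ber (pw w) E (\<lambda>S. of_bool (\<exists>v. m \<le> card (conn S v \<inter> L))))\<^sup>2"
    using eventually_finite_edge_sets
    by eventually_elim (rule tail_of_maximum[OF w w _ assms], simp)
qed (use assms in auto)

text \<open>A weight-preserving bijection of the vertices permutes the finite edge sets over which
  the supremum is taken. It is used for translations.\<close>

lemma Tau_image:
  assumes f: "bij f" and wf: "\<And>e. w (f ` e) = w e"
  shows "Tau w (f x) (f y) = Tau w x y"
    and "maxdist w (f ` L) m = maxdist w L m"
proof -
  have cj: "conn ((`) f ` S) (f v) = f ` conn S v" for S v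
    using f by (intro conn_image bij_is_inj)
  have inj: "inj ((`) f)" using f by (intro injI) (metis bij_is_inj inj_image_eq_iff)
  have edg: "(`) f ` E \<subseteq> edges" if "E \<subseteq> edges" for E
  proof -
    have "card (f ` e) = card e" for e
      by (rule card_image) (use f in \<open>auto intro: inj_on_subset bij_is_inj\<close>)
    then show ?thesis using that by (auto simp: edges_def)
  qed
  have surj: "\<exists>E'. finite E' \<and> E' \<subseteq> edges \<and> E = (`) f ` E'" if "finite E" "E \<subseteq> edges" for E
  proof -
    have "(`) f ` ((`) (inv f) ` E) = E"
      using f by (simp add: image_image image_comp[symmetric] bij_is_surj surj_f_inv_f image_f_inv_f)
    moreover have "(`) (inv f) ` E \<subseteq> edges"
    proof -
      have "inj_on (inv f) e" for e using f by (metis bij_betw_inv_into bij_is_inj inj_on_subset subset_UNIV)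
      then show ?thesis using that(2) by (auto simp: edges_def card_image)
    qed
    ultimately show ?thesis using that(1) by (metis finite_imageI)
  qed
  have pwf: "pw w \<circ> (`) f = pw w" by (auto simp: pw_def wf)
  have main: "expec w g = expec w (\<lambda>S. g ((`) f ` S))" for g
  proof -
    have "(\<lambda>E. ber (pw w) E g) ` {E. finite E \<and> E \<subseteq> edges} =
        (\<lambda>E. ber (pw w) E (\<lambda>S. g ((`) f ` S))) ` {E. finite E \<and> E \<subseteq> edges}"
    proof -
      have eq: "ber (pw w) ((`) f ` E) g = ber (pw w) E (\<lambda>S. g ((`) f ` S))" if "finite E" for E
        using ber_image[OF that inj_on_subset[OF inj subset_UNIV], of "pw w" g] by (simp add: pwf)
      show ?thesis
      proof (intro subset_antisym subsetI; elim imageE)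
        fix r E assume E: "r = ber (pw w) E g" "E \<in> {E. finite E \<and> E \<subseteq> edges}"
        then obtain E' where "finite E'" "E' \<subseteq> edges" "E = (`) f ` E'" using surj[of E] by blast
        then show "r \<in> (\<lambda>E. ber (pw w) E (\<lambda>S. g ((`) f ` S))) ` {E. finite E \<and> E \<subseteq> edges}"
          using E eq by auto
      next
        fix r E assume E: "r = ber (pw w) E (\<lambda>S. g ((`) f ` S))" "E \<in> {E. finite E \<and> E \<subseteq> edges}"
        then show "r \<in> (\<lambda>E. ber (pw w) E g) ` {E. finite E \<and> E \<subseteq> edges}"
          using eq[of E] edg[of E] by (intro image_eqI[of _ _ "(`) f ` E"]) auto
      qed
    qed
    then show ?thesis unfolding expec_def by simp
  qed
  show "Tau w (f x) (f y) = Tau w x y"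
    unfolding Tau_def by (subst main) (simp add: cj inj_image_mem_iff[OF bij_is_inj[OF f]])
  have ex: "(\<exists>v. m \<le> card (conn ((`) f ` S) v \<inter> f ` L)) \<longleftrightarrow> (\<exists>v. m \<le> card (conn S v \<inter> L))" for S
  proof -
    have "card (conn ((`) f ` S) (f v) \<inter> f ` L) = card (conn S v \<inter> L)" for v
      unfolding cj using f by (metis bij_is_inj card_image image_Int inj_on_subset subset_UNIV)
    moreover have "\<exists>u. v = f u" for v using f by (metis bij_pointE)
    ultimately show ?thesis by metis
  qed
  show "maxdist w (f ` L) m = maxdist w L m"
    unfolding maxdist_def by (subst main) (simp add: ex)
qed

end

lemma finite_Pair_sets: "finite A \<Longrightarrow> finite B \<Longrightarrow> finite {{a, b} | a b. a \<in> A \<and> b \<in> B}"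
  using finite_image_set2[of "\<lambda>a. a \<in> A" "\<lambda>b. b \<in> B" "\<lambda>a b. {a, b}"] by simp

text \<open>The sprinkling lemmas require every edge between the two sets to be present; this holds
  for all sufficiently large finite edge sets.\<close>

lemma eventually_contains_pairs:
  assumes "finite A" "finite B"
  shows "\<forall>\<^sub>F E in finite_edge_sets. finite E \<and> E \<subseteq> edges \<and> (\<forall>a\<in>A. \<forall>b\<in>B. a \<noteq> b \<longrightarrow> {a, b} \<in> E)"
proof -
  let ?E0 = "{{a, b} | a b. a \<in> A \<and> b \<in> B} \<inter> edges"
  have "\<forall>\<^sub>F E in finite_edge_sets. finite E \<and> E \<subseteq> edges \<and> ?E0 \<subseteq> E"
    using finite_Pair_sets[OF assms] by (intro eventually_contains_edges) auto
  then show ?thesis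
  proof (rule eventually_mono)
    fix E assume E: "finite E \<and> E \<subseteq> edges \<and> ?E0 \<subseteq> E"
    have "{a, b} \<in> ?E0" if "a \<in> A" "b \<in> B" "a \<noteq> b" for a b
      using that by (auto simp: edges_def)
    then show "finite E \<and> E \<subseteq> edges \<and> (\<forall>a\<in>A. \<forall>b\<in>B. a \<noteq> b \<longrightarrow> {a, b} \<in> E)"
      using E by blast
  qed
qed

section \<open>Two-layer estimates in infinite volume\<close>

context
  fixes w1 w2 :: "'v set \<Rightarrow> real"
  assumes w1: "\<And>e. 0 \<le> w1 e" and w2: "\<And>e. 0 \<le> w2 e"
begin

lemma w12: "0 \<le> w1 e + w2 e" using w1 w2 by simp

lemma Tau_mono: "Tau w1 x y \<le> Tau (\<lambda>e. w1 e + w2 e) x y"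
proof (rule tendsto_le[OF _ Tau_tendsto[OF w12] Tau_tendsto[OF w1]])
  show "\<forall>\<^sub>F E in finite_edge_sets. tau w1 E x y \<le> tau (\<lambda>e. w1 e + w2 e) E x y"
    using eventually_finite_edge_sets
  proof eventually_elim
    case (elim E)
    then show ?case unfolding tau_def
      by (intro ber_mono_weights pw_bounds pw_mono w1 w2 w12 mono_conn) (auto simp: w2)
  qed
qed auto

text \<open>The convolution enters only through a bound \<open>B\<close> on all its finite partial
  sums.\<close>

lemma Tau_two_step:
  assumes "\<And>D. finite D \<Longrightarrow> D \<subseteq> {(a, b). a \<noteq> b} \<Longrightarrow>
     (\<Sum>(a, b)\<in>D. w2 {a, b} * Tau w1 x a * Tau (\<lambda>e. w1 e + w2 e) b y) \<le> B"
  shows "Tau (\<lambda>e. w1 e + w2 e) x y \<le> Tau w1 x y + B"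
proof (rule tendsto_upperbound[OF Tau_tendsto[OF w12]])
  show "\<forall>\<^sub>F E in finite_edge_sets. tau (\<lambda>e. w1 e + w2 e) E x y \<le> Tau w1 x y + B"
    using eventually_finite_edge_sets
  proof eventually_elim
    case (elim E)
    then have E: "finite E" "E \<subseteq> edges" by auto
    let ?D = "{(a, b). a \<noteq> b \<and> {a, b} \<in> E}"
    have "tau (\<lambda>e. w1 e + w2 e) E x y \<le> tau w1 E x y +
      (\<Sum>(a, b)\<in>?D. w2 {a, b} * tau w1 E x a * tau (\<lambda>e. w1 e + w2 e) E b y)"
      by (rule tau_two_step[OF w1 w2 E])
    also have "\<dots> \<le> Tau w1 x y + (\<Sum>(a, b)\<in>?D. w2 {a, b} * Tau w1 x a * Tau (\<lambda>e. w1 e + w2 e) b y)"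
    proof (intro add_mono sum_mono, goal_cases)
      case 1
      then show ?case by (rule tau_le_Tau[OF w1 E])
    next
      case (2 d)
      then show ?case
        by (auto intro!: mult_mono mult_nonneg_nonneg tau_le_Tau[OF w1 E] tau_le_Tau[OF w12 E] w2
            tau_nonneg[OF w1 w2 E(1)] tau_nonneg[OF w12 w2 E(1)] Tau_nonneg[OF w1])
    qed
    also have "\<dots> \<le> Tau w1 x y + B"
      by (intro add_left_mono assms finite_edge_pairs[OF w1 w2 E]) auto
    finally show ?case .
  qed
qed auto

text \<open>On finitely many edges the largest partial susceptibility of the larger model is finite, so
  the inequality obtained by summing \<open>tau_two_step\<close> may be solved for it.\<close>

lemma susceptibility_stable:
  fixes cc W :: real
  assumes cc: "\<And>u F. finite F \<Longrightarrow> (\<Sum>x\<in>F. Tau w1 u x) \<le> cc"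
    and W: "\<And>a F. finite F \<Longrightarrow> a \<notin> F \<Longrightarrow> (\<Sum>b\<in>F. w2 {a, b}) \<le> W"
    and less: "cc * W < 1" and F: "finite F"
  shows "(\<Sum>x\<in>F. Tau (\<lambda>e. w1 e + w2 e) u x) \<le> cc / (1 - cc * W)"
proof (rule tendsto_upperbound[OF tendsto_sum])
  let ?w = "\<lambda>e. w1 e + w2 e"
  show "((\<lambda>E. tau ?w E u x) \<longlongrightarrow> Tau ?w u x) finite_edge_sets" for x
    by (rule Tau_tendsto[OF w12])
  have W0: "0 \<le> W" using W[of "{}"] by simp
  have cc0: "0 \<le> cc" using cc[of "{}"] by simp
  show "\<forall>\<^sub>F E in finite_edge_sets. (\<Sum>x\<in>F. tau ?w E u x) \<le> cc / (1 - cc * W)"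
    using eventually_finite_edge_sets
  proof eventually_elim
    case (elim E)
    then have E: "finite E" "E \<subseteq> edges" by auto
    define D where "D = {(a, b). a \<noteq> b \<and> {a, b} \<in> E}"
    have fD: "finite D" unfolding D_def by (rule finite_edge_pairs[OF w1 w2 E])
    have nn1: "0 \<le> tau w1 E x y" and nn: "0 \<le> tau ?w E x y" for x y
      by (rule tau_nonneg[OF w1 w2 E(1)], rule tau_nonneg[OF w12 w2 E(1)])
    \<comment> \<open>\<open>V\<close> contains every endpoint of an edge of \<open>E\<close>, so
      the maximum \<open>M\<close> over it controls each factor \<open>s b\<close> produced by the
      two-step inequality.\<close>
    define V where "V = insert u (fst ` D \<union> snd ` D)"
    have fV: "finite V" unfolding V_def using fD by auto
    define s where "s = (\<lambda>v. \<Sum>x\<in>F. tau ?w E v x)"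
    define M where "M = Max (s ` V)"
    have sM: "s v \<le> M" if "v \<in> V" for v unfolding M_def using that fV by auto
    have s0: "0 \<le> s v" for v unfolding s_def by (intro sum_nonneg nn)
    have M0: "0 \<le> M" using sM[of u] s0[of u] unfolding V_def by auto
    have "s v \<le> cc + cc * W * M" if v: "v \<in> V" for v
    proof -
      have "s v \<le> (\<Sum>x\<in>F. tau w1 E v x + (\<Sum>(a, b)\<in>D. w2 {a, b} * tau w1 E v a * tau ?w E b x))"
        unfolding s_def D_def by (intro sum_mono tau_two_step w1 w2 E)
      also have "\<dots> = (\<Sum>x\<in>F. tau w1 E v x) + (\<Sum>(a, b)\<in>D. w2 {a, b} * tau w1 E v a * s b)"
        unfolding sum.distrib s_def
        by (subst sum.swap) (auto simp: sum_distrib_left intro!: sum.cong)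
      also have "(\<Sum>x\<in>F. tau w1 E v x) \<le> cc"
        using order_trans[OF sum_mono[OF tau_le_Tau[OF w1 E]] cc[OF F]] .
      also have "(\<Sum>(a, b)\<in>D. w2 {a, b} * tau w1 E v a * s b) \<le> (\<Sum>(a, b)\<in>D. w2 {a, b} * tau w1 E v a * M)"
      proof (intro sum_mono, clarify)
        fix a b assume "(a, b) \<in> D"
        then have "b \<in> V" unfolding V_def by force
        then show "w2 {a, b} * tau w1 E v a * s b \<le> w2 {a, b} * tau w1 E v a * M"
          by (intro mult_left_mono sM mult_nonneg_nonneg w2 nn1)
      qed
      also have "\<dots> = M * (\<Sum>(a, b)\<in>D. tau w1 E v a * w2 {a, b})"
        by (auto simp: sum_distrib_left intro!: sum.cong)
      also have "\<dots> \<le> M * (W * cc)"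
      proof (intro mult_left_mono M0)
      have "(\<Sum>(a, b)\<in>D. tau w1 E v a * w2 {a, b}) = (\<Sum>a\<in>fst ` D. \<Sum>b\<in>D `` {a}. tau w1 E v a * w2 {a, b})"
      proof -
        have "D = Sigma (fst ` D) (\<lambda>a. D `` {a})" by force
        moreover have "finite (D `` {a})" for a using fD by (intro finite_subset[of "D `` {a}" "snd ` D"]) force+
        ultimately show ?thesis using fD by (subst sum.Sigma) auto
      qed
      also have "\<dots> \<le> (\<Sum>a\<in>fst ` D. tau w1 E v a * W)"
        unfolding sum_distrib_left[symmetric]
      proof (intro sum_mono mult_left_mono nn1 W)
        fix a
        have "D `` {a} \<subseteq> snd ` D" by force
        then show "finite (D `` {a})" using fD finite_subset by blast
        show "a \<notin> D `` {a}" unfolding D_def by auto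
      qed
      also have "\<dots> \<le> W * cc"
        unfolding sum_distrib_right[symmetric]
        using order_trans[OF sum_mono[OF tau_le_Tau[OF w1 E]] cc[of "fst ` D" v]] fD W0
        by (simp add: mult.commute mult_left_mono)
      finally show "(\<Sum>(a, b)\<in>D. tau w1 E v a * w2 {a, b}) \<le> W * cc" .
      qed
      finally show ?thesis by (simp add: mult_ac)
    qed
    moreover have "M \<in> s ` V" unfolding M_def using fV V_def by (intro Max_in) auto
    ultimately have "M \<le> cc + cc * W * M" by auto
    then have "M * (1 - cc * W) \<le> cc" by (simp add: algebra_simps)
    then have "M \<le> cc / (1 - cc * W)" using less by (simp add: pos_le_divide_eq)
    then show ?case using sM[of u] unfolding s_def V_def by auto
  qed
qed (use F in auto)

text \<open>Rarity of large clusters lets \<open>mean_le_truncated_mean\<close> replace each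
  truncated mean by the full mean at the price of a factor 6, hence the 36.\<close>

lemma Tau_ge_square_of_means:
  fixes \<kappa> m :: real
  assumes L: "finite L0" "finite Lz" and m: "1 \<le> m" and \<kappa>: "0 \<le> \<kappa>"
    and rare: "maxdist w1 L0 m \<le> 1 / 9" "maxdist w1 Lz m \<le> 1 / 9"
    and edge: "\<And>a b. a \<in> L0 \<Longrightarrow> b \<in> Lz \<Longrightarrow> a \<noteq> b \<Longrightarrow> \<kappa> \<le> w2 {a, b}"
  shows "(1 - exp (- \<kappa> * m\<^sup>2)) / m\<^sup>2 / 36 * ((\<Sum>a\<in>L0. Tau w1 x a) * (\<Sum>b\<in>Lz. Tau w1 z b))
     \<le> Tau (\<lambda>e. w1 e + w2 e) x z"
proof -
  let ?w = "\<lambda>e. w1 e + w2 e"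
  let ?c = "(1 - exp (- \<kappa> * m\<^sup>2)) / m\<^sup>2"
  have c: "0 \<le> ?c" using \<kappa> by simp
  show ?thesis
  proof (rule tendsto_le[OF _ Tau_tendsto[OF w12] tendsto_mult_left[OF tendsto_mult[OF tendsto_sum tendsto_sum]]])
    show "\<forall>\<^sub>F E in finite_edge_sets. ?c / 36 * ((\<Sum>a\<in>L0. tau w1 E x a) * (\<Sum>b\<in>Lz. tau w1 E z b)) \<le> tau ?w E x z"
      using eventually_contains_pairs[OF L]
    proof eventually_elim
      case (elim E)
      then have E: "finite E" "E \<subseteq> edges" by auto
      have sumE: "(\<Sum>a\<in>L. tau w1 E v a) = ber (pw w1) E (\<lambda>S. card (conn S v \<inter> L))" if "finite L" for L v
        using that unfolding tau_def ber_sum[symmetric]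
        by (intro ber_cong) (simp add: of_bool_def sum.If_cases Int_commute Int_def)
      have le6: "(\<Sum>a\<in>L. tau w1 E v a) \<le> 6 * ber (pw w1) E (\<lambda>S. min (card (conn S v \<inter> L)) m)"
        if "finite L" "maxdist w1 L m \<le> 1 / 9" for L v
        unfolding sumE[OF that(1)] using that
        by (intro mean_le_truncated_mean[OF w1 w2 E(1) that(1) m]) (rule order_trans[OF ber_le_maxdist[OF w1 E]])
      have nn: "0 \<le> (\<Sum>a\<in>L. tau w1 E v a)" for L v by (intro sum_nonneg tau_nonneg[OF w1 w2 E(1)])
      have "(\<Sum>a\<in>L0. tau w1 E x a) * (\<Sum>b\<in>Lz. tau w1 E z b) \<le>
        (6 * ber (pw w1) E (\<lambda>S. min (card (conn S x \<inter> L0)) m)) * (6 * ber (pw w1) E (\<lambda>S. min (card (conn S z \<inter> Lz)) m))"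
        using m by (intro mult_mono le6 L rare nn mult_nonneg_nonneg ber_nonneg pw_bounds w1) auto
      then have "?c / 36 * ((\<Sum>a\<in>L0. tau w1 E x a) * (\<Sum>b\<in>Lz. tau w1 E z b)) \<le>
        ?c / 36 * ((6 * ber (pw w1) E (\<lambda>S. min (card (conn S x \<inter> L0)) m)) * (6 * ber (pw w1) E (\<lambda>S. min (card (conn S z \<inter> Lz)) m)))"
        using c by (intro mult_left_mono) auto
      also have "\<dots> = ?c * (ber (pw w1) E (\<lambda>S. min (card (conn S x \<inter> L0)) m) * ber (pw w1) E (\<lambda>S. min (card (conn S z \<inter> Lz)) m))"
        by simp
      also have "\<dots> \<le> tau ?w E x z"
        using m elim by (intro tau_ge_truncated w1 w2 E L \<kappa>) (auto intro: edge)
      finally show ?case .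
    qed
  qed (auto intro: Tau_tendsto[OF w1])
qed

text \<open>The strict inequality in the hypothesis on \<open>maxdist\<close> ensures that the
  finite-volume probabilities exceed \<open>1 - \<epsilon>\<close> for some finite edge set.\<close>

lemma Tau_chain:
  fixes \<kappa> \<epsilon> m :: real and Lam :: "nat \<Rightarrow> 'v set"
  assumes L: "\<And>i. finite (Lam i)" and m: "0 \<le> m" and \<kappa>: "0 \<le> \<kappa>"
    and big: "\<And>i. i \<le> D \<Longrightarrow> 1 - \<epsilon> < maxdist w1 (Lam i) m"
    and edge: "\<And>i a b. i < D \<Longrightarrow> a \<in> Lam i \<Longrightarrow> b \<in> Lam (Suc i) \<Longrightarrow> a \<noteq> b \<Longrightarrow> \<kappa> \<le> w2 {a, b}"
  shows "m\<^sup>2 * (1 - (real D + 1) * \<epsilon> - D * exp (- \<kappa> * m\<^sup>2)) \<le>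
     (\<Sum>x\<in>Lam 0. \<Sum>y\<in>Lam D. Tau (\<lambda>e. w1 e + w2 e) x y)"
proof -
  have "\<forall>\<^sub>F E in finite_edge_sets. finite E \<and> E \<subseteq> edges \<and>
      (\<forall>i\<in>{..D}. \<forall>a\<in>Lam i. \<forall>b\<in>Lam (Suc i). a \<noteq> b \<longrightarrow> {a, b} \<in> E) \<and>
      (\<forall>i\<in>{..D}. 1 - \<epsilon> < ber (pw w1) E (\<lambda>S. of_bool (\<exists>v. m \<le> card (conn S v \<inter> Lam i))))"
  proof -
    have "\<forall>\<^sub>F E in finite_edge_sets. \<forall>i\<in>{..D}. \<forall>a\<in>Lam i. \<forall>b\<in>Lam (Suc i). a \<noteq> b \<longrightarrow> {a, b} \<in> E"
    proof (rule eventually_ball_finite, simp, rule ballI)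
      show "\<forall>\<^sub>F E in finite_edge_sets. \<forall>a\<in>Lam i. \<forall>b\<in>Lam (Suc i). a \<noteq> b \<longrightarrow> {a, b} \<in> E" for i
        using eventually_contains_pairs[OF L[of i] L[of "Suc i"]] by (rule eventually_mono) blast
    qed
    moreover have "\<forall>\<^sub>F E in finite_edge_sets. \<forall>i\<in>{..D}.
        1 - \<epsilon> < ber (pw w1) E (\<lambda>S. of_bool (\<exists>v. m \<le> card (conn S v \<inter> Lam i)))"
    proof (rule eventually_ball_finite, simp, rule ballI)
      show "\<forall>\<^sub>F E in finite_edge_sets. 1 - \<epsilon> < ber (pw w1) E (\<lambda>S. of_bool (\<exists>v. m \<le> card (conn S v \<inter> Lam i)))"
        if "i \<in> {..D}" for i
        using that by (intro order_tendstoD(1)[OF maxdist_tendsto[OF w1 L]] big) auto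
    qed
    ultimately show ?thesis using eventually_finite_edge_sets by (simp add: eventually_conj_iff)
  qed
  from eventually_happens'[OF finite_edge_sets_neq_bot this] obtain E where E: "finite E" "E \<subseteq> edges"
    "\<forall>i\<in>{..D}. \<forall>a\<in>Lam i. \<forall>b\<in>Lam (Suc i). a \<noteq> b \<longrightarrow> {a, b} \<in> E"
    "\<forall>i\<in>{..D}. 1 - \<epsilon> < ber (pw w1) E (\<lambda>S. of_bool (\<exists>v. m \<le> card (conn S v \<inter> Lam i)))"
    by (elim exE conjE) (rule that)
  have "m\<^sup>2 * (1 - (real D + 1) * \<epsilon> - D * exp (- \<kappa> * m\<^sup>2)) \<le>
     (\<Sum>x\<in>Lam 0. \<Sum>y\<in>Lam D. tau (\<lambda>e. w1 e + w2 e) E x y)"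
    using E by (intro tau_chain w1 w2 L m \<kappa>) (auto intro: edge less_imp_le)
  also have "\<dots> \<le> (\<Sum>x\<in>Lam 0. \<Sum>y\<in>Lam D. Tau (\<lambda>e. w1 e + w2 e) x y)"
    by (intro sum_mono tau_le_Tau[OF w12] E)
  finally show ?thesis .
qed

end

text \<open>On a fixed finite edge set the missing weight is a second layer of weight at most
  \<epsilon> per edge. Bounding both two-point functions in \<open>tau_two_step\<close> by 1 leaves
  an error of \<epsilon> times the number of oriented edges.\<close>

lemma Tau_le_of_approximations:
  fixes w :: "'v set \<Rightarrow> real"
  assumes w: "\<And>e. 0 \<le> w e"
    and approx: "\<And>E \<epsilon>. finite E \<Longrightarrow> E \<subseteq> edges \<Longrightarrow> 0 < \<epsilon> \<Longrightarrow>
      \<exists>w'. (\<forall>e. 0 \<le> w' e \<and> w' e \<le> w e) \<and> (\<forall>e\<in>E. w e \<le> w' e + \<epsilon>) \<and> Tau w' x y \<le> B"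
  shows "Tau w x y \<le> B"
  unfolding Tau_def
proof (rule expec_le[OF w], fold tau_def)
  fix E :: "'v set set" assume E: "finite E" "E \<subseteq> edges"
  let ?D = "{(a, b). a \<noteq> b \<and> {a, b} \<in> E}"
  have "tau w E x y \<le> B + \<epsilon> * card ?D" if \<epsilon>: "0 < \<epsilon>" for \<epsilon> :: real
  proof -
    obtain w' where w': "\<And>e. 0 \<le> w' e" "\<And>e. w' e \<le> w e" "\<And>e. e \<in> E \<Longrightarrow> w e \<le> w' e + \<epsilon>" "Tau w' x y \<le> B"
      using approx[of E \<epsilon>] E \<epsilon> by auto
    define v where "v = (\<lambda>e. w e - w' e)"
    have v: "0 \<le> v e" for e using w' unfolding v_def by simp
    have wv: "w = (\<lambda>e. w' e + v e)" unfolding v_def by auto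
    have "tau w E x y \<le> tau w' E x y + (\<Sum>(a, b)\<in>?D. v {a, b} * tau w' E x a * tau w E b y)"
      using tau_two_step[where ?w1.0 = w' and ?w2.0 = v and x = x and y = y, OF w'(1) v E] unfolding wv[symmetric] .
    also have "\<dots> \<le> B + (\<Sum>(a, b)\<in>?D. \<epsilon> * 1 * 1)"
    proof (rule add_mono)
      show "tau w' E x y \<le> B"
        using tau_le_Tau[where w = w' and x = x and y = y, OF w'(1) E] w'(4) by simp
      show "(\<Sum>(a, b)\<in>?D. v {a, b} * tau w' E x a * tau w E b y) \<le> (\<Sum>(a, b)\<in>?D. \<epsilon> * 1 * 1)"
      proof (rule sum_mono, clarify)
        fix a b assume "{a, b} \<in> E"
        then show "v {a, b} * tau w' E x a * tau w E b y \<le> \<epsilon> * 1 * 1"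
          using w'(3)[of "{a, b}"] \<epsilon>
          by (intro mult_mono mult_nonneg_nonneg tau_nonneg[OF w'(1) w'(1) E(1)] tau_nonneg[OF w w E(1)]
              tau_le_1[OF w'(1) w'(1) E(1)] tau_le_1[OF w w E(1)] v) (auto simp: v_def)
      qed
    qed
    also have "(\<Sum>(a, b)\<in>?D. \<epsilon> * 1 * 1) = \<epsilon> * card ?D"
      by (simp add: case_prod_unfold)
    finally show ?thesis .
  qed
  note le = this
  have "tau w E x y \<le> B + \<epsilon>" if "0 < \<epsilon>" for \<epsilon> :: real
  proof -
    have "\<epsilon> / (card ?D + 1) * card ?D \<le> \<epsilon>"
      using that by (simp add: divide_simps)
    moreover have "0 < \<epsilon> / (card ?D + 1)" using that by (simp add: add_nonneg_pos)
    ultimately show ?thesis using le[of "\<epsilon> / (card ?D + 1)"] by linarith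
  qed
  then show "tau w E x y \<le> B" by (rule field_le_epsilon)
qed

lemma Tau_ge_edge:
  assumes w: "\<And>e. 0 \<le> w e" and "x \<noteq> y"
  shows "1 - exp (- w {x, y}) \<le> Tau w x y"
proof -
  have "ber (pw w) {{x, y}} (\<lambda>S. of_bool (y \<in> conn S x)) \<ge> pw w {x, y} * 1"
  proof -
    have "y \<in> conn {{x, y}} x" using assms by (intro conn_step[OF conn_refl]) auto
    then show ?thesis using pw_bounds[where w = w and e = "{x, y}", OF w]
      ber_insert[where I = "{}" and i = "{x, y}" and p = "pw w" and g = "\<lambda>S. of_bool (y \<in> conn S x)"] by simp
  qed
  moreover have "{x, y} \<in> edges" using assms(2) by (simp add: edges_def)
  ultimately show ?thesis
    using tau_le_Tau[where w = w and E = "{{x, y}}" and x = x and y = y, OF w] by (simp add: tau_def pw_def)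
qed

section \<open>The percolation measure\<close>

text \<open>\<open>edge_weight\<close> is given by a definite description that need not denote off
  \<open>edges\<close>; the value 0 there makes the weight nonnegative everywhere.\<close>

definition kernel_weight :: "('v \<Rightarrow> 'v \<Rightarrow> real) \<Rightarrow> real \<Rightarrow> 'v set \<Rightarrow> real" where
  "kernel_weight K \<beta> e = (if e \<in> edges then \<beta> * edge_weight K e else 0)"

lemma edge_cases:
  assumes "e \<in> edges"
  obtains a b where "a \<noteq> b" "e = {a, b}"
  using assms unfolding edges_def by (auto simp: card_2_iff)

lemma finite_incseq_cover:
  assumes "incseq f" "finite F" "F \<subseteq> (\<Union>n. f n)"
  shows "\<exists>n. F \<subseteq> f n"
  using assms(2,3)
proof (induction F rule: finite_induct)
  case (insert x F)
  then obtain n k where "F \<subseteq> f n" "x \<in> f k" by auto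
  moreover have "f n \<subseteq> f (max n k)" "f k \<subseteq> f (max n k)"
    using assms(1) by (auto simp: incseq_def)
  ultimately show ?case by (intro exI[of _ "max n k"]) auto
qed auto

locale percolation_kernel =
  fixes K :: "'v :: countable \<Rightarrow> 'v \<Rightarrow> real" and \<beta> :: real
  assumes sym: "K x y = K y x" and nonneg: "0 \<le> K x y" and beta: "0 \<le> \<beta>"
begin

abbreviation "M \<equiv> percolation K \<beta>"
abbreviation "W \<equiv> kernel_weight K \<beta>"

lemma weight_pair: "a \<noteq> b \<Longrightarrow> W {a, b} = \<beta> * K a b"
  by (simp add: kernel_weight_def edges_def edge_weight_pair[of K, OF sym])

lemma weight_nonneg: "0 \<le> W e"
proof (cases "e \<in> edges")
  case True
  then obtain a b where "a \<noteq> b" "e = {a, b}" by (rule edge_cases)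
  then show ?thesis using weight_pair nonneg beta by auto
qed (simp add: kernel_weight_def)

sublocale product_prob_space "\<lambda>e. measure_pmf (bernoulli_pmf (1 - exp (- \<beta> * edge_weight K e)))" edges
  by unfold_locales

lemma countable_edges: "countable (edges :: 'v set set)"
proof -
  have "edges \<subseteq> range (\<lambda>(a, b). {a, b :: 'v})" by (auto elim!: edge_cases)
  then show ?thesis by (rule countable_subset) auto
qed

definition open_in :: "('v set \<Rightarrow> bool) \<Rightarrow> 'v set set \<Rightarrow> 'v set set" where
  "open_in \<omega> E = {e \<in> E. \<omega> e}"

text \<open>An event depending on the edges in \<open>E\<close> is the disjoint union of the
  cylinders over the admissible configurations of \<open>E\<close>, and the cylinder probabilities
  are the weights in \<open>ber\<close>.\<close>

lemma finite_dim_measurable: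
  assumes "finite E" "E \<subseteq> edges"
  shows "{\<omega> \<in> space M. Q (open_in \<omega> E)} \<in> sets M"
    and "measure M {\<omega> \<in> space M. Q (open_in \<omega> E)} = ber (pw W) E (\<lambda>S. of_bool (Q S))"
proof -
  define cyl where "cyl = (\<lambda>S. {\<omega> \<in> space M. \<forall>e\<in>E. \<omega> e \<in> {e \<in> S}})"
  have eq: "{\<omega> \<in> space M. Q (open_in \<omega> E)} = (\<Union>S\<in>{S \<in> Pow E. Q S}. cyl S)"
  proof (intro subset_antisym subsetI)
    fix \<omega> assume "\<omega> \<in> {\<omega> \<in> space M. Q (open_in \<omega> E)}"
    then show "\<omega> \<in> (\<Union>S\<in>{S \<in> Pow E. Q S}. cyl S)"
      unfolding cyl_def by (intro UN_I[of "open_in \<omega> E"]) (auto simp: open_in_def)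
  next
    fix \<omega> assume "\<omega> \<in> (\<Union>S\<in>{S \<in> Pow E. Q S}. cyl S)"
    then obtain S where S: "S \<subseteq> E" "Q S" "\<omega> \<in> space M" "\<forall>e\<in>E. \<omega> e = (e \<in> S)"
      unfolding cyl_def by auto
    then have "open_in \<omega> E = S" unfolding open_in_def by auto
    then show "\<omega> \<in> {\<omega> \<in> space M. Q (open_in \<omega> E)}" using S by simp
  qed
  have cylemb: "cyl S = prod_emb edges (\<lambda>e. measure_pmf (bernoulli_pmf (1 - exp (- \<beta> * edge_weight K e)))) E (Pi\<^sub>E E (\<lambda>e. {e \<in> S}))" for S
    unfolding cyl_def prod_emb_def percolation_def using assms(2) by (auto simp: space_PiM Pi_iff)
  have meas: "cyl S \<in> sets M" for S
    unfolding cylemb percolation_def using assms by (intro sets_PiM_I) auto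
  have m: "measure M (cyl S) = (\<Prod>e\<in>S. pw W e) * (\<Prod>e\<in>E - S. 1 - pw W e)" if "S \<subseteq> E" for S
  proof -
    have "measure M (cyl S) = (\<Prod>e\<in>E. measure (measure_pmf (bernoulli_pmf (1 - exp (- \<beta> * edge_weight K e)))) {e \<in> S})"
      unfolding cylemb percolation_def using assms by (intro measure_PiM_emb) auto
    also have "\<dots> = (\<Prod>e\<in>E. if e \<in> S then pw W e else 1 - pw W e)"
    proof (intro prod.cong refl)
      fix e assume "e \<in> E"
      then have "W e = \<beta> * edge_weight K e" using assms by (auto simp: kernel_weight_def)
      moreover have "0 \<le> pw W e" "pw W e \<le> 1" using pw_bounds[of W e] weight_nonneg by auto
      ultimately show "measure (measure_pmf (bernoulli_pmf (1 - exp (- \<beta> * edge_weight K e)))) {e \<in> S} =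
          (if e \<in> S then pw W e else 1 - pw W e)"
        by (simp add: measure_pmf_single pw_def)
    qed
    also have "\<dots> = (\<Prod>e\<in>S. pw W e) * (\<Prod>e\<in>E - S. 1 - pw W e)"
    proof -
      have "E \<inter> {e. e \<in> S} = S" "E \<inter> - {e. e \<in> S} = E - S" using that by auto
      then show ?thesis using assms(1) by (simp add: prod.If_cases)
    qed
    finally show ?thesis .
  qed
  show "{\<omega> \<in> space M. Q (open_in \<omega> E)} \<in> sets M"
    unfolding eq using assms(1) meas by (intro sets.finite_UN) auto
  have "measure M {\<omega> \<in> space M. Q (open_in \<omega> E)} = (\<Sum>S\<in>{S \<in> Pow E. Q S}. measure M (cyl S))"
    unfolding eq
  proof (rule measure_finite_Union)
    show "disjoint_family_on cyl {S \<in> Pow E. Q S}"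
      unfolding disjoint_family_on_def cyl_def by auto
    show "emeasure M (cyl S) \<noteq> \<infinity>" for S
      unfolding percolation_def infinity_ennreal_def by (rule P.emeasure_finite)
  qed (use assms(1) meas in auto)
  also have "\<dots> = (\<Sum>S\<in>{S \<in> Pow E. Q S}. (\<Prod>e\<in>S. pw W e) * (\<Prod>e\<in>E - S. 1 - pw W e))"
    by (intro sum.cong) (auto simp: m)
  also have "\<dots> = ber (pw W) E (\<lambda>S. of_bool (Q S))"
    unfolding ber_def using assms(1) by (intro sum.mono_neutral_cong_left) auto
  finally show "measure M {\<omega> \<in> space M. Q (open_in \<omega> E)} = ber (pw W) E (\<lambda>S. of_bool (Q S))" .
qed

lemma cluster_open_in: "cluster \<omega> x = conn (open_in \<omega> edges) x"
proof -
  have "{(a, b). a \<noteq> b \<and> {a, b} \<in> open_in \<omega> edges} = {(a, b). a \<noteq> b \<and> {a, b} \<in> {e. \<omega> e}}"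
    by (auto simp: open_in_def edges_def)
  then show ?thesis unfolding cluster_eq_conn by (simp only: conn_def)
qed

text \<open>The edges are exhausted by an increasing sequence of finite sets. Continuity from below
  of the measure and the limit defining \<open>Tau\<close> then evaluate the same sequence.\<close>

lemma two_point_measurable: "{\<omega> \<in> space M. y \<in> cluster \<omega> x} \<in> sets M"
  and two_point_eq_Tau: "two_point K \<beta> x y = Tau W x y"
proof -
  obtain f :: "nat \<Rightarrow> 'v set set" where f: "\<And>n. finite (f n)" "\<And>n. f n \<subseteq> edges" "incseq f" "(\<Union>n. f n) = edges"
  proof (cases "(edges :: 'v set set) = {}")
    case True
    then show ?thesis by (intro that[of "\<lambda>_. {}"]) (auto simp: incseq_def)
  next
    case False
    let ?f = "\<lambda>n. from_nat_into (edges :: 'v set set) ` {..n}"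
    have "range (from_nat_into (edges :: 'v set set)) = edges"
      by (rule range_from_nat_into[OF False countable_edges])
    then have "x \<in> edges \<longleftrightarrow> (\<exists>n. x \<in> ?f n)" for x by blast
    then have "(\<Union>n. ?f n) = edges" by blast
    then show ?thesis by (intro that[of ?f]) (auto simp: incseq_def)
  qed
  define A where "A = (\<lambda>n. {\<omega> \<in> space M. y \<in> conn (open_in \<omega> (f n)) x})"
  have A_eq: "{\<omega> \<in> space M. y \<in> cluster \<omega> x} = (\<Union>n. A n)"
  proof (intro subset_antisym subsetI)
    fix \<omega> assume w: "\<omega> \<in> {\<omega> \<in> space M. y \<in> cluster \<omega> x}"
    then have "y \<in> conn (open_in \<omega> edges) x" by (simp add: cluster_open_in)
    from conn_finite_support[OF this] obtain F
      where F: "F \<subseteq> open_in \<omega> edges" "finite F" "y \<in> conn F x" by auto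
    have "F \<subseteq> (\<Union>n. f n)" using F(1) f(4) unfolding open_in_def by auto
    from finite_incseq_cover[OF f(3) F(2) this] obtain n where "F \<subseteq> f n" by auto
    then have "F \<subseteq> open_in \<omega> (f n)" using F(1) unfolding open_in_def by auto
    from subsetD[OF conn_mono[OF this] F(3)]
    show "\<omega> \<in> (\<Union>n. A n)" unfolding A_def using w by auto
  next
    fix \<omega> assume "\<omega> \<in> (\<Union>n. A n)"
    then obtain n where n: "\<omega> \<in> space M" "y \<in> conn (open_in \<omega> (f n)) x" unfolding A_def by auto
    have "open_in \<omega> (f n) \<subseteq> open_in \<omega> edges" using f(2)[of n] unfolding open_in_def by auto
    from subsetD[OF conn_mono[OF this] n(2)]
    show "\<omega> \<in> {\<omega> \<in> space M. y \<in> cluster \<omega> x}"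
      using n(1) unfolding cluster_open_in by simp
  qed
  have As: "A n \<in> sets M" for n unfolding A_def by (rule finite_dim_measurable[OF f(1,2)])
  show "{\<omega> \<in> space M. y \<in> cluster \<omega> x} \<in> sets M" unfolding A_eq using As by auto
  have "incseq A"
  proof (rule incseq_SucI)
    fix n
    have "open_in \<omega> (f n) \<subseteq> open_in \<omega> (f (Suc n))" for \<omega>
      using f(3) unfolding open_in_def incseq_Suc_iff by auto
    from conn_mono[OF this, of _ x] show "A n \<subseteq> A (Suc n)" unfolding A_def by fast
  qed
  then have "(\<lambda>n. measure M (A n)) \<longlonglongrightarrow> measure M (\<Union>n. A n)"
    using As P.finite_Lim_measure_incseq[of A] unfolding percolation_def by auto
  moreover have "measure M (A n) = tau W (f n) x y" for n
    unfolding A_def tau_def by (rule finite_dim_measurable[OF f(1,2)])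
  ultimately have lim1: "(\<lambda>n. tau W (f n) x y) \<longlonglongrightarrow> two_point K \<beta> x y"
    unfolding two_point_def A_eq by simp
  \<comment> \<open>The exhaustion is cofinal among the finite edge sets, so the limit along the net
    is also the limit along the sequence.\<close>
  have "filterlim f finite_edge_sets sequentially"
    unfolding filterlim_def le_filter_def eventually_filtermap
  proof (intro allI impI)
    fix P assume "eventually P (finite_edge_sets :: 'v set set filter)"
    then obtain E0 where E0: "finite E0" "E0 \<subseteq> edges" "\<And>E. finite E \<Longrightarrow> E0 \<subseteq> E \<Longrightarrow> E \<subseteq> edges \<Longrightarrow> P E"
      unfolding eventually_finite_subsets_at_top by auto
    have "E0 \<subseteq> (\<Union>n. f n)" using E0(2) f(4) by simp
    from finite_incseq_cover[OF f(3) E0(1) this] obtain n where n: "E0 \<subseteq> f n" by auto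
    show "\<forall>\<^sub>F n in sequentially. P (f n)"
      using eventually_ge_at_top[of n]
    proof eventually_elim
      case (elim k)
      then have "f n \<subseteq> f k" using f(3) by (simp add: incseq_def)
      then show ?case using n f(1,2) by (intro E0(3)) auto
    qed
  qed
  from filterlim_compose[OF Tau_tendsto[OF weight_nonneg] this]
  have lim2: "(\<lambda>n. tau W (f n) x y) \<longlonglongrightarrow> Tau W x y" .
  show "two_point K \<beta> x y = Tau W x y" using LIMSEQ_unique[OF lim1 lim2] .
qed

text \<open>Tonelli on a countable vertex set. With \<open>g = 1\<close> this is the susceptibility,
  with a power of the norm it is the moment in the radius of gyration.\<close>

lemma nn_integral_cluster:
  "(\<integral>\<^sup>+ \<omega>. (\<integral>\<^sup>+ y. g y \<partial>count_space (cluster \<omega> x)) \<partial>M) =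
     (\<integral>\<^sup>+ y. g y * ennreal (Tau W x y) \<partial>count_space UNIV)"
proof -
  have "(\<integral>\<^sup>+ \<omega>. (\<integral>\<^sup>+ y. g y \<partial>count_space (cluster \<omega> x)) \<partial>M) =
      (\<integral>\<^sup>+ \<omega>. (\<integral>\<^sup>+ y. g y * indicator {\<omega> \<in> space M. y \<in> cluster \<omega> x} \<omega> \<partial>count_space UNIV) \<partial>M)"
    by (intro nn_integral_cong) (auto simp: nn_integral_count_space_indicator indicator_def intro!: nn_integral_cong)
  also have "\<dots> = (\<integral>\<^sup>+ y. (\<integral>\<^sup>+ \<omega>. g y * indicator {\<omega> \<in> space M. y \<in> cluster \<omega> x} \<omega> \<partial>M) \<partial>count_space UNIV)"
    by (intro nn_integral_count_space_nn_integral borel_measurable_times_ennreal borel_measurable_indicator two_point_measurable) auto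
  also have "\<dots> = (\<integral>\<^sup>+ y. g y * ennreal (Tau W x y) \<partial>count_space UNIV)"
  proof (intro nn_integral_cong)
    fix y
    have "emeasure M {\<omega> \<in> space M. y \<in> cluster \<omega> x} = ennreal (Tau W x y)"
      unfolding two_point_eq_Tau[symmetric] two_point_def percolation_def by (rule P.emeasure_eq_measure)
    then show "(\<integral>\<^sup>+ \<omega>. g y * indicator {\<omega> \<in> space M. y \<in> cluster \<omega> x} \<omega> \<partial>M) = g y * ennreal (Tau W x y)"
      using two_point_measurable by (simp add: nn_integral_cmult_indicator)
  qed
  finally show ?thesis .
qed

end

text \<open>The bridge between the extended-valued expectations of the definitions and the bounds on
  finite partial sums used in the estimates.\<close>

lemma nn_integral_count_space_le_iff:
  fixes f :: "'a :: countable \<Rightarrow> real"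
  assumes f: "\<And>x. 0 \<le> f x" and B: "0 \<le> B"
  shows "(\<integral>\<^sup>+ x. ennreal (f x) \<partial>count_space UNIV) \<le> ennreal B \<longleftrightarrow> (\<forall>F. finite F \<longrightarrow> sum f F \<le> B)"
proof -
  have fin: "(\<integral>\<^sup>+ x. ennreal (f x) * indicator F x \<partial>count_space UNIV) = ennreal (sum f F)" if "finite F" for F
    using that f by (simp flip: nn_integral_count_space_indicator add: nn_integral_count_space_finite)
  show ?thesis
  proof (intro iffI allI impI)
    fix F :: "'a set" assume le: "(\<integral>\<^sup>+ x. ennreal (f x) \<partial>count_space UNIV) \<le> ennreal B" and "finite F"
    have "(\<integral>\<^sup>+ x. ennreal (f x) * indicator F x \<partial>count_space UNIV) \<le> (\<integral>\<^sup>+ x. ennreal (f x) \<partial>count_space UNIV)"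
      by (intro nn_integral_mono) (auto simp: indicator_def)
    then have "ennreal (sum f F) \<le> ennreal B" using fin[OF \<open>finite F\<close>] le by simp
    then show "sum f F \<le> B" using B by simp
  next
    assume le: "\<forall>F. finite F \<longrightarrow> sum f F \<le> B"
    define F where "F = (\<lambda>n. from_nat_into (UNIV :: 'a set) ` {..n})"
    have r: "range (from_nat_into (UNIV :: 'a set)) = UNIV"
      by (rule range_from_nat_into) auto
    have "(\<integral>\<^sup>+ x. ennreal (f x) \<partial>count_space UNIV) = (\<integral>\<^sup>+ x. (SUP n. ennreal (f x) * indicator (F n) x) \<partial>count_space UNIV)"
    proof (intro nn_integral_cong)
      fix x
      have "x \<in> range (from_nat_into (UNIV :: 'a set))" by (simp only: r UNIV_I)
      then obtain n where n: "x = from_nat_into UNIV n" by (rule rangeE)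
      show "ennreal (f x) = (SUP n. ennreal (f x) * indicator (F n) x)"
      proof (rule antisym)
        have "ennreal (f x) = ennreal (f x) * indicator (F n) x" using n by (auto simp: F_def)
        also have "\<dots> \<le> (SUP n. ennreal (f x) * indicator (F n) x)" by (rule SUP_upper) auto
        finally show "ennreal (f x) \<le> (SUP n. ennreal (f x) * indicator (F n) x)" .
        show "(SUP n. ennreal (f x) * indicator (F n) x) \<le> ennreal (f x)"
          by (rule SUP_least) (simp add: indicator_def)
      qed
    qed
    also have "\<dots> = (SUP n. \<integral>\<^sup>+ x. ennreal (f x) * indicator (F n) x \<partial>count_space UNIV)"
      by (intro nn_integral_monotone_convergence_SUP)
        (auto simp: incseq_def le_fun_def F_def indicator_def intro!: mult_left_mono)
    also have "\<dots> = (SUP n. ennreal (sum f (F n)))"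
      by (intro SUP_cong refl fin) (auto simp: F_def)
    also have "\<dots> \<le> ennreal B"
      using le by (intro SUP_least ennreal_leI) (auto simp: F_def)
    finally show "(\<integral>\<^sup>+ x. ennreal (f x) \<partial>count_space UNIV) \<le> ennreal B" .
  qed
qed

context percolation_kernel
begin

text \<open>A finite expected cluster size makes each cluster almost surely finite, and there are
  countably many vertices.\<close>

lemma no_infinite_cluster:
  assumes "\<And>x F. finite F \<Longrightarrow> (\<Sum>y\<in>F. Tau W x y) \<le> B"
  shows "\<P>(\<omega> in M. \<exists>x. infinite (cluster \<omega> x)) = 0"
proof -
  have "AE \<omega> in M. finite (cluster \<omega> x)" for x
  proof -
    have B: "0 \<le> B" using assms[of "{}"] by simp
    have "(\<integral>\<^sup>+ \<omega>. (\<integral>\<^sup>+ y. 1 \<partial>count_space (cluster \<omega> x)) \<partial>M) =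
        (\<integral>\<^sup>+ y. ennreal (Tau W x y) \<partial>count_space UNIV)"
      unfolding nn_integral_cluster by simp
    also have "\<dots> \<le> ennreal B"
      using assms by (subst nn_integral_count_space_le_iff[OF Tau_nonneg[OF weight_nonneg] B]) auto
    finally have fin: "(\<integral>\<^sup>+ \<omega>. (\<integral>\<^sup>+ y. 1 \<partial>count_space (cluster \<omega> x)) \<partial>M) \<noteq> \<infinity>"
      by (auto simp: top_unique)
    have "(\<lambda>\<omega>. \<integral>\<^sup>+ y. 1 \<partial>count_space (cluster \<omega> x)) \<in> borel_measurable M"
    proof -
      have "(\<lambda>\<omega>. \<integral>\<^sup>+ y. indicator {\<omega> \<in> space M. y \<in> cluster \<omega> x} \<omega> \<partial>count_space UNIV) \<in> borel_measurable M"
        using two_point_measurable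
        by (intro sigma_finite_measure.borel_measurable_nn_integral sigma_finite_measure_count_space
            measurable_pair_measure_countable1) (auto simp: case_prod_unfold)
      then show ?thesis
      proof (rule measurable_cong[THEN iffD1, rotated])
        fix \<omega> assume "\<omega> \<in> space M"
        then show "(\<integral>\<^sup>+ y. indicator {\<omega> \<in> space M. y \<in> cluster \<omega> x} \<omega> \<partial>count_space UNIV) =
            (\<integral>\<^sup>+ y. 1 \<partial>count_space (cluster \<omega> x))"
          by (subst nn_integral_count_space_indicator) (auto simp: indicator_def intro!: nn_integral_cong)
      qed
    qed
    from nn_integral_PInf_AE[OF this fin] show ?thesis
      by (rule eventually_mono) (auto simp: emeasure_count_space split: if_splits)
  qed
  then have "AE \<omega> in M. \<forall>x. finite (cluster \<omega> x)" by (subst AE_all_countable) auto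
  then have AE: "AE \<omega> in M. \<not> (\<exists>x. infinite (cluster \<omega> x))" by auto
  show ?thesis
  \<comment> \<open>Measurability of the event is not established; outside the sigma-algebra
    \<open>measure\<close> returns 0, which is the claimed value.\<close>
  proof (cases "{\<omega> \<in> space M. \<exists>x. infinite (cluster \<omega> x)} \<in> sets M")
    case True
    then have "emeasure M {\<omega> \<in> space M. \<exists>x. infinite (cluster \<omega> x)} = 0"
      using AE by (subst (asm) AE_iff_measurable[OF True]) auto
    then show ?thesis by (simp add: measure_def)
  qed (simp add: measure_notin_sets)
qed

end

section \<open>Norms on the integer lattice\<close>

lemma real_vec_simps [simp]:
  "real_vec 0 = 0" "real_vec (x + y) = real_vec x + real_vec y"
  "real_vec (- x) = - real_vec x" "real_vec (x - y) = real_vec x - real_vec y"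
  by (simp_all add: real_vec_def vec_eq_iff)

lemma real_vec_eq_0_iff [simp]: "real_vec x = 0 \<longleftrightarrow> x = 0"
  by (simp add: real_vec_def vec_eq_iff)

lemma card_lattice_box:
  fixes A :: "int set"
  assumes "finite A"
  shows "finite {x :: int ^ 'd. \<forall>i. x $ i \<in> A}" "card {x :: int ^ 'd. \<forall>i. x $ i \<in> A} = card A ^ CARD('d)"
proof -
  let ?P = "PiE (UNIV :: 'd set) (\<lambda>_. A)"
  have eq: "{x :: int ^ 'd. \<forall>i. x $ i \<in> A} = vec_lambda ` ?P"
  proof (intro subset_antisym subsetI)
    fix x :: "int ^ 'd" assume "x \<in> {x. \<forall>i. x $ i \<in> A}"
    then show "x \<in> vec_lambda ` ?P" by (intro image_eqI[of _ _ "vec_nth x"]) auto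
  qed auto
  have inj: "inj_on vec_lambda ?P" by (auto simp: inj_on_def vec_lambda_inject)
  show "finite {x :: int ^ 'd. \<forall>i. x $ i \<in> A}"
    unfolding eq using assms by (intro finite_imageI finite_PiE) auto
  show "card {x :: int ^ 'd. \<forall>i. x $ i \<in> A} = card A ^ CARD('d)"
    unfolding eq card_image[OF inj] by (simp add: card_PiE)
qed

locale lattice_norm =
  fixes N :: "real ^ 'd \<Rightarrow> real" and d :: real
  assumes N: "is_norm N" and dim: "d = real CARD('d)"
begin

definition nv :: "int ^ 'd \<Rightarrow> real" where
  "nv x = N (real_vec x)"

definition lball :: "real \<Rightarrow> (int ^ 'd) set" where
  "lball R = {x. nv x \<le> R}"

lemma d_ge_1: "1 \<le> d"
  using zero_less_card_finite[where 'a = 'd] unfolding dim by linarith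

lemma nv_nonneg [simp]: "0 \<le> nv x"
  using N by (simp add: is_norm_def nv_def)

lemma nv_0 [simp]: "nv 0 = 0"
  using N by (simp add: is_norm_def nv_def)

lemma nv_pos: "x \<noteq> 0 \<Longrightarrow> 0 < nv x"
  using N nv_nonneg[of x] by (simp add: is_norm_def nv_def less_le)

lemma nv_triangle: "nv (x + y) \<le> nv x + nv y"
  using N by (simp add: is_norm_def nv_def)

lemma nv_minus [simp]: "nv (- x) = nv x"
proof -
  have "N ((- 1) *\<^sub>R real_vec x) = \<bar>- 1\<bar> * N (real_vec x)"
    using N unfolding is_norm_def by blast
  then show ?thesis by (simp add: nv_def)
qed

lemma nv_commute: "nv (x - y) = nv (y - x)"
  using nv_minus[of "x - y"] by simp

lemma nv_triangle_diff: "nv (x - y) \<le> nv x + nv y"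
  using nv_triangle[of x "- y"] by simp

lemma nv_scale: "nv (\<chi> i. of_nat n * v $ i) = n * nv v"
proof -
  have "real_vec (\<chi> i. of_nat n * v $ i) = real n *\<^sub>R real_vec v"
    by (simp add: real_vec_def vec_eq_iff)
  moreover have "N (real n *\<^sub>R real_vec v) = \<bar>real n\<bar> * N (real_vec v)"
    using N unfolding is_norm_def by blast
  ultimately show ?thesis by (simp add: nv_def)
qed

lemma N_le_norm: "\<exists>c>0. \<forall>v. N v \<le> c * norm v"
proof -
  define c where "c = (\<Sum>i\<in>UNIV. N (axis i 1)) + 1"
  have nonneg: "0 \<le> N v" for v using N by (simp add: is_norm_def)
  have scale: "N (a *\<^sub>R v) = \<bar>a\<bar> * N v" for a v using N unfolding is_norm_def by blast
  have tri: "N (u + v) \<le> N u + N v" for u v using N unfolding is_norm_def by blast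
  have N0: "N 0 = 0" using N unfolding is_norm_def by blast
  have sum: "N (sum f A) \<le> (\<Sum>i\<in>A. N (f i))" for f :: "'d \<Rightarrow> real ^ 'd" and A
  proof (induction A rule: infinite_finite_induct)
    case (insert x A)
    then show ?case using tri[of "f x" "sum f A"] by simp
  qed (auto simp: N0)
  have "N v \<le> c * norm v" for v
  proof -
    have "v = (\<Sum>i\<in>UNIV. v $ i *\<^sub>R axis i 1)"
      using basis_expansion[of v] by (simp add: scalar_mult_eq_scaleR)
    then have "N v \<le> (\<Sum>i\<in>UNIV. N (v $ i *\<^sub>R axis i 1))" using sum by metis
    also have "\<dots> \<le> (\<Sum>i\<in>UNIV. norm v * N (axis i 1))"
      by (intro sum_mono) (simp add: scale mult_right_mono component_le_norm_cart nonneg)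
    also have "\<dots> = norm v * (\<Sum>i\<in>UNIV. N (axis i 1))" by (simp add: sum_distrib_left)
    also have "\<dots> \<le> c * norm v" unfolding c_def by (simp add: algebra_simps)
    finally show ?thesis .
  qed
  moreover have "0 < c" unfolding c_def using sum_nonneg[of UNIV "\<lambda>i. N (axis i 1)"] nonneg by simp
  ultimately show ?thesis by blast
qed

text \<open>By compactness \<open>N\<close> attains a positive minimum on the Euclidean unit sphere,
  and homogeneity does the rest.\<close>

lemma norm_le_N: "\<exists>c>0. \<forall>v. norm v \<le> c * N v"
proof -
  obtain c where c: "0 < c" "\<And>v. N v \<le> c * norm v" using N_le_norm by auto
  have tri: "N (u + v) \<le> N u + N v" for u v using N unfolding is_norm_def by blast
  have scale: "N (a *\<^sub>R v) = \<bar>a\<bar> * N v" for a v using N unfolding is_norm_def by blast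
  have nonneg: "0 \<le> N v" and zero: "N v = 0 \<longleftrightarrow> v = 0" for v using N unfolding is_norm_def by blast+
  have dist: "\<bar>N u - N v\<bar> \<le> c * norm (u - v)" for u v
  proof -
    have "N (v - u) = N (u - v)" using scale[of "-1" "u - v"] by simp
    then show ?thesis using tri[of "u - v" v] tri[of "v - u" u] c(2)[of "u - v"] by simp
  qed
  have "continuous_on (sphere 0 1) N"
  proof (rule continuous_onI)
    fix x :: "real ^ 'd" and e :: real assume "0 < e"
    have "dist (N x') (N x) \<le> e" if "dist x' x < e / c" for x'
    proof -
      have "c * norm (x' - x) \<le> e" using that c(1) by (simp add: dist_norm field_simps)
      then show ?thesis using dist[of x' x] by (simp add: dist_real_def)
    qed
    then show "\<exists>d>0. \<forall>x'\<in>sphere 0 1. dist x' x < d \<longrightarrow> dist (N x') (N x) \<le> e"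
      using \<open>0 < e\<close> c(1) by (intro exI[of _ "e / c"]) auto
  qed
  moreover have "sphere (0 :: real ^ 'd) 1 \<noteq> {}" by simp
  ultimately obtain u where u: "u \<in> sphere 0 1" "\<And>v. v \<in> sphere 0 1 \<Longrightarrow> N u \<le> N v"
    using continuous_attains_inf[OF compact_sphere, of 0 1 N] by blast
  have pos: "0 < N u" using u(1) zero[of u] nonneg[of u] by (auto simp: less_le)
  have "norm v \<le> (1 / N u) * N v" for v
  proof (cases "v = 0")
    case False
    then have "N u \<le> N ((1 / norm v) *\<^sub>R v)" by (intro u(2)) simp
    then have "N u \<le> N v / norm v" unfolding scale by simp
    then have "N u * norm v \<le> N v" using False by (simp add: pos_le_divide_eq)
    then show ?thesis using pos by (simp add: pos_le_divide_eq mult.commute)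
  next
    case True
    then show ?thesis using zero[of v] by simp
  qed
  then show ?thesis using pos by (intro exI[of _ "1 / N u"]) auto
qed

lemma lball_upper: "\<exists>K>0. \<forall>R\<ge>1. finite (lball R) \<and> card (lball R) \<le> K * R powr d"
proof -
  obtain c where c: "0 < c" "\<And>v. norm v \<le> c * N v" using norm_le_N by auto
  have "finite (lball R) \<and> card (lball R) \<le> (2 * c + 1) powr d * R powr d" if R: "1 \<le> R" for R
  proof -
    define n where "n = \<lfloor>c * R\<rfloor>"
    have n: "0 \<le> n" "n \<le> c * R" using c R unfolding n_def by auto
    have sub: "lball R \<subseteq> {x. \<forall>i. x $ i \<in> {- n..n}}"
    proof
      fix x assume "x \<in> lball R"
      then have "c * nv x \<le> c * R" using c by (simp add: lball_def)
      then have "norm (real_vec x) \<le> c * R" using c(2)[of "real_vec x"] by (simp add: nv_def)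
      then have "\<bar>real_of_int (x $ i)\<bar> \<le> c * R" for i
        using component_le_norm_cart[of "real_vec x" i] by (simp add: real_vec_def)
      then have "x $ i \<le> n \<and> - x $ i \<le> n" for i
        unfolding n_def le_floor_iff by (smt (verit) of_int_minus)
      then show "x \<in> {x. \<forall>i. x $ i \<in> {- n..n}}" by (auto simp: minus_le_iff)
    qed
    note box = card_lattice_box[where 'd = 'd, of "{- n..n}"]
    have fin: "finite (lball R)" using sub box(1) finite_subset by blast
    have "real (card (lball R)) \<le> real (card {- n..n} ^ CARD('d))"
      using card_mono[OF _ sub] box by simp
    also have "\<dots> = (2 * n + 1) powr d" using n(1) by (simp add: dim powr_realpow nat_add_distrib add.commute)
    also have "\<dots> \<le> ((2 * c + 1) * R) powr d"
      using n R d_ge_1 by (intro powr_mono2) (auto simp: algebra_simps)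
    also have "\<dots> = (2 * c + 1) powr d * R powr d" using c R by (simp add: powr_mult)
    finally show ?thesis using fin by simp
  qed
  moreover have "0 < (2 * c + 1) powr d" using c by simp
  ultimately show ?thesis by blast
qed

lemma finite_lball [simp, intro]: "finite (lball R)"
proof -
  obtain K where "\<And>R. 1 \<le> R \<Longrightarrow> finite (lball R)" using lball_upper by auto
  from this[of "max 1 R"] show ?thesis
    by (rule rev_finite_subset) (auto simp: lball_def)
qed

lemma lball_lower: "\<exists>k>0. \<forall>R\<ge>0. k * R powr d \<le> card (lball R)"
proof -
  obtain c where c: "0 < c" "\<And>v. N v \<le> c * norm v" using N_le_norm by auto
  have cd: "0 < c * d" using c d_ge_1 by simp
  have "(1 / (c * d)) powr d * R powr d \<le> card (lball R)" if R: "0 \<le> R" for R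
  proof -
    define n where "n = \<lfloor>R / (c * d)\<rfloor>"
    have n: "0 \<le> n" "n \<le> R / (c * d)" "R / (c * d) \<le> n + 1"
      using cd R unfolding n_def by (auto simp: real_of_int_floor_add_one_ge)
    have sub: "{x. \<forall>i. x $ i \<in> {- n..n}} \<subseteq> lball R"
    proof
      fix x :: "int ^ 'd" assume x: "x \<in> {x. \<forall>i. x $ i \<in> {- n..n}}"
      have "norm (real_vec x) \<le> (\<Sum>i\<in>UNIV. \<bar>real_vec x $ i\<bar>)" by (rule norm_le_l1_cart)
      also have "\<dots> \<le> (\<Sum>i\<in>(UNIV :: 'd set). real_of_int n)"
      proof (intro sum_mono)
        fix i
        have "- n \<le> x $ i" "x $ i \<le> n" using x by auto
        then show "\<bar>real_vec x $ i\<bar> \<le> real_of_int n" by (simp add: real_vec_def)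
      qed
      also have "\<dots> = d * n" by (simp add: dim)
      finally have "c * norm (real_vec x) \<le> c * (d * n)" using c by (intro mult_left_mono) auto
      also have "\<dots> \<le> R" using n(2) cd by (simp add: field_simps)
      finally show "x \<in> lball R" using c(2)[of "real_vec x"] by (simp add: lball_def nv_def)
    qed
    have "(1 / (c * d)) powr d * R powr d = (R / (c * d)) powr d"
      using cd R by (simp add: powr_mult[symmetric])
    also have "\<dots> \<le> (2 * n + 1) powr d"
      using n R cd d_ge_1 by (intro powr_mono2) auto
    also have "\<dots> = real (card {- n..n} ^ CARD('d))"
      using n(1) by (simp add: dim powr_realpow nat_add_distrib add.commute)
    also have "\<dots> \<le> card (lball R)"
      using card_mono[OF finite_lball sub] card_lattice_box[where 'd = 'd, of "{- n..n}"]
      by (simp only: of_nat_le_iff finite_atLeastAtMost_int)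
    finally show ?thesis .
  qed
  moreover have "0 < (1 / (c * d)) powr d" using cd by (auto simp: zero_less_mult_iff)
  ultimately show ?thesis by blast
qed

lemma nv_bounded_below: "\<exists>\<eta>>0. \<forall>x. x \<noteq> 0 \<longrightarrow> \<eta> \<le> nv x"
proof -
  obtain c where c: "0 < c" "\<And>v. norm v \<le> c * N v" using norm_le_N by auto
  have "1 / c \<le> nv x" if "x \<noteq> 0" for x
  proof -
    have "\<exists>i. x $ i \<noteq> 0" using that by (simp add: vec_eq_iff)
    then obtain i where "x $ i \<noteq> 0" ..
    then have "1 \<le> \<bar>real_vec x $ i\<bar>" by (simp add: real_vec_def)
    also have "\<dots> \<le> norm (real_vec x)" by (rule component_le_norm_cart)
    also have "\<dots> \<le> c * nv x" using c by (simp add: nv_def)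
    finally show ?thesis using c by (simp add: field_simps)
  qed
  then show ?thesis using c by (intro exI[of _ "1 / c"]) auto
qed

section \<open>Lattice sums over dyadic shells\<close>

lemma sum_geometric_le:
  fixes q :: real
  assumes "0 < q" "q < 1"
  shows "(\<Sum>k<n. q ^ k) \<le> 1 / (1 - q)"
  using sum_le_suminf[of "\<lambda>k. q ^ k" "{..<n}"] assms
  by (simp add: summable_geometric suminf_geometric)

text \<open>The shell between \<open>2^k * r\<close> and \<open>2^(k + 1) * r\<close> has at most a
  constant times \<open>(2^k * r)^d\<close> points, so its contribution is of order
  \<open>r^(-\<epsilon>)\<close> times the k-th power of \<open>q = 2^(-\<epsilon>)\<close>.\<close>

lemma tail_sum:
  assumes "0 < \<epsilon>"
  shows "\<exists>K>0. \<forall>r\<ge>1. \<forall>F. finite F \<longrightarrow> F \<inter> lball r = {} \<longrightarrow>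
    (\<Sum>x\<in>F. nv x powr (- d - \<epsilon>)) \<le> K * r powr (- \<epsilon>)"
proof -
  obtain K where K: "0 < K" "\<And>R. 1 \<le> R \<Longrightarrow> card (lball R) \<le> K * R powr d" using lball_upper by auto
  define q where "q = (1 / 2 :: real) powr \<epsilon>"
  have q: "0 < q" "q < 1" unfolding q_def using assms powr_less_mono2[of \<epsilon> "1 / 2" 1] by auto
  define K' where "K' = K * 2 powr d / (1 - q)"
  have "(\<Sum>x\<in>F. nv x powr (- d - \<epsilon>)) \<le> K' * r powr (- \<epsilon>)"
    if r: "1 \<le> r" and F: "finite F" "F \<inter> lball r = {}" for r F
  proof -
    have "\<exists>n. \<forall>x\<in>F. nv x \<le> 2 ^ n * r"
    proof -
      obtain n where n: "Max (insert 0 (nv ` F)) < 2 ^ n" using real_arch_pow[of 2] by auto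
      have "nv x \<le> 2 ^ n * r" if "x \<in> F" for x
      proof -
        have "nv x \<le> Max (insert 0 (nv ` F))" using that F by (intro Max_ge) auto
        also have "\<dots> \<le> 2 ^ n * 1" using n by simp
        also have "\<dots> \<le> 2 ^ n * r" using r by (intro mult_left_mono) auto
        finally show ?thesis .
      qed
      then show ?thesis by auto
    qed
    then obtain n where n: "\<And>x. x \<in> F \<Longrightarrow> nv x \<le> 2 ^ n * r" by auto
    have pt: "nv x powr (- d - \<epsilon>) \<le> (\<Sum>k<n. (2 ^ k * r) powr (- d - \<epsilon>) * of_bool (x \<in> lball (2 ^ Suc k * r)))"
      if x: "x \<in> F" for x
    proof -
      have gr: "r < nv x" using F x unfolding lball_def by force
      define k where "k = (LEAST k. nv x \<le> 2 ^ k * r)"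
      have k: "nv x \<le> 2 ^ k * r" "k \<le> n"
        unfolding k_def using n[OF x] by (auto intro: LeastI Least_le)
      have "k \<noteq> 0" using k(1) gr by (intro notI) simp
      then obtain j where j: "k = Suc j" using not0_implies_Suc by auto
      have "\<not> nv x \<le> 2 ^ j * r" using not_less_Least[of j "\<lambda>k. nv x \<le> 2 ^ k * r"] j unfolding k_def by auto
      then have "nv x powr (- d - \<epsilon>) \<le> (2 ^ j * r) powr (- d - \<epsilon>)"
        using r assms d_ge_1 by (intro powr_mono2') auto
      also have "\<dots> = (2 ^ j * r) powr (- d - \<epsilon>) * of_bool (x \<in> lball (2 ^ Suc j * r))"
        using k(1) j by (simp add: lball_def)
      also have "\<dots> \<le> (\<Sum>k<n. (2 ^ k * r) powr (- d - \<epsilon>) * of_bool (x \<in> lball (2 ^ Suc k * r)))"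
        using k(2) j by (intro member_le_sum) auto
      finally show ?thesis .
    qed
    have "(\<Sum>x\<in>F. nv x powr (- d - \<epsilon>)) \<le>
        (\<Sum>x\<in>F. \<Sum>k<n. (2 ^ k * r) powr (- d - \<epsilon>) * of_bool (x \<in> lball (2 ^ Suc k * r)))"
      by (intro sum_mono pt)
    also have "\<dots> = (\<Sum>k<n. (2 ^ k * r) powr (- d - \<epsilon>) * (\<Sum>x\<in>F. of_bool (x \<in> lball (2 ^ Suc k * r))))"
      by (subst sum.swap) (simp add: sum_distrib_left)
    also have "\<dots> \<le> (\<Sum>k<n. K * 2 powr d * r powr (- \<epsilon>) * q ^ k)"
    proof (intro sum_mono)
      fix k
      have R: "1 \<le> 2 ^ k * r" using r one_le_power[of "2::real" k] mult_mono[of 1 "2 ^ k" 1 r] by simp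
      have "(\<Sum>x\<in>F. of_bool (x \<in> lball (2 ^ Suc k * r))) = real (card (F \<inter> lball (2 ^ Suc k * r)))"
        using F by (simp add: of_bool_def sum.If_cases)
      also have "\<dots> \<le> card (lball (2 ^ Suc k * r))" by (intro of_nat_mono card_mono) auto
      also have "\<dots> \<le> K * (2 * (2 ^ k * r)) powr d" using K(2)[of "2 ^ Suc k * r"] R by (simp add: mult.assoc)
      also have "\<dots> = K * 2 powr d * (2 ^ k * r) powr d" using R by (simp add: powr_mult)
      finally have "(2 ^ k * r) powr (- d - \<epsilon>) * (\<Sum>x\<in>F. of_bool (x \<in> lball (2 ^ Suc k * r))) \<le>
          (2 ^ k * r) powr (- d - \<epsilon>) * (K * 2 powr d * (2 ^ k * r) powr d)"
        by (intro mult_left_mono) auto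
      also have "\<dots> = K * 2 powr d * ((2 ^ k * r) powr (- d - \<epsilon>) * (2 ^ k * r) powr d)" by simp
      also have "(2 ^ k * r) powr (- d - \<epsilon>) * (2 ^ k * r) powr d = (2 ^ k * r) powr (- \<epsilon>)"
        by (simp flip: powr_add)
      also have "(2 ^ k * r) powr (- \<epsilon>) = (2 ^ k) powr (- \<epsilon>) * r powr (- \<epsilon>)" using r by (simp add: powr_mult)
      also have "(2 ^ k) powr (- \<epsilon>) = q ^ k"
      proof -
        have "(2 ^ k :: real) powr (- \<epsilon>) = 2 powr (- \<epsilon> * k)" by (simp add: powr_powr mult.commute flip: powr_realpow)
        also have "\<dots> = (2 powr (- \<epsilon>)) powr k" by (simp add: powr_powr)
        also have "2 powr (- \<epsilon>) = q" unfolding q_def by (simp add: powr_minus powr_divide field_simps)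
        also have "q powr k = q ^ k" using q by (simp add: powr_realpow)
        finally show ?thesis .
      qed
      finally show "(2 ^ k * r) powr (- d - \<epsilon>) * (\<Sum>x\<in>F. of_bool (x \<in> lball (2 ^ Suc k * r))) \<le>
          K * 2 powr d * r powr (- \<epsilon>) * q ^ k" by (simp add: mult_ac)
    qed
    also have "\<dots> = K * 2 powr d * r powr (- \<epsilon>) * (\<Sum>k<n. q ^ k)" by (simp add: sum_distrib_left)
    also have "\<dots> \<le> K * 2 powr d * r powr (- \<epsilon>) * (1 / (1 - q))"
      using K(1) by (intro mult_left_mono sum_geometric_le q) auto
    finally show ?thesis unfolding K'_def by (simp add: mult_ac)
  qed
  moreover have "0 < K'" unfolding K'_def using K q by simp
  ultimately show ?thesis by blast
qed

end

section \<open>The long-range model and its cut-offs\<close>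

lemma Tau_sym: "Tau w x y = Tau w y x"
proof -
  have "(y \<in> conn S x) = (x \<in> conn S y)" for S by (auto intro: conn_sym)
  then show ?thesis unfolding Tau_def by simp
qed

text \<open>\<open>b\<close> is a general parameter here, specialised to the critical value in the
  theorem. \<open>J_lower\<close> is the quantitative form of "raising the cut-off to
  \<open>R\<close> adds edges of length of order \<open>R\<close>".\<close>

locale lr_model = lattice_norm N d for N :: "real ^ 'd \<Rightarrow> real" and d +
  fixes \<alpha> b :: real and J :: "real \<Rightarrow> real" and CJ cJ rJ :: real
  assumes alpha: "0 < \<alpha>" and b: "0 \<le> b"
    and J_pos: "\<And>r. 0 < r \<Longrightarrow> 0 < J r"
    and J_antimono: "\<And>r s. 0 < r \<Longrightarrow> r \<le> s \<Longrightarrow> J s \<le> J r"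
    and CJ: "0 < CJ" and J_upper: "\<And>r. 1 \<le> r \<Longrightarrow> J r \<le> CJ * r powr (- d - \<alpha>)"
    and cJ: "0 < cJ" and rJ: "1 \<le> rJ"
    and J_lower: "\<And>R. rJ \<le> R \<Longrightarrow> cJ * R powr (- d - \<alpha>) \<le> J (R / 2) - J R"
begin

text \<open>The kernel \<open>cutoff_kernel\<close> with its integral evaluated as a difference, see
  \<open>integral_abs_deriv\<close>.\<close>

definition Kc :: "real \<Rightarrow> int ^ 'd \<Rightarrow> int ^ 'd \<Rightarrow> real" where
  "Kc r x y = (if x \<noteq> y \<and> nv (x - y) \<le> r then J (nv (x - y)) - J r else 0)"

definition Kf :: "int ^ 'd \<Rightarrow> int ^ 'd \<Rightarrow> real" where
  "Kf x y = (if x \<noteq> y then J (nv (x - y)) else 0)"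

definition wc :: "real \<Rightarrow> (int ^ 'd) set \<Rightarrow> real" where "wc r = kernel_weight (Kc r) b"
definition wf :: "(int ^ 'd) set \<Rightarrow> real" where "wf = kernel_weight Kf b"

text \<open>Weights of the independent layer that turns cut-off \<open>r\<close> into cut-off
  \<open>R\<close>.\<close>

definition wd :: "real \<Rightarrow> real \<Rightarrow> (int ^ 'd) set \<Rightarrow> real" where
  "wd r R e = wc R e - wc r e"

definition T :: "real \<Rightarrow> int ^ 'd \<Rightarrow> int ^ 'd \<Rightarrow> real" where "T r = Tau (wc r)"
definition Tf :: "int ^ 'd \<Rightarrow> int ^ 'd \<Rightarrow> real" where "Tf = Tau wf"

lemma nv_diff_pos: "x \<noteq> y \<Longrightarrow> 0 < nv (x - y)"
  by (rule nv_pos) simp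

lemma percolation_kernel_Kc: "percolation_kernel (Kc r) b"
proof
  show "Kc r x y = Kc r y x" for x y by (auto simp: Kc_def nv_commute[of x y])
  show "0 \<le> Kc r x y" for x y
    using J_antimono[of "nv (x - y)" r] nv_diff_pos[of x y] by (auto simp: Kc_def)
qed (use b in auto)

lemma percolation_kernel_Kf: "percolation_kernel Kf b"
proof
  show "Kf x y = Kf y x" for x y by (auto simp: Kf_def nv_commute[of x y])
  show "0 \<le> Kf x y" for x y using J_pos[OF nv_diff_pos[of x y]] by (auto simp: Kf_def)
qed (use b in auto)

lemma wc_nonneg: "0 \<le> wc r e"
  unfolding wc_def by (rule percolation_kernel.weight_nonneg[OF percolation_kernel_Kc])

lemma wf_nonneg: "0 \<le> wf e"
  unfolding wf_def by (rule percolation_kernel.weight_nonneg[OF percolation_kernel_Kf])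

lemma wc_pair: "x \<noteq> y \<Longrightarrow> wc r {x, y} = b * Kc r x y"
  unfolding wc_def by (rule percolation_kernel.weight_pair[OF percolation_kernel_Kc])

lemma wf_pair: "x \<noteq> y \<Longrightarrow> wf {x, y} = b * Kf x y"
  unfolding wf_def by (rule percolation_kernel.weight_pair[OF percolation_kernel_Kf])

lemma wc_outside: "e \<notin> edges \<Longrightarrow> wc r e = 0"
  by (simp add: wc_def kernel_weight_def)

lemma wf_outside: "e \<notin> edges \<Longrightarrow> wf e = 0"
  by (simp add: wf_def kernel_weight_def)

text \<open>A pair within distance \<open>r\<close> gains \<open>J r - J R\<close>, one between
  \<open>r\<close> and \<open>R\<close> gains \<open>J (nv (x - y)) - J R\<close>; monotonicity of
  \<open>J\<close> bounds both by \<open>J r\<close>.\<close>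

lemma wd_bounds:
  assumes "0 < r" "r \<le> R" "x \<noteq> y"
  shows "0 \<le> wd r R {x, y}" "wd r R {x, y} \<le> b * J r" "R < nv (x - y) \<Longrightarrow> wd r R {x, y} = 0"
proof -
  have pos: "0 < nv (x - y)" using assms by (intro nv_diff_pos)
  have J: "J R \<le> J r" "0 \<le> J R" "0 \<le> J r"
    using assms J_antimono[of r R] J_pos[of R] J_pos[of r] by auto
  have J1: "nv (x - y) \<le> R \<Longrightarrow> J R \<le> J (nv (x - y))" using J_antimono[OF pos] by simp
  have J2: "r \<le> nv (x - y) \<Longrightarrow> J (nv (x - y)) \<le> J r" using J_antimono[of r] assms by simp
  have eq: "wd r R {x, y} = b * (Kc R x y - Kc r x y)"
    unfolding wd_def wc_pair[OF assms(3)] by (simp add: algebra_simps)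
  have "0 \<le> Kc R x y - Kc r x y" "Kc R x y - Kc r x y \<le> J r"
    using assms J J1 J2 unfolding Kc_def by (auto split: if_splits)
  then show "0 \<le> wd r R {x, y}" "wd r R {x, y} \<le> b * J r" using b unfolding eq by (auto intro: mult_left_mono)
  show "R < nv (x - y) \<Longrightarrow> wd r R {x, y} = 0"
    unfolding eq Kc_def using assms by auto
qed

text \<open>As \<open>r \<le> R / 2\<close>, every pair within \<open>R / 2\<close> gains at least
  as much as a pair at distance exactly \<open>R / 2\<close> would.\<close>

lemma wd_lower:
  assumes "0 < r" "r \<le> R / 2" "x \<noteq> y" "nv (x - y) \<le> R / 2"
  shows "b * (J (R / 2) - J R) \<le> wd r R {x, y}"
proof -
  have pos: "0 < nv (x - y)" using assms by (intro nv_diff_pos)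
  have "J (R / 2) - J R \<le> Kc R x y - Kc r x y"
    using assms pos J_antimono[OF pos, of "R / 2"] J_antimono[of r "R / 2"] unfolding Kc_def by auto
  then have "b * (J (R / 2) - J R) \<le> b * (Kc R x y - Kc r x y)" using b by (intro mult_left_mono) auto
  then show ?thesis unfolding wd_def wc_pair[OF assms(3)] by (simp add: algebra_simps)
qed

lemma wd_nonneg: "0 < r \<Longrightarrow> r \<le> R \<Longrightarrow> 0 \<le> wd r R e"
proof (cases "e \<in> edges")
  case True
  assume "0 < r" "r \<le> R"
  obtain x y where "x \<noteq> y" "e = {x, y}" using edge_cases[OF True] by blast
  then show ?thesis using wd_bounds(1) \<open>0 < r\<close> \<open>r \<le> R\<close> by simp
qed (simp add: wd_def wc_outside)

lemma wc_eq_add: "wc R = (\<lambda>e. wc r e + wd r R e)"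
  by (auto simp: wd_def)

lemma wc_le_wf: "0 < r \<Longrightarrow> wc r e \<le> wf e"
proof (cases "e \<in> edges")
  case True
  assume r: "0 < r"
  obtain x y where xy: "x \<noteq> y" "e = {x, y}" using edge_cases[OF True] by blast
  have "Kc r x y \<le> Kf x y" using J_pos[OF r] J_pos[OF nv_diff_pos[OF xy(1)]] by (auto simp: Kc_def Kf_def)
  then show ?thesis using xy b by (simp add: wc_pair wf_pair mult_left_mono)
qed (simp add: wc_outside wf_outside)

lemma T_nonneg: "0 \<le> T r x y" and T_le_1: "T r x y \<le> 1" and T_self [simp]: "T r x x = 1"
  unfolding T_def by (simp_all add: Tau_nonneg[OF wc_nonneg] Tau_le_1[OF wc_nonneg] Tau_self[OF wc_nonneg])

lemma T_sym: "T r x y = T r y x"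
  unfolding T_def by (rule Tau_sym)

lemma T_mono: "0 < r \<Longrightarrow> r \<le> R \<Longrightarrow> T r x y \<le> T R x y"
proof -
  assume "0 < r" "r \<le> R"
  then have "Tau (wc r) x y \<le> Tau (\<lambda>e. wc r e + wd r R e) x y"
    by (intro Tau_mono wc_nonneg wd_nonneg)
  then show ?thesis unfolding T_def wc_eq_add[of R r, symmetric] .
qed

lemma T_le_Tf: "0 < r \<Longrightarrow> T r x y \<le> Tf x y"
proof -
  assume r: "0 < r"
  have "Tau (wc r) x y \<le> Tau (\<lambda>e. wc r e + (wf e - wc r e)) x y"
    by (rule Tau_mono[OF wc_nonneg]) (use wc_le_wf[OF r] in auto)
  then show ?thesis unfolding T_def Tf_def by simp
qed

lemma weight_translate:
  assumes "\<And>x y. K (v + x) (v + y) = K x y" "percolation_kernel K \<beta>"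
  shows "kernel_weight K \<beta> ((+) (v :: int ^ 'd) ` e) = kernel_weight K \<beta> e"
proof (cases "e \<in> edges")
  case True
  obtain x y where xy: "x \<noteq> y" "e = {x, y}" using edge_cases[OF True] by blast
  have "kernel_weight K \<beta> {v + x, v + y} = \<beta> * K (v + x) (v + y)"
    using xy by (intro percolation_kernel.weight_pair[OF assms(2)]) simp
  also have "\<dots> = kernel_weight K \<beta> {x, y}"
    unfolding assms(1) using xy by (intro percolation_kernel.weight_pair[OF assms(2), symmetric])
  finally show ?thesis using xy by simp
next
  case False
  have "card ((+) v ` e) = card e" by (rule card_image) (auto simp: inj_on_def)
  then show ?thesis using False by (simp add: kernel_weight_def edges_def)
qed

lemma bij_translate: "bij ((+) (v :: int ^ 'd))"
proof (rule bij_betw_byWitness[where f' = "\<lambda>x. x - v"])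
qed auto

lemma wc_translate: "wc r ((+) v ` e) = wc r e"
  unfolding wc_def by (rule weight_translate[OF _ percolation_kernel_Kc]) (simp add: Kc_def)

lemma wf_translate: "wf ((+) v ` e) = wf e"
  unfolding wf_def by (rule weight_translate[OF _ percolation_kernel_Kf]) (simp add: Kf_def)

lemma T_translate: "T r (v + x) (v + y) = T r x y"
  unfolding T_def by (rule Tau_image(1)[where w = "wc r" and f = "(+) v", OF wc_nonneg bij_translate wc_translate])

lemma Tf_translate: "Tf (v + x) (v + y) = Tf x y"
  unfolding Tf_def by (rule Tau_image(1)[where w = wf and f = "(+) v", OF wf_nonneg bij_translate wf_translate])

lemma T_origin: "T r x y = T r 0 (y - x)"
  using T_translate[of r x 0 "y - x"] by simp

lemma Tf_origin: "Tf x y = Tf 0 (y - x)"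
  using Tf_translate[of x 0 "y - x"] by simp

lemma maxdist_translate: "maxdist (wc r) ((+) v ` L) m = maxdist (wc r) L m"
  by (rule Tau_image(2)[where w = "wc r" and f = "(+) v", OF wc_nonneg bij_translate wc_translate])

end

text \<open>\<open>chi r\<close> stands for the susceptibility of the model cut off at \<open>r\<close>. The lower bound on it
  comes from criticality, the moment bound is the correlation length condition.\<close>

locale lr_cl = lr_model N d \<alpha> b J CJ cJ rJ
  for N :: "real ^ 'd \<Rightarrow> real" and d \<alpha> b J CJ cJ rJ +
  fixes chi :: "real \<Rightarrow> real" and c_lo :: real
  assumes b_pos: "0 < b"
    and chi_upper0: "\<And>r F. 1 \<le> r \<Longrightarrow> finite F \<Longrightarrow> (\<Sum>x\<in>F. T r 0 x) \<le> chi r"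
    and chi_least: "\<And>r B. 1 \<le> r \<Longrightarrow> (\<And>F. finite F \<Longrightarrow> (\<Sum>x\<in>F. T r 0 x) \<le> B) \<Longrightarrow> chi r \<le> B"
    and c_lo: "0 < c_lo" and chi_lower: "\<And>r. 1 \<le> r \<Longrightarrow> c_lo * r powr \<alpha> \<le> chi r"
    and moments: "\<And>p. 0 < p \<Longrightarrow> \<exists>C>0. \<forall>r\<ge>1. \<forall>F. finite F \<longrightarrow>
        (\<Sum>x\<in>F. nv x powr p * T r 0 x) \<le> C * r powr p * chi r"
begin

lemma chi_upper:
  assumes "1 \<le> r" "finite F"
  shows "(\<Sum>x\<in>F. T r u x) \<le> chi r"
proof -
  have "(\<Sum>x\<in>F. T r u x) = (\<Sum>x\<in>(\<lambda>x. x - u) ` F. T r 0 x)"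
    by (subst sum.reindex) (auto simp: inj_on_def T_origin[of r u])
  also have "\<dots> \<le> chi r" using assms by (intro chi_upper0) auto
  finally show ?thesis .
qed

lemma chi_ge_1: "1 \<le> r \<Longrightarrow> 1 \<le> chi r"
  using chi_upper0[of r "{0}"] by simp

lemma chi_mono: "1 \<le> r \<Longrightarrow> r \<le> R \<Longrightarrow> chi r \<le> chi R"
  by (rule chi_least) (auto intro!: order_trans[OF sum_mono[OF T_mono] chi_upper0])

text \<open>Markov's inequality for the p-th moment of the two-point function.\<close>

lemma far_mass:
  assumes "0 < p"
  shows "\<exists>C>0. \<forall>r\<ge>1. \<forall>t>0. \<forall>F u. finite F \<longrightarrow> (\<forall>x\<in>F. t * r \<le> nv (x - u)) \<longrightarrow>
    (\<Sum>x\<in>F. T r u x) \<le> C * t powr (- p) * chi r"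
proof -
  obtain C where C: "0 < C" "\<And>r F. 1 \<le> r \<Longrightarrow> finite F \<Longrightarrow>
      (\<Sum>x\<in>F. nv x powr p * T r 0 x) \<le> C * r powr p * chi r"
    using moments[OF assms] by blast
  have "(\<Sum>x\<in>F. T r u x) \<le> C * t powr (- p) * chi r"
    if r: "1 \<le> r" and t: "0 < t" and F: "finite F" "\<And>x. x \<in> F \<Longrightarrow> t * r \<le> nv (x - u)" for r t F u
  proof -
    have pos: "0 < (t * r) powr p" using r t by simp
    have "(t * r) powr p * (\<Sum>x\<in>F. T r u x) \<le> (\<Sum>x\<in>F. nv (x - u) powr p * T r 0 (x - u))"
      unfolding sum_distrib_left
    proof (intro sum_mono)
      fix x assume "x \<in> F"
      then have "(t * r) powr p \<le> nv (x - u) powr p" using F r t assms by (intro powr_mono2) auto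
      then show "(t * r) powr p * T r u x \<le> nv (x - u) powr p * T r 0 (x - u)"
        using T_nonneg[of r 0 "x - u"] by (simp add: T_origin[of r u] mult_right_mono)
    qed
    also have "\<dots> = (\<Sum>x\<in>(\<lambda>x. x - u) ` F. nv x powr p * T r 0 x)"
      by (subst sum.reindex) (auto simp: inj_on_def)
    also have "\<dots> \<le> C * r powr p * chi r" using r F by (intro C) auto
    finally have "(\<Sum>x\<in>F. T r u x) \<le> C * r powr p * chi r / (t * r) powr p"
      using pos by (simp add: pos_le_divide_eq mult.commute)
    also have "\<dots> = C * t powr (- p) * chi r"
      using r t by (simp add: powr_mult powr_minus field_simps)
    finally show ?thesis .
  qed
  then show ?thesis using C(1) by blast
qed

lemma half_mass: "\<exists>L\<ge>1. \<forall>r\<ge>1. chi r / 2 \<le> (\<Sum>x\<in>lball (L * r). T r 0 x)"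
proof -
  obtain C where C: "0 < C" "\<forall>r\<ge>1. \<forall>t>0. \<forall>F u. finite F \<longrightarrow> (\<forall>x\<in>F. t * r \<le> nv (x - u)) \<longrightarrow>
    (\<Sum>x\<in>F. T r u x) \<le> C * t powr (- 1) * chi r"
    using far_mass[OF zero_less_one] by (elim exE conjE) (rule that)
  \<comment> \<open>Chosen so that \<open>far_mass\<close> with exponent 1 leaves at most the
    fraction \<open>C / L \<le> 1 / 2\<close> outside the ball.\<close>
  define L where "L = 2 * C + 1"
  have L: "1 \<le> L" "C * L powr (- 1) \<le> 1 / 2" unfolding L_def using C(1) by (auto simp: powr_minus field_simps)
  have "chi r / 2 \<le> (\<Sum>x\<in>lball (L * r). T r 0 x)" if r: "1 \<le> r" for r
  proof -
    have "chi r \<le> (\<Sum>x\<in>lball (L * r). T r 0 x) + chi r / 2"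
    proof (rule chi_least[OF r])
      fix F :: "(int ^ 'd) set" assume F: "finite F"
      have "(\<Sum>x\<in>F. T r 0 x) = (\<Sum>x\<in>F \<inter> lball (L * r). T r 0 x) + (\<Sum>x\<in>F - lball (L * r). T r 0 x)"
        using F by (rule sum.Int_Diff)
      also have "(\<Sum>x\<in>F \<inter> lball (L * r). T r 0 x) \<le> (\<Sum>x\<in>lball (L * r). T r 0 x)"
        by (intro sum_mono2) (auto simp: T_nonneg)
      also have "(\<Sum>x\<in>F - lball (L * r). T r 0 x) \<le> C * L powr (- 1) * chi r"
        using r L F by (intro C(2)[rule_format]) (auto simp: lball_def)
      also have "\<dots> \<le> 1 / 2 * chi r" using chi_ge_1[OF r] by (intro mult_right_mono L) auto
      finally show "(\<Sum>x\<in>F. T r 0 x) \<le> (\<Sum>x\<in>lball (L * r). T r 0 x) + chi r / 2" by simp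
    qed
    then show ?thesis by simp
  qed
  then show ?thesis using L by blast
qed

text \<open>An a priori bound: any polynomial rate is enough to exclude doubly exponential growth
  along a geometric sequence of scales.\<close>

lemma chi_polynomial: "\<exists>K>0. \<forall>r\<ge>1. chi r \<le> K * r powr d"
proof -
  obtain L where L: "1 \<le> L" "\<And>r. 1 \<le> r \<Longrightarrow> chi r / 2 \<le> (\<Sum>x\<in>lball (L * r). T r 0 x)"
    using half_mass by blast
  obtain K where K: "0 < K" "\<And>R. 1 \<le> R \<Longrightarrow> card (lball R) \<le> K * R powr d" using lball_upper by blast
  have "chi r \<le> 2 * K * L powr d * r powr d" if r: "1 \<le> r" for r
  proof -
    have Lr: "1 \<le> L * r" using L(1) r mult_mono[of 1 L 1 r] by simp
    have "chi r / 2 \<le> (\<Sum>x\<in>lball (L * r). 1)"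
      using L(2)[OF r] sum_mono[of "lball (L * r)" "T r 0" "\<lambda>_. 1"] T_le_1 by (metis order_trans)
    also have "\<dots> \<le> K * (L * r) powr d" using K(2)[OF Lr] by simp
    also have "\<dots> = K * L powr d * r powr d" using L r by (simp add: powr_mult)
    finally show ?thesis by simp
  qed
  moreover have "0 < 2 * K * L powr d" using K L by simp
  ultimately show ?thesis by blast
qed

end

section \<open>The susceptibility under the correlation length condition\<close>

lemma maxdist_iterate:
  assumes w: "\<And>e. 0 \<le> w e" and L: "finite L" and m: "1 \<le> m"
  shows "maxdist w L (3 ^ k * m) \<le> maxdist w L m ^ 2 ^ k"
proof (induction k)
  case (Suc k)
  have "1 \<le> 3 ^ k * m" using m one_le_power[of "3::real" k] mult_mono[of 1 "3 ^ k" 1 m] by simp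
  from maxdist_cube[OF w L this]
  have "maxdist w L (3 ^ Suc k * m) \<le> (maxdist w L (3 ^ k * m))\<^sup>2" by (simp add: mult.assoc)
  also have "\<dots> \<le> (maxdist w L m ^ 2 ^ k)\<^sup>2"
    by (intro power_mono Suc maxdist_bounds w)
  also have "\<dots> = maxdist w L m ^ 2 ^ Suc k" by (simp add: power_mult[symmetric] mult.commute)
  finally show ?case .
qed simp

context lr_cl
begin

definition L0 :: real where
  "L0 = (SOME L. 1 \<le> L \<and> (\<forall>r\<ge>1. chi r / 2 \<le> (\<Sum>x\<in>lball (L * r). T r 0 x)))"

lemma L0: "1 \<le> L0" "1 \<le> r \<Longrightarrow> chi r / 2 \<le> (\<Sum>x\<in>lball (L0 * r). T r 0 x)"
proof -
  have "\<exists>L. 1 \<le> L \<and> (\<forall>r\<ge>1. chi r / 2 \<le> (\<Sum>x\<in>lball (L * r). T r 0 x))"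
    using half_mass by simp
  from someI_ex[OF this] show "1 \<le> L0" "1 \<le> r \<Longrightarrow> chi r / 2 \<le> (\<Sum>x\<in>lball (L0 * r). T r 0 x)"
    unfolding L0_def by auto
qed

text \<open>\<open>Ms r\<close> is the cluster size at which the edges that appear when the cut-off is raised from \<open>r\<close> to
  \<open>rho * r\<close>, each of weight at least \<open>kap * r powr (- d - \<alpha>)\<close>, join two clusters at distance of order
  \<open>r\<close> with a probability of order one; compare \<open>kap_Ms\<close>.\<close>

definition g0 :: real where "g0 = nv 1"

lemma g0: "0 < g0"
  unfolding g0_def by (rule nv_pos) simp

text \<open>\<open>rho * r / 2\<close> must exceed \<open>2 * L0 * r + 2 * g0 * r\<close>, the
  distance between points of neighbouring boxes in the chain, and \<open>2 * L0 * r + r\<close>,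
  that between boxes around 0 and around a point within \<open>r\<close>.\<close>

definition rho :: real where "rho = 4 * L0 + 4 * g0 + 2"
definition kap :: real where "kap = b * cJ * rho powr (- d - \<alpha>)"
definition Ms :: "real \<Rightarrow> real" where "Ms r = r powr ((d + \<alpha>) / 2)"
definition A :: "real \<Rightarrow> real" where "A r = chi r * r powr (- \<alpha>)"
definition Bx :: "real \<Rightarrow> (int ^ 'd) set" where "Bx r = lball (L0 * r)"

lemma rho: "2 \<le> rho"
  unfolding rho_def using L0(1) g0 by simp

lemma kap: "0 < kap"
  unfolding kap_def using b_pos cJ rho by simp

lemma rho_mult: "1 \<le> r \<Longrightarrow> 1 \<le> rho * r" "1 \<le> r \<Longrightarrow> r \<le> rho * r" "1 \<le> r \<Longrightarrow> r \<le> rho * r / 2"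
proof -
  have "2 * r \<le> rho * r" if "1 \<le> r" using that rho by (intro mult_right_mono) auto
  then show "1 \<le> r \<Longrightarrow> 1 \<le> rho * r" and "1 \<le> r \<Longrightarrow> r \<le> rho * r" and "1 \<le> r \<Longrightarrow> r \<le> rho * r / 2"
    by linarith+
qed

lemma Ms: "1 \<le> r \<Longrightarrow> 1 \<le> Ms r"
  unfolding Ms_def using d_ge_1 alpha by (intro ge_one_powr_ge_zero) auto

lemma Ms_sq: "1 \<le> r \<Longrightarrow> (Ms r)\<^sup>2 = r powr (d + \<alpha>)"
  unfolding Ms_def by (simp add: powr_powr power2_eq_square flip: powr_add)

lemma A_lower: "1 \<le> r \<Longrightarrow> c_lo \<le> A r"
  using mult_right_mono[OF chi_lower[of r], of "r powr (- \<alpha>)"]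
  unfolding A_def by (simp add: mult.assoc flip: powr_add)

lemma A_pos: "1 \<le> r \<Longrightarrow> 0 < A r"
  using A_lower[of r] c_lo by simp

lemma chi_A: "1 \<le> r \<Longrightarrow> chi r = A r * r powr \<alpha>"
  unfolding A_def by (simp add: mult.assoc flip: powr_add)

lemma finite_Bx [simp]: "finite (Bx r)"
  by (simp add: Bx_def)

lemma wd_at_scale:
  assumes "rJ \<le> r" "x \<noteq> y" "nv (x - y) \<le> rho * r / 2"
  shows "kap * r powr (- d - \<alpha>) \<le> wd r (rho * r) {x, y}"
proof -
  have r: "1 \<le> r" using assms rJ by simp
  have "rJ \<le> rho * r" using assms(1) rho_mult(2)[OF r] by simp
  from J_lower[OF this] have "b * (cJ * (rho * r) powr (- d - \<alpha>)) \<le> b * (J (rho * r / 2) - J (rho * r))"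
    using b by (intro mult_left_mono) auto
  also have "\<dots> \<le> wd r (rho * r) {x, y}"
    using r rho_mult(3)[OF r] assms by (intro wd_lower) auto
  finally show ?thesis using r rho by (simp add: kap_def powr_mult mult_ac)
qed

text \<open>The exponent in the sprinkling estimate for clusters of size \<open>s * Ms r\<close>
  does not depend on the scale.\<close>

lemma kap_Ms: "1 \<le> r \<Longrightarrow> kap * r powr (- d - \<alpha>) * (s * Ms r)\<^sup>2 = kap * s\<^sup>2"
proof -
  assume r: "1 \<le> r"
  have "r powr (- d - \<alpha>) * r powr (d + \<alpha>) = 1" using r by (simp flip: powr_add)
  then show ?thesis using Ms_sq[OF r] by (simp add: power_mult_distrib mult_ac)
qed

text \<open>If clusters of size \<open>6 ^ k * Ms r\<close> are not unlikely, then by \<open>maxdist_iterate\<close> clusters of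
  size \<open>2 ^ k * Ms r\<close> are so likely that they are present in all of about \<open>2 ^ k\<close> boxes in a row;
  consecutive ones are joined by edges of length of order \<open>r\<close>. This contradicts the
  correlation length condition at scale \<open>rho * r\<close> unless \<open>A (rho * r)\<close> is large.\<close>

lemma chain_of_boxes:
  fixes k :: nat
  assumes r: "rJ \<le> r"
    and likely: "1 / 9 \<le> maxdist (wc r) (Bx r) (6 ^ k * Ms r)"
    and D: "real D \<le> 2 ^ k / 24" "1 \<le> D" and k: "3 / kap \<le> 2 ^ k"
  shows "4 ^ k * r powr (d + \<alpha>) / 3 \<le>
     (\<Sum>x\<in>Bx r. \<Sum>y\<in>(+) (\<chi> i. of_nat (D * nat \<lceil>r\<rceil>) * 1 $ i) ` Bx r. T (rho * r) x y)"
proof -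
  have r1: "1 \<le> r" using r rJ by simp
  \<comment> \<open>Boxes are moved by lattice vectors, so the step is rounded up to an integer
    between \<open>r\<close> and \<open>2 * r\<close>.\<close>
  define t where "t = nat \<lceil>r\<rceil>"
  have t: "r \<le> t" "t \<le> 2 * r" unfolding t_def using r1 by (auto simp: le_nat_iff) linarith
  define sh where "sh = (\<lambda>n. (\<chi> i. of_nat n * 1 $ i) :: int ^ 'd)"
  have sh: "nv (sh n) = n * g0" for n unfolding sh_def g0_def by (rule nv_scale)
  have sh_add: "sh (Suc i * t) - sh (i * t) = sh t" for i
    unfolding sh_def by (simp add: vec_eq_iff algebra_simps)
  define Lam where "Lam = (\<lambda>i. (+) (sh (i * t)) ` Bx r)"
  define m where "m = 2 ^ k * Ms r"
  define \<kappa> where "\<kappa> = kap * r powr (- d - \<alpha>)"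
  have \<kappa>: "0 \<le> \<kappa>" unfolding \<kappa>_def using kap by simp
  have m1: "1 \<le> m" unfolding m_def
    using Ms[OF r1] one_le_power[of "2::real" k] mult_mono[of 1 "2 ^ k" 1 "Ms r"] by simp
  \<comment> \<open>If size \<open>m\<close> had probability at most \<open>1 - \<epsilon>\<close>,
    then size \<open>3^k * m = 6^k * Ms r\<close> would have probability at most
    \<open>exp (- \<epsilon> * 2^k) = exp (- 4) < 1 / 9\<close>.\<close>
  define \<epsilon> :: real where "\<epsilon> = 4 / 2 ^ k"
  have big: "1 - \<epsilon> < maxdist (wc r) (Bx r) m"
  proof (rule ccontr)
    let ?P = "maxdist (wc r) (Bx r) m"
    assume "\<not> ?thesis"
    then have "?P \<le> exp (- \<epsilon>)" using exp_ge_add_one_self[of "- \<epsilon>"] by simp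
    then have "?P ^ 2 ^ k \<le> exp (- \<epsilon>) ^ 2 ^ k"
      using maxdist_bounds[OF wc_nonneg] by (intro power_mono) auto
    also have "\<dots> = exp (- 4)" unfolding \<epsilon>_def by (simp flip: exp_of_nat_mult)
    also have "\<dots> < 1 / 9"
    proof -
      have "(2 :: real) ^ 4 \<le> exp 1 ^ 4" using exp_ge_add_one_self[of 1] by (intro power_mono) auto
      also have "\<dots> = exp 4" by (simp flip: exp_of_nat_mult)
      finally show ?thesis by (simp add: exp_minus field_simps)
    qed
    finally have "?P ^ 2 ^ k < 1 / 9" .
    moreover have "maxdist (wc r) (Bx r) (6 ^ k * Ms r) \<le> ?P ^ 2 ^ k"
    proof -
      have "6 ^ k * Ms r = 3 ^ k * m" unfolding m_def by (simp add: power_mult_distrib[symmetric])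
      then show ?thesis using maxdist_iterate[OF wc_nonneg finite_Bx m1] by simp
    qed
    ultimately show False using likely by simp
  qed
  have km: "\<kappa> * m\<^sup>2 = kap * 4 ^ k"
    using kap_Ms[OF r1, of "2 ^ k"] unfolding \<kappa>_def m_def by (simp add: power2_eq_square flip: power_mult_distrib)
  have "m\<^sup>2 * (1 - (real D + 1) * \<epsilon> - D * exp (- \<kappa> * m\<^sup>2)) \<le>
     (\<Sum>x\<in>Lam 0. \<Sum>y\<in>Lam D. Tau (\<lambda>e. wc r e + wd r (rho * r) e) x y)"
  proof (rule Tau_chain)
    show "0 \<le> wd r (rho * r) e" for e using r1 rho_mult(2)[OF r1] by (intro wd_nonneg) auto
    show "1 - \<epsilon> < maxdist (wc r) (Lam i) m" for i
      unfolding Lam_def maxdist_translate by (rule big)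
    show "\<kappa> \<le> wd r (rho * r) {x, y}" if in_Lam: "x \<in> Lam i" "y \<in> Lam (Suc i)" and ne: "x \<noteq> y" for i x y
    proof -
      obtain x' y' where xy: "x = sh (i * t) + x'" "y = sh (Suc i * t) + y'" "x' \<in> Bx r" "y' \<in> Bx r"
        using in_Lam unfolding Lam_def by auto
      have "x - y = x' - y' - sh t" unfolding xy sh_add[of i, symmetric] by simp
      then have "nv (x - y) \<le> nv x' + nv y' + nv (sh t)"
        using nv_triangle_diff[of "x' - y'" "sh t"] nv_triangle_diff[of x' y'] by simp
      also have "\<dots> \<le> L0 * r + L0 * r + 2 * r * g0"
        using xy t g0 unfolding sh Bx_def lball_def by (intro add_mono mult_right_mono) auto
      also have "\<dots> \<le> rho * r / 2" unfolding rho_def using r1 by (simp add: algebra_simps)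
      finally show ?thesis unfolding \<kappa>_def using ne by (intro wd_at_scale r) auto
    qed
  qed (use m1 \<kappa> in \<open>auto simp: wc_nonneg Lam_def\<close>)
  then have chain: "m\<^sup>2 * (1 - (real D + 1) * \<epsilon> - D * exp (- \<kappa> * m\<^sup>2)) \<le>
     (\<Sum>x\<in>Lam 0. \<Sum>y\<in>Lam D. T (rho * r) x y)"
    unfolding T_def wc_eq_add[of "rho * r" r, symmetric] .
  have "(real D + 1) * \<epsilon> \<le> 1 / 3"
  proof -
    have "real D + 1 \<le> 2 ^ k / 12" using D by simp
    then have "(real D + 1) * \<epsilon> \<le> (2 ^ k / 12) * (4 / 2 ^ k)" unfolding \<epsilon>_def by (intro mult_right_mono) auto
    then show ?thesis by simp
  qed
  \<comment> \<open>From \<open>exp (- u) \<le> 1 / u\<close> with \<open>u = kap * 4^k\<close>,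
    where \<open>D \<le> 2^k\<close> and \<open>3 / kap \<le> 2^k\<close>.\<close>
  moreover have "D * exp (- \<kappa> * m\<^sup>2) \<le> 1 / 3"
  proof -
    have "kap * 4 ^ k \<le> exp (kap * 4 ^ k)" using exp_ge_add_one_self[of "kap * 4 ^ k"] by linarith
    then have "exp (- (kap * 4 ^ k)) \<le> 1 / (kap * 4 ^ k)"
      using kap by (simp add: exp_minus field_simps)
    moreover have "real D \<le> 2 ^ k" using D(1) zero_less_power[of "2 :: real" k] by linarith
    moreover have "exp (- \<kappa> * m\<^sup>2) = exp (- (kap * 4 ^ k))" using km by simp
    ultimately have "D * exp (- \<kappa> * m\<^sup>2) \<le> 2 ^ k * (1 / (kap * 4 ^ k))"
      by (intro mult_mono) simp_all
    also have "\<dots> = 1 / (kap * 2 ^ k)"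
      using kap by (simp add: field_simps flip: power_mult_distrib)
    also have "\<dots> \<le> 1 / 3" using k kap by (simp add: field_simps)
    finally show ?thesis .
  qed
  ultimately have "1 / 3 \<le> 1 - (real D + 1) * \<epsilon> - D * exp (- \<kappa> * m\<^sup>2)" by linarith
  then have "m\<^sup>2 * (1 / 3) \<le> m\<^sup>2 * (1 - (real D + 1) * \<epsilon> - D * exp (- \<kappa> * m\<^sup>2))"
    by (rule mult_left_mono) simp
  also note chain
  also have "Lam 0 = Bx r"
  proof -
    have "sh 0 = 0" unfolding sh_def by (simp add: vec_eq_iff)
    then show ?thesis unfolding Lam_def by simp
  qed
  also have "Lam D = (+) (\<chi> i. of_nat (D * nat \<lceil>r\<rceil>) * 1 $ i) ` Bx r"
    unfolding Lam_def sh_def t_def ..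
  finally have "m\<^sup>2 * (1 / 3) \<le> (\<Sum>x\<in>Bx r. \<Sum>y\<in>(+) (\<chi> i. of_nat (D * nat \<lceil>r\<rceil>) * 1 $ i) ` Bx r. T (rho * r) x y)" .
  moreover have "m\<^sup>2 = 4 ^ k * r powr (d + \<alpha>)"
    unfolding m_def power_mult_distrib Ms_sq[OF r1] by (simp add: power2_eq_square flip: power_mult_distrib)
  ultimately show ?thesis by (simp only: times_divide_eq_right mult_1_right)
qed

text \<open>The chain connects about \<open>4^k * r^(d + \<alpha>)\<close> pairs at distance of
  order \<open>2^k * r\<close> on average, while the p-th moment at scale \<open>rho * r\<close>
  allows only the number of points of a box times \<open>(2^k)^(-p) * chi (rho * r)\<close>, up to
  constants.\<close>

lemma likely_implies_A_large:
  assumes p: "0 < p"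
  shows "\<exists>C>0. \<forall>r\<ge>rJ. \<forall>k. 1 / 9 \<le> maxdist (wc r) (Bx r) (6 ^ k * Ms r) \<longrightarrow>
    (2 ^ k) powr p \<le> C * A (rho * r)"
proof -
  obtain C where C: "0 < C" "\<forall>r\<ge>1. \<forall>t>0. \<forall>F u. finite F \<longrightarrow> (\<forall>x\<in>F. t * r \<le> nv (x - u)) \<longrightarrow>
    (\<Sum>x\<in>F. T r u x) \<le> C * t powr (- p) * chi r"
    using far_mass[OF p] by (elim exE conjE) (rule that)
  obtain K where K: "0 < K" "\<And>R. 1 \<le> R \<Longrightarrow> card (lball R) \<le> K * R powr d" using lball_upper by blast
  \<comment> \<open>For \<open>2^k\<close> below \<open>B0\<close> the claim follows from
    \<open>A \<ge> c_lo\<close>. Above it, 48 gives \<open>D \<ge> 1\<close>, \<open>3 / kap\<close>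
    is needed for the chain, and the third bound makes half the displacement of the last box exceed
    twice the box radius.\<close>
  define B0 where "B0 = Max {48, 3 / kap, 192 * L0 / g0}"
  have B0: "48 \<le> B0" "3 / kap \<le> B0" "192 * L0 / g0 \<le> B0" unfolding B0_def by auto
  \<comment> \<open>With \<open>D \<ge> 2^k / 48\<close>, half of the displacement
    \<open>D * r * g0\<close> is at least \<open>s * 2^k * (rho * r)\<close>; the other half absorbs
    the radii of the end boxes.\<close>
  define s where "s = g0 / (96 * rho)"
  have s: "0 < s" unfolding s_def using g0 rho by simp
  define C1 where "C1 = 3 * K * L0 powr d * C * s powr (- p) * rho powr \<alpha>"
  have C1: "0 < C1" unfolding C1_def using K C L0 s rho by simp
  define C2 where "C2 = C1 + B0 powr p / c_lo"
  have "0 \<le> B0 powr p / c_lo" using c_lo by simp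
  then have C2: "C1 \<le> C2" "B0 powr p / c_lo \<le> C2" "0 < C2" unfolding C2_def using C1 by linarith+
  have "(2 ^ k) powr p \<le> C2 * A (rho * r)"
    if r: "rJ \<le> r" and likely: "1 / 9 \<le> maxdist (wc r) (Bx r) (6 ^ k * Ms r)" for r k
  proof (cases "2 ^ k < B0")
    case True
    have r1: "1 \<le> rho * r" using r rJ rho_mult(1)[of r] by simp
    have "(2 ^ k) powr p \<le> B0 powr p" using True p by (intro powr_mono2) auto
    also have "\<dots> = (B0 powr p / c_lo) * c_lo" using c_lo by simp
    also have "\<dots> \<le> C2 * A (rho * r)"
      using A_lower[OF r1] c_lo C2 by (intro mult_mono) auto
    finally show ?thesis .
  next
    case False
    have r1: "1 \<le> r" "1 \<le> rho * r" using r rJ rho_mult(1)[of r] by auto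
    have kB: "48 \<le> (2 :: real) ^ k" "3 / kap \<le> 2 ^ k" "192 * L0 / g0 \<le> 2 ^ k" using False B0 by auto
    define D where "D = nat \<lfloor>2 ^ k / 24 :: real\<rfloor>"
    have Dk: "real D = of_int \<lfloor>2 ^ k / 24 :: real\<rfloor>" unfolding D_def by (simp add: of_nat_nat)
    have D: "real D \<le> 2 ^ k / 24" "2 ^ k / 48 \<le> real D" "1 \<le> D"
    proof -
      show "real D \<le> 2 ^ k / 24" unfolding Dk by (rule of_int_floor_le)
      have "2 ^ k / 24 < real D + 1" unfolding Dk by linarith
      then show "2 ^ k / 48 \<le> real D" "1 \<le> D" using kB(1) by linarith+
    qed
    define t where "t = nat \<lceil>r\<rceil>"
    have t: "r \<le> t" unfolding t_def using r1 by linarith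
    define v :: "int ^ 'd" where "v = (\<chi> i. of_nat (D * t) * 1 $ i)"
    have v: "nv v = real (D * t) * g0" unfolding v_def g0_def by (rule nv_scale)
    have sum_y: "(\<Sum>y\<in>(+) v ` Bx r. T (rho * r) x y) \<le> C * (s * 2 ^ k) powr (- p) * chi (rho * r)"
      if x: "x \<in> Bx r" for x
    proof (rule C(2)[rule_format])
      fix y assume "y \<in> (+) v ` Bx r"
      then obtain y' where y: "y = v + y'" "y' \<in> Bx r" by auto
      have "nv v \<le> nv (y - x) + nv x + nv y'"
        using nv_triangle[of "y - x" "x - y'"] nv_triangle_diff[of x y'] y by simp
      moreover have "real D * r * g0 \<le> nv v"
        unfolding v of_nat_mult using t g0 by (intro mult_right_mono mult_left_mono) auto
      ultimately have "real D * r * g0 - 2 * L0 * r \<le> nv (y - x)"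
        using x y(2) unfolding Bx_def lball_def mem_Collect_eq by linarith
      moreover have "s * 2 ^ k * (rho * r) \<le> real D * r * g0 - 2 * L0 * r"
      proof -
        have "s * 2 ^ k * rho = (2 ^ k / 48) * g0 / 2" unfolding s_def using rho by simp
        also have "\<dots> \<le> real D * g0 / 2" using D(2) g0 by simp
        finally have 1: "s * 2 ^ k * rho \<le> real D * g0 / 2" .
        have "4 * L0 / g0 \<le> real D" using kB(3) D(2) by simp
        then have "2 * L0 \<le> real D * g0 / 2" using g0 by (simp add: field_simps)
        with 1 have "s * 2 ^ k * rho \<le> real D * g0 - 2 * L0" by simp
        then have "s * 2 ^ k * rho * r \<le> (real D * g0 - 2 * L0) * r" using r1 by (intro mult_right_mono) auto
        then show ?thesis by (simp add: algebra_simps)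
      qed
      ultimately show "s * 2 ^ k * (rho * r) \<le> nv (y - x)" by simp
    qed (use r1 s in auto)
    have "4 ^ k * r powr (d + \<alpha>) / 3 \<le> (\<Sum>x\<in>Bx r. \<Sum>y\<in>(+) v ` Bx r. T (rho * r) x y)"
      unfolding v_def t_def using D kB by (intro chain_of_boxes r likely) auto
    also have "\<dots> \<le> (\<Sum>x\<in>Bx r. C * (s * 2 ^ k) powr (- p) * chi (rho * r))"
      by (intro sum_mono sum_y)
    also have "\<dots> = real (card (Bx r)) * (C * (s * 2 ^ k) powr (- p) * chi (rho * r))" by simp
    also have "\<dots> \<le> (K * (L0 * r) powr d) * (C * (s * 2 ^ k) powr (- p) * chi (rho * r))"
      using L0(1) r1 mult_mono[of 1 L0 1 r] C(1) chi_ge_1[OF r1(2)] unfolding Bx_def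
      by (intro mult_right_mono K) auto
    also have "\<dots> = K * L0 powr d * C * s powr (- p) * (2 ^ k) powr (- p) * r powr d * (A (rho * r) * rho powr \<alpha> * r powr \<alpha>)"
      unfolding chi_A[OF r1(2)] using L0(1) r1 s rho by (simp add: powr_mult)
    finally have "4 ^ k * r powr (d + \<alpha>) / 3 \<le> C1 / 3 * (2 ^ k) powr (- p) * A (rho * r) * (r powr d * r powr \<alpha>)"
      unfolding C1_def by (simp add: mult_ac)
    then have "(4 ^ k / 3) * r powr (d + \<alpha>) \<le> (C1 / 3 * (2 ^ k) powr (- p) * A (rho * r)) * r powr (d + \<alpha>)"
      by (simp add: powr_add)
    then have "4 ^ k / 3 \<le> C1 / 3 * (2 ^ k) powr (- p) * A (rho * r)"
      using r1 by (subst (asm) mult_le_cancel_right_pos) auto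
    then have "4 ^ k * (2 ^ k) powr p \<le> C1 * (2 ^ k) powr (- p) * A (rho * r) * (2 ^ k) powr p"
      by (intro mult_right_mono) auto
    also have "\<dots> = C1 * A (rho * r)"
      by (simp add: powr_minus field_simps)
    finally have "4 ^ k * (2 ^ k) powr p \<le> C1 * A (rho * r)" .
    moreover have "1 * (2 ^ k) powr p \<le> 4 ^ k * (2 ^ k :: real) powr p" by (intro mult_right_mono) auto
    moreover have "C1 * A (rho * r) \<le> C2 * A (rho * r)" using C2 A_pos[OF r1(2)] by (intro mult_right_mono) auto
    ultimately show ?thesis by linarith
  qed
  then show ?thesis using C2(3) by blast
qed

text \<open>\<open>k\<close> is the least number with \<open>C * A (rho * r) < 2^(24 * k)\<close>.
  Minimality bounds the preceding power, whose fourth root \<open>64^(k - 1)\<close> dominates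
  \<open>36^(k - 1)\<close>; this is where the 24th moment comes from.\<close>

lemma rare_size:
  "\<exists>C>0. \<forall>r\<ge>rJ. \<exists>k :: nat. maxdist (wc r) (Bx r) (6 ^ k * Ms r) < 1 / 9 \<and> 36 ^ k \<le> C * A (rho * r) powr (1 / 4)"
proof -
  obtain C where C: "0 < C" "\<And>r k. rJ \<le> r \<Longrightarrow> 1 / 9 \<le> maxdist (wc r) (Bx r) (6 ^ k * Ms r) \<Longrightarrow>
    (2 ^ k) powr 24 \<le> C * A (rho * r)"
    using likely_implies_A_large[of 24] by auto
  \<comment> \<open>The first summand covers \<open>k = 0\<close> through
    \<open>A \<ge> c_lo\<close>, the second covers \<open>k > 0\<close> with a factor 36 for the
    last step.\<close>
  define C' where "C' = c_lo powr (- 1 / 4) + 36 * C powr (1 / 4)"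
  have C': "0 < C'" unfolding C'_def using c_lo C by (simp add: add_pos_pos)
  have "\<exists>k. maxdist (wc r) (Bx r) (6 ^ k * Ms r) < 1 / 9 \<and> 36 ^ k \<le> C' * A (rho * r) powr (1 / 4)"
    if r: "rJ \<le> r" for r
  proof -
    have r1: "1 \<le> rho * r" using r rJ rho_mult(1)[of r] by simp
    let ?Y = "C * A (rho * r)"
    let ?P = "\<lambda>k. ?Y < (2 ^ 24) ^ k"
    obtain n where n: "?P n" using real_arch_pow[of "2 ^ 24" ?Y] by auto
    define k where "k = (LEAST k. ?P k)"
    have Pk: "?P k" unfolding k_def by (rule LeastI[of ?P, OF n])
    have pw: "((2 :: real) ^ j) powr 24 = (2 ^ 24) ^ j" for j
    proof -
      have "((2 :: real) ^ j) powr (real 24) = (2 ^ j) ^ 24" by (rule powr_realpow) simp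
      also have "((2 :: real) ^ j) ^ 24 = (2 ^ 24) ^ j" by (simp only: power_mult[symmetric] mult.commute)
      finally show ?thesis by simp
    qed
    have "\<not> 1 / 9 \<le> maxdist (wc r) (Bx r) (6 ^ k * Ms r)"
      using C(2)[OF r, of k] Pk unfolding pw by auto
    moreover have "36 ^ k \<le> C' * A (rho * r) powr (1 / 4)"
    proof (cases k)
      case 0
      have "1 = c_lo powr (- 1 / 4) * c_lo powr (1 / 4)" using c_lo by (simp flip: powr_add)
      also have "\<dots> \<le> C' * A (rho * r) powr (1 / 4)"
        using A_lower[OF r1] c_lo unfolding C'_def by (intro mult_mono powr_mono2) auto
      finally show ?thesis using 0 by simp
    next
      case (Suc j)
      then have "\<not> ?P j" using not_less_Least[of j ?P] unfolding k_def by auto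
      then have "((2 ^ 24) ^ j) powr (1 / 4) \<le> ?Y powr (1 / 4)" by (intro powr_mono2) auto
      also have "\<dots> = C powr (1 / 4) * A (rho * r) powr (1 / 4)"
        using C(1) A_pos[OF r1] by (simp add: powr_mult)
      finally have le: "((2 ^ 24) ^ j) powr (1 / 4) \<le> C powr (1 / 4) * A (rho * r) powr (1 / 4)" .
      have "(((2 :: real) ^ 24) ^ j) powr (1 / 4) = (64 ^ j)"
      proof -
        have "((2 :: real) ^ 24) ^ j = (64 ^ j) ^ 4" by (simp flip: power_mult add: mult.commute[of j 4] power_mult)
        also have "\<dots> = (64 ^ j) powr (real 4)" by (rule powr_realpow[symmetric]) simp
        finally have "(((2 :: real) ^ 24) ^ j) powr (1 / 4) = ((64 ^ j) powr (real 4)) powr (1 / 4)"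
          by (simp only:)
        also have "\<dots> = 64 ^ j" by (subst powr_powr) simp
        finally show ?thesis .
      qed
      moreover have "(36 :: real) ^ j \<le> 64 ^ j" by (intro power_mono) auto
      ultimately have "36 ^ k \<le> 36 * (C powr (1 / 4) * A (rho * r) powr (1 / 4))"
        using le Suc by simp
      also have "\<dots> = (36 * C powr (1 / 4)) * A (rho * r) powr (1 / 4)" by simp
      also have "\<dots> \<le> C' * A (rho * r) powr (1 / 4)" unfolding C'_def by (intro mult_right_mono) auto
      finally show ?thesis .
    qed
    ultimately show ?thesis by (intro exI[of _ k]) auto
  qed
  then show ?thesis using C' by blast
qed

text \<open>The boxes around 0 and around \<open>z\<close> each carry half of the susceptibility of
  their centre, hence \<open>144 = 36 * 4\<close>; the layer between \<open>r\<close> and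
  \<open>rho * r\<close> joins the two clusters.\<close>

lemma two_point_lower_at_scale:
  assumes r: "rJ \<le> r" and rare: "maxdist (wc r) (Bx r) (6 ^ k * Ms r) < 1 / 9" and z: "nv z \<le> r"
  shows "(1 - exp (- kap)) / 144 * (chi r)\<^sup>2 / (36 ^ k * r powr (d + \<alpha>)) \<le> T (rho * r) 0 z"
proof -
  have r1: "1 \<le> r" using r rJ by simp
  define m where "m = 6 ^ k * Ms r"
  define \<kappa> where "\<kappa> = kap * r powr (- d - \<alpha>)"
  have m1: "1 \<le> m" unfolding m_def
    using Ms[OF r1] one_le_power[of "6::real" k] mult_mono[of 1 "6 ^ k" 1 "Ms r"] by simp
  have m2: "m\<^sup>2 = 36 ^ k * r powr (d + \<alpha>)"
    unfolding m_def power_mult_distrib Ms_sq[OF r1] by (simp add: power2_eq_square flip: power_mult_distrib)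
  have km: "\<kappa> * m\<^sup>2 = kap * 36 ^ k"
    using kap_Ms[OF r1, of "6 ^ k"] unfolding \<kappa>_def m_def by (simp add: power2_eq_square flip: power_mult_distrib)
  have "kap * 1 \<le> kap * 36 ^ k" using kap by (intro mult_left_mono) auto
  then have c: "1 - exp (- kap) \<le> 1 - exp (- \<kappa> * m\<^sup>2)" using km by simp
  have "(1 - exp (- \<kappa> * m\<^sup>2)) / m\<^sup>2 / 36 * ((\<Sum>a\<in>Bx r. Tau (wc r) 0 a) * (\<Sum>y\<in>(+) z ` Bx r. Tau (wc r) z y))
     \<le> Tau (\<lambda>e. wc r e + wd r (rho * r) e) 0 z"
  proof (rule Tau_ge_square_of_means)
    show "0 \<le> wd r (rho * r) e" for e using r1 rho_mult(2)[OF r1] by (intro wd_nonneg) auto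
    show "maxdist (wc r) (Bx r) m \<le> 1 / 9" "maxdist (wc r) ((+) z ` Bx r) m \<le> 1 / 9"
      using rare unfolding maxdist_translate m_def by auto
    show "\<kappa> \<le> wd r (rho * r) {x, y}" if xB: "x \<in> Bx r" and yB: "y \<in> (+) z ` Bx r" and ne: "x \<noteq> y" for x y
    proof -
      obtain y' where y: "y = z + y'" "y' \<in> Bx r" using yB by auto
      have "nv (x - y) \<le> nv x + nv y' + nv z"
        using nv_triangle_diff[of "x - y'" z] nv_triangle_diff[of x y'] unfolding y
        by (simp add: algebra_simps)
      also have "\<dots> \<le> L0 * r + L0 * r + r" using xB y(2) z unfolding Bx_def lball_def mem_Collect_eq by linarith
      also have "\<dots> \<le> rho * r / 2" unfolding rho_def using r1 g0 by (simp add: algebra_simps)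
      finally show ?thesis unfolding \<kappa>_def using ne by (intro wd_at_scale r) auto
    qed
    show "0 \<le> \<kappa>" unfolding \<kappa>_def using kap by simp
  qed (use m1 in \<open>auto simp: wc_nonneg\<close>)
  then have 1: "(1 - exp (- \<kappa> * m\<^sup>2)) / m\<^sup>2 / 36 * ((\<Sum>a\<in>Bx r. T r 0 a) * (\<Sum>y\<in>(+) z ` Bx r. T r z y)) \<le> T (rho * r) 0 z"
    unfolding T_def wc_eq_add[of "rho * r" r, symmetric] .
  have "(\<Sum>y\<in>(+) z ` Bx r. T r z y) = (\<Sum>a\<in>Bx r. T r 0 a)"
    by (subst sum.reindex) (auto simp: T_origin[of r z])
  then have "(chi r / 2) * (chi r / 2) \<le> (\<Sum>a\<in>Bx r. T r 0 a) * (\<Sum>y\<in>(+) z ` Bx r. T r z y)"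
    using L0(2)[OF r1] chi_ge_1[OF r1] unfolding Bx_def by (intro mult_mono) (auto intro: sum_nonneg simp: T_nonneg)
  note prod = this
  have "(1 - exp (- kap)) / m\<^sup>2 / 36 * ((chi r / 2) * (chi r / 2)) \<le>
      (1 - exp (- \<kappa> * m\<^sup>2)) / m\<^sup>2 / 36 * ((\<Sum>a\<in>Bx r. T r 0 a) * (\<Sum>y\<in>(+) z ` Bx r. T r z y))"
  proof (rule mult_mono[OF _ prod])
    show "(1 - exp (- kap)) / m\<^sup>2 / 36 \<le> (1 - exp (- \<kappa> * m\<^sup>2)) / m\<^sup>2 / 36"
      using c by (intro divide_right_mono) auto
    have "exp (- \<kappa> * m\<^sup>2) \<le> 1" using c kap by (simp add: less_imp_le order_trans[of _ "exp (- kap)"])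
    then show "0 \<le> (1 - exp (- \<kappa> * m\<^sup>2)) / m\<^sup>2 / 36" by simp
  qed (use chi_ge_1[OF r1] in simp)
  also note 1
  finally have "(1 - exp (- kap)) / 144 * (chi r)\<^sup>2 / m\<^sup>2 \<le> T (rho * r) 0 z"
    by (simp add: power2_eq_square)
  then show ?thesis unfolding m2 .
qed

text \<open>The lower bound is summed over the ball of radius \<open>r\<close> and compared with
  \<open>chi (rho * r)\<close>. One power of \<open>A (rho * r)\<close> comes from that
  susceptibility and a further 1/4 from \<open>rare_size\<close>.\<close>

lemma A_growth: "\<exists>c>0. \<forall>r\<ge>rJ. c * (A r)\<^sup>2 \<le> A (rho * r) powr (5 / 4)"
proof -
  obtain C where C: "0 < C" "\<And>r. rJ \<le> r \<Longrightarrow> \<exists>k :: nat. maxdist (wc r) (Bx r) (6 ^ k * Ms r) < 1 / 9 \<and>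
      36 ^ k \<le> C * A (rho * r) powr (1 / 4)"
    using rare_size by blast
  obtain K where K: "0 < K" "\<And>R. 0 \<le> R \<Longrightarrow> K * R powr d \<le> card (lball R)" using lball_lower by blast
  define c0 where "c0 = (1 - exp (- kap)) / 144"
  have c0: "0 < c0" unfolding c0_def using kap by simp
  define c where "c = K * c0 / C * rho powr (- \<alpha>)"
  have c: "0 < c" unfolding c_def using K c0 C rho by simp
  have "c * (A r)\<^sup>2 \<le> A (rho * r) powr (5 / 4)" if r: "rJ \<le> r" for r
  proof -
    have r1: "1 \<le> r" "1 \<le> rho * r" using r rJ rho_mult(1)[of r] by auto
    obtain k where k: "maxdist (wc r) (Bx r) (6 ^ k * Ms r) < 1 / 9" "36 ^ k \<le> C * A (rho * r) powr (1 / 4)"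
      using C(2)[OF r] by blast
    let ?a = "A (rho * r)"
    have a: "0 < ?a" by (rule A_pos[OF r1(2)])
    define q where "q = c0 * (chi r)\<^sup>2 / (C * ?a powr (1 / 4) * r powr (d + \<alpha>))"
    have q: "q \<le> T (rho * r) 0 z" if "z \<in> lball r" for z
    proof -
      have "q \<le> c0 * (chi r)\<^sup>2 / (36 ^ k * r powr (d + \<alpha>))"
        unfolding q_def
      proof (rule divide_left_mono)
        show "36 ^ k * r powr (d + \<alpha>) \<le> C * ?a powr (1 / 4) * r powr (d + \<alpha>)"
          by (intro mult_right_mono k(2)) simp
        have "0 < 36 ^ k * r powr (d + \<alpha>)" "0 < C * ?a powr (1 / 4) * r powr (d + \<alpha>)" using r1 C(1) a by simp_all
        then show "0 < C * ?a powr (1 / 4) * r powr (d + \<alpha>) * (36 ^ k * r powr (d + \<alpha>))" by (rule mult_pos_pos[rotated])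
      qed (use c0 in simp)
      also have "\<dots> \<le> T (rho * r) 0 z"
        unfolding c0_def using that by (intro two_point_lower_at_scale r k) (auto simp: lball_def)
      finally show ?thesis .
    qed
    have q0: "0 \<le> q" unfolding q_def using c0 C a by simp
    have "K * r powr d * q \<le> card (lball r) * q" using q0 K(2)[of r] r1 by (intro mult_right_mono) auto
    also have "\<dots> = (\<Sum>z\<in>lball r. q)" by simp
    also have "\<dots> \<le> (\<Sum>z\<in>lball r. T (rho * r) 0 z)" by (intro sum_mono q)
    also have "\<dots> \<le> chi (rho * r)" using r1 by (intro chi_upper) auto
    also have "\<dots> = ?a * rho powr \<alpha> * r powr \<alpha>" using r1 rho by (simp add: chi_A powr_mult)
    finally have le: "K * r powr d * q \<le> ?a * rho powr \<alpha> * r powr \<alpha>" .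
    have "q * r powr d = c0 * (A r)\<^sup>2 / (C * ?a powr (1 / 4)) * r powr \<alpha>"
    proof -
      have "(chi r)\<^sup>2 = (A r)\<^sup>2 * (r powr \<alpha> * r powr \<alpha>)"
        by (simp add: chi_A[OF r1(1)] power_mult_distrib power2_eq_square)
      then show ?thesis unfolding q_def using r1 by (simp add: powr_add field_simps)
    qed
    then have "(K * (c0 * (A r)\<^sup>2 / (C * ?a powr (1 / 4)))) * r powr \<alpha> \<le> (?a * rho powr \<alpha>) * r powr \<alpha>"
      using le by (simp add: mult_ac)
    then have "K * (c0 * (A r)\<^sup>2 / (C * ?a powr (1 / 4))) \<le> ?a * rho powr \<alpha>"
      using r1 by (subst (asm) mult_le_cancel_right_pos) auto
    then have "K * c0 * (A r)\<^sup>2 \<le> ?a * rho powr \<alpha> * (C * ?a powr (1 / 4))"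
      using C a by (simp add: field_simps)
    also have "\<dots> = C * rho powr \<alpha> * (?a powr 1 * ?a powr (1 / 4))" using a by simp
    also have "?a powr 1 * ?a powr (1 / 4) = ?a powr (5 / 4)" by (simp only: powr_add[symmetric]) simp
    finally have "K * c0 * (A r)\<^sup>2 \<le> (C * rho powr \<alpha>) * ?a powr (5 / 4)" by simp
    moreover have "c * (A r)\<^sup>2 = (K * c0 * (A r)\<^sup>2) / (C * rho powr \<alpha>)"
      unfolding c_def using rho by (simp add: powr_minus field_simps)
    moreover have "0 < C * rho powr \<alpha>" using C rho by simp
    ultimately show ?thesis by (simp add: pos_divide_le_eq mult.commute)
  qed
  then show ?thesis using c by blast
qed

end

text \<open>As \<open>2 > 5 / 4\<close>, a large value of \<open>f 0\<close> would force doubly exponential growth.\<close>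

lemma no_double_exponential_growth:
  fixes f :: "nat \<Rightarrow> real"
  assumes f: "\<And>n. 0 < f n" and c: "0 < c" and step: "\<And>n. c * (f n)\<^sup>2 \<le> f (Suc n) powr (5 / 4)"
    and upper: "\<And>n. f n \<le> K * B ^ n" and B: "1 \<le> B" and K: "0 < K"
  shows "f 0 \<le> 2 * c powr (- 4 / 3)"
proof (rule ccontr)
  assume "\<not> ?thesis"
  then have f0: "2 * c powr (- 4 / 3) < f 0" by simp
  \<comment> \<open>The shift by \<open>(4 / 3) * ln c\<close> removes the constant and leaves
    \<open>y (Suc n) \<ge> (8 / 5) * y n\<close>, where \<open>8 / 5 = 2 / (5 / 4)\<close>.\<close>
  define y where "y = (\<lambda>n. ln (f n) + (4 / 3) * ln c)"
  have "ln 2 < y 0"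
  proof -
    have "ln (2 * c powr (- 4 / 3)) < ln (f 0)" using f0 f c by (subst ln_less_cancel_iff) auto
    then show ?thesis using c by (simp add: y_def ln_mult ln_powr)
  qed
  have ystep: "(8 / 5) * y n \<le> y (Suc n)" for n
  proof -
    have "ln (c * (f n)\<^sup>2) \<le> ln (f (Suc n) powr (5 / 4))"
      using step[of n] f[of n] f[of "Suc n"] c by (subst ln_le_cancel_iff) auto
    then have "ln c + 2 * ln (f n) \<le> (5 / 4) * ln (f (Suc n))"
      using c f[of n] f[of "Suc n"] by (simp add: ln_mult ln_powr ln_realpow)
    then show ?thesis unfolding y_def by simp
  qed
  have y: "(8 / 5) ^ n * ln 2 \<le> y n" for n
  proof (induction n)
    case (Suc n)
    have "(8 / 5) ^ Suc n * ln 2 = (8 / 5) * ((8 / 5) ^ n * ln (2 :: real))" by simp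
    also have "\<dots> \<le> (8 / 5) * y n" using Suc by (intro mult_left_mono) auto
    finally show ?case using ystep[of n] by (rule order_trans)
  qed (use \<open>ln 2 < y 0\<close> in simp)
  define a where "a = ln K + (4 / 3) * ln c"
  have up: "y n \<le> a + n * ln B" for n
  proof -
    have "ln (f n) \<le> ln (K * B ^ n)" using upper[of n] f[of n] K B by (subst ln_le_cancel_iff) auto
    also have "\<dots> = ln K + n * ln B" using K B by (simp add: ln_mult ln_realpow)
    finally show ?thesis unfolding y_def a_def by simp
  qed
  \<comment> \<open>The upper bound on \<open>y n\<close> is affine in \<open>n\<close>, so it
    vanishes after division by \<open>(8 / 5)^n\<close>.\<close>
  have "(\<lambda>n. a * (5 / 8) ^ n + ln B * (real n * (5 / 8) ^ n)) \<longlonglongrightarrow> a * 0 + ln B * 0"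
    by (intro tendsto_intros LIMSEQ_realpow_zero powser_times_n_limit_0) auto
  moreover have "ln 2 \<le> a * (5 / 8) ^ n + ln B * (real n * (5 / 8) ^ n)" for n
  proof -
    have "(8 / 5) ^ n * ln 2 \<le> a + n * ln B" using y[of n] up[of n] by simp
    then have "(5 / 8) ^ n * ((8 / 5) ^ n * ln 2) \<le> (5 / 8) ^ n * (a + n * ln B)" by (intro mult_left_mono) auto
    then show ?thesis by (simp add: algebra_simps flip: power_mult_distrib)
  qed
  ultimately have "ln 2 \<le> a * 0 + ln B * (0 :: real)" by (intro LIMSEQ_le_const) auto
  then show False by simp
qed

context lr_cl
begin

text \<open>\<open>no_double_exponential_growth\<close> is applied along \<open>rho^n * r\<close>,
  where \<open>chi_polynomial\<close> gives the exponential bound. Scales below \<open>rJ\<close>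
  follow by monotonicity.\<close>

lemma chi_upper_bound: "\<exists>C>0. \<forall>r\<ge>1. chi r \<le> C * r powr \<alpha>"
proof -
  obtain c where c: "0 < c" "\<And>r. rJ \<le> r \<Longrightarrow> c * (A r)\<^sup>2 \<le> A (rho * r) powr (5 / 4)"
    using A_growth by blast
  obtain K where K: "0 < K" "\<And>r. 1 \<le> r \<Longrightarrow> chi r \<le> K * r powr d" using chi_polynomial by blast
  define C where "C = 2 * c powr (- 4 / 3)"
  have C: "0 < C" unfolding C_def using c by simp
  have AC: "A r \<le> C" if r: "rJ \<le> r" for r
  proof -
    define s where "s = (\<lambda>n. rho ^ n * r)"
    have r1: "1 \<le> r" using r rJ by simp
    have pw: "1 \<le> rho ^ n" for n using rho by (intro one_le_power) auto
    have s: "rJ \<le> s n" "1 \<le> s n" for n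
    proof -
      have "1 * r \<le> rho ^ n * r" using r1 by (intro mult_right_mono pw) auto
      then show "rJ \<le> s n" "1 \<le> s n" using r r1 unfolding s_def by linarith+
    qed
    have "A (s 0) \<le> 2 * c powr (- 4 / 3)"
    proof (rule no_double_exponential_growth[OF A_pos[OF s(2)] c(1)])
      show "c * (A (s n))\<^sup>2 \<le> A (s (Suc n)) powr (5 / 4)" for n
        using c(2)[OF s(1)[of n]] by (simp add: s_def mult.assoc)
      show "A (s n) \<le> K * r powr d * (rho powr d) ^ n" for n
      proof -
        have "A (s n) \<le> chi (s n) * 1"
          unfolding A_def using s(2)[of n] chi_ge_1[OF s(2)[of n]] alpha
          by (intro mult_left_mono) (auto simp: powr_minus intro!: inverse_le_1_iff[THEN iffD2] ge_one_powr_ge_zero)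
        also have "\<dots> \<le> K * s n powr d" using K(2)[OF s(2)] by simp
        also have "\<dots> = K * r powr d * (rho powr d) ^ n"
          unfolding s_def using r1 rho by (simp add: powr_mult powr_realpow powr_power powr_powr mult_ac flip: powr_realpow)
        finally show ?thesis .
      qed
      show "1 \<le> rho powr d" using rho d_ge_1 by (intro ge_one_powr_ge_zero) auto
      show "0 < K * r powr d" using K r1 by simp
    qed
    then show ?thesis by (simp add: s_def C_def)
  qed
  have "chi r \<le> (C * rJ powr \<alpha>) * r powr \<alpha>" if r: "1 \<le> r" for r
  proof (cases "rJ \<le> r")
    case True
    have "chi r \<le> C * r powr \<alpha>" using AC[OF True] chi_A[OF r] by (simp add: mult_right_mono)
    also have "\<dots> \<le> C * r powr \<alpha> * rJ powr \<alpha>"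
      using C rJ alpha mult_left_mono[of 1 "rJ powr \<alpha>" "C * r powr \<alpha>"] by (simp add: ge_one_powr_ge_zero)
    finally show ?thesis by (simp add: mult_ac)
  next
    case False
    then have "chi r \<le> chi rJ" using r by (intro chi_mono) auto
    also have "\<dots> \<le> C * rJ powr \<alpha>" using AC[of rJ] chi_A[OF rJ] by (simp add: mult_right_mono)
    also have "\<dots> \<le> C * rJ powr \<alpha> * r powr \<alpha>"
      using C r alpha mult_left_mono[of 1 "r powr \<alpha>" "C * rJ powr \<alpha>"] by (simp add: ge_one_powr_ge_zero)
    finally show ?thesis .
  qed
  moreover have "0 < C * rJ powr \<alpha>" using C rJ by simp
  ultimately show ?thesis by blast
qed

end

section \<open>Two-point estimates\<close>

lemma powr_between:
  fixes x l u s :: real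
  assumes "0 < l" "l \<le> x" "x \<le> u"
  shows "x powr s \<le> l powr s + u powr s"
proof (cases "0 \<le> s")
  case True
  then have "x powr s \<le> u powr s" using assms by (intro powr_mono2) auto
  then show ?thesis by (simp add: add_increasing)
next
  case False
  then have "x powr s \<le> l powr s" using assms by (intro powr_mono2') auto
  then show ?thesis by (simp add: add_increasing2)
qed

context lr_cl
begin

text \<open>Now that \<open>A\<close> is bounded, so is \<open>36^k\<close>. The estimate at scale
  \<open>r = nv x\<close> becomes a constant times
  \<open>r^(2 * \<alpha>) / r^(d + \<alpha>)\<close>.\<close>

lemma Tf_lower_bound: "\<exists>a>0. \<forall>x. x \<noteq> 0 \<longrightarrow> a * nv x powr (- d + \<alpha>) \<le> Tf 0 x"
proof -
  obtain C where C: "0 < C" "\<And>r. rJ \<le> r \<Longrightarrow> \<exists>k :: nat. maxdist (wc r) (Bx r) (6 ^ k * Ms r) < 1 / 9 \<and>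
      36 ^ k \<le> C * A (rho * r) powr (1 / 4)"
    using rare_size by blast
  obtain C1 where C1: "0 < C1" "\<And>r. 1 \<le> r \<Longrightarrow> chi r \<le> C1 * r powr \<alpha>" using chi_upper_bound by blast
  obtain \<eta> where \<eta>: "0 < \<eta>" "\<And>x. x \<noteq> 0 \<Longrightarrow> \<eta> \<le> nv x" using nv_bounded_below by blast
  define c0 where "c0 = (1 - exp (- kap)) / 144"
  have c0: "0 < c0" unfolding c0_def using kap by simp
  define C2 where "C2 = C * C1 powr (1 / 4)"
  have C2: "0 < C2" unfolding C2_def using C C1 by simp
  have AC: "A r \<le> C1" if "1 \<le> r" for r
  proof -
    have "A r \<le> C1 * r powr \<alpha> * r powr (- \<alpha>)" unfolding A_def using C1(2)[OF that] by (intro mult_right_mono) auto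
    also have "\<dots> = C1" using that by (simp add: mult.assoc flip: powr_add)
    finally show ?thesis .
  qed
  define a1 where "a1 = c0 * c_lo\<^sup>2 / C2"
  have a1: "0 < a1" unfolding a1_def using c0 c_lo C2 by simp
  have large: "a1 * nv x powr (- d + \<alpha>) \<le> Tf 0 x" if x: "rJ \<le> nv x" for x
  proof -
    define r where "r = nv x"
    have r: "rJ \<le> r" "1 \<le> r" "1 \<le> rho * r" using x rJ rho_mult(1)[of r] unfolding r_def by auto
    obtain k where k: "maxdist (wc r) (Bx r) (6 ^ k * Ms r) < 1 / 9" "36 ^ k \<le> C * A (rho * r) powr (1 / 4)"
      using C(2)[OF r(1)] by blast
    have "A (rho * r) powr (1 / 4) \<le> C1 powr (1 / 4)"
      using AC[OF r(3)] A_pos[OF r(3)] by (intro powr_mono2) auto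
    then have "C * A (rho * r) powr (1 / 4) \<le> C2" unfolding C2_def using C(1) by (intro mult_left_mono) auto
    then have k2: "36 ^ k \<le> C2" using k(2) by linarith
    have "a1 * r powr (- d + \<alpha>) = c0 * (c_lo * r powr \<alpha>)\<^sup>2 / (C2 * r powr (d + \<alpha>))"
    proof -
      have "r powr (- d + \<alpha>) * r powr (d + \<alpha>) = r powr \<alpha> * r powr \<alpha>" using r by (simp flip: powr_add)
      then show ?thesis unfolding a1_def using r C2 by (simp add: power2_eq_square field_simps)
    qed
    also have "\<dots> \<le> c0 * (chi r)\<^sup>2 / (36 ^ k * r powr (d + \<alpha>))"
    proof (rule frac_le)
      show "c0 * (c_lo * r powr \<alpha>)\<^sup>2 \<le> c0 * (chi r)\<^sup>2"
        using c0 c_lo chi_lower[OF r(2)] by (intro mult_left_mono power_mono) auto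
      show "36 ^ k * r powr (d + \<alpha>) \<le> C2 * r powr (d + \<alpha>)" using k2 by (intro mult_right_mono) auto
    qed (use c0 r in auto)
    also have "\<dots> \<le> T (rho * r) 0 x"
      unfolding c0_def using r by (intro two_point_lower_at_scale k) (auto simp: r_def)
    also have "\<dots> \<le> Tf 0 x" using r by (intro T_le_Tf) auto
    finally show ?thesis unfolding r_def .
  qed
  \<comment> \<open>Below \<open>rJ\<close> the direct edge from 0 to \<open>x\<close>
    suffices.\<close>
  define e where "e = 1 - exp (- b * J rJ)"
  have e: "0 < e" unfolding e_def using b_pos J_pos[of rJ] rJ by simp
  define B where "B = \<eta> powr (- d + \<alpha>) + rJ powr (- d + \<alpha>)"
  have B: "0 < B" unfolding B_def using \<eta> by (simp add: add_pos_nonneg)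
  have small: "e / B * nv x powr (- d + \<alpha>) \<le> Tf 0 x" if x: "x \<noteq> 0" "nv x < rJ" for x
  proof -
    have "nv x powr (- d + \<alpha>) \<le> B" unfolding B_def using x \<eta> by (intro powr_between) auto
    then have "e / B * nv x powr (- d + \<alpha>) \<le> e / B * B" using e B by (intro mult_left_mono) auto
    also have "\<dots> = e" using B by simp
    also have "\<dots> \<le> 1 - exp (- wf {0, x})"
    proof -
      have "J rJ \<le> J (nv (0 - x))" using x nv_pos[of x] by (intro J_antimono) auto
      then have "b * J rJ \<le> wf {0, x}" using x b_pos by (simp add: wf_pair Kf_def)
      then show ?thesis unfolding e_def by simp
    qed
    also have "\<dots> \<le> Tf 0 x" unfolding Tf_def using x by (intro Tau_ge_edge wf_nonneg) auto
    finally show ?thesis .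
  qed
  have "min a1 (e / B) * nv x powr (- d + \<alpha>) \<le> Tf 0 x" if "x \<noteq> 0" for x
  proof (cases "rJ \<le> nv x")
    case True
    have "min a1 (e / B) * nv x powr (- d + \<alpha>) \<le> a1 * nv x powr (- d + \<alpha>)" by (intro mult_right_mono) auto
    then show ?thesis using large[OF True] by linarith
  next
    case False
    have "min a1 (e / B) * nv x powr (- d + \<alpha>) \<le> e / B * nv x powr (- d + \<alpha>)" by (intro mult_right_mono) auto
    then show ?thesis using small[OF that] False by linarith
  qed
  moreover have "0 < min a1 (e / B)" using a1 e B by simp
  ultimately show ?thesis by blast
qed

section \<open>Upper bounds on the two-point function by doubling the cut-off\<close>

lemma pair_sum_le_product:
  fixes f g :: "int ^ 'd \<Rightarrow> real"
  assumes "finite D" "\<And>a. 0 \<le> f a" "\<And>a. 0 \<le> g a" "\<And>F. finite F \<Longrightarrow> sum f F \<le> X" "\<And>F. finite F \<Longrightarrow> sum g F \<le> Y"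
  shows "(\<Sum>(a, b)\<in>D. f a * g b) \<le> X * Y"
proof -
  have "(\<Sum>(a, b)\<in>D. f a * g b) \<le> (\<Sum>(a, b)\<in>fst ` D \<times> snd ` D. f a * g b)"
    using assms by (intro sum_mono2) force+
  also have "\<dots> = (\<Sum>a\<in>fst ` D. f a) * (\<Sum>b\<in>snd ` D. g b)"
    by (simp add: sum_product sum.cartesian_product)
  also have "\<dots> \<le> X * Y"
    using assms sum_nonneg[of "fst ` D" f] by (intro mult_mono) (auto intro!: sum_nonneg order_trans[of 0 "sum f (fst ` D)" X])
  finally show ?thesis .
qed

text \<open>The convolution carries one added edge, of weight of order
  \<open>r^(- d - \<alpha>)\<close>, and two susceptibilities of order \<open>r^\<alpha>\<close>. If
  \<open>x\<close> is far compared with \<open>r\<close>, the edge is short, so one of the two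
  connections covers a third of the distance and \<open>far_mass\<close> gives the extra
  decay.\<close>

lemma doubling_step:
  assumes p: "0 < p"
  shows "\<exists>C>0. \<forall>r\<ge>1. \<forall>x. x \<noteq> 0 \<longrightarrow>
    T (2 * r) 0 x \<le> T r 0 x + C * r powr (\<alpha> - d) \<and>
    T (2 * r) 0 x \<le> T r 0 x + C * r powr (\<alpha> - d + p) * nv x powr (- p)"
proof -
  obtain C where C: "0 < C" "\<forall>r\<ge>1. \<forall>t>0. \<forall>F u. finite F \<longrightarrow> (\<forall>x\<in>F. t * r \<le> nv (x - u)) \<longrightarrow>
    (\<Sum>x\<in>F. T r u x) \<le> C * t powr (- p) * chi r"
    using far_mass[OF p] by (elim exE conjE) (rule that)
  obtain C1 where C1: "0 < C1" "\<And>r. 1 \<le> r \<Longrightarrow> chi r \<le> C1 * r powr \<alpha>" using chi_upper_bound by blast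
  define C3 where "C3 = b * CJ * (C1 * (C1 * 2 powr \<alpha>))"
  have C3: "0 < C3" unfolding C3_def using b_pos CJ C1 by simp
  define C4 where "C4 = C3 * (2 * C + 1) * 6 powr p"
  have C4: "0 < C4" "C3 \<le> C4" "C3 * (2 * C) * 6 powr p \<le> C4" "C3 * 6 powr p \<le> C4"
  proof -
    have "1 \<le> (6 :: real) powr p" using p by (intro ge_one_powr_ge_zero) auto
    then have "1 * 1 \<le> (2 * C + 1) * 6 powr p" using C(1) by (intro mult_mono) auto
    then show "C3 \<le> C4" unfolding C4_def using C3 mult_left_mono[of 1 "(2 * C + 1) * 6 powr p" C3] by (simp add: mult.assoc)
    then show "0 < C4" using C3 by simp
    show "C3 * (2 * C) * 6 powr p \<le> C4" "C3 * 6 powr p \<le> C4" unfolding C4_def using C3 C(1) by (auto simp: algebra_simps)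
  qed
  \<comment> \<open>Edges longer than \<open>2 * r\<close> carry no weight in the added layer, so
    only shorter pairs have to be considered.\<close>
  have two: "T (2 * r) 0 x \<le> T r 0 x + B"
    if r: "1 \<le> r" and bound: "\<And>D. finite D \<Longrightarrow> D \<subseteq> {(a, b). nv (a - b) \<le> 2 * r} \<Longrightarrow>
      b * J r * (\<Sum>(u, v)\<in>D. T r 0 u * T (2 * r) x v) \<le> B" for r x B
  proof -
    have "Tau (\<lambda>e. wc r e + wd r (2 * r) e) 0 x \<le> Tau (wc r) 0 x + B"
    proof (rule Tau_two_step)
      show "0 \<le> wd r (2 * r) e" for e using r by (intro wd_nonneg) auto
      fix D :: "((int ^ 'd) \<times> (int ^ 'd)) set" assume D: "finite D" "D \<subseteq> {(a, b). a \<noteq> b}"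
      let ?D = "{(u, v) \<in> D. nv (u - v) \<le> 2 * r}"
      have "(\<Sum>(u, v)\<in>D. wd r (2 * r) {u, v} * T r 0 u * T (2 * r) v x) =
          (\<Sum>(u, v)\<in>?D. wd r (2 * r) {u, v} * T r 0 u * T (2 * r) v x)"
      proof (rule sum.mono_neutral_right)
        have "wd r (2 * r) {u, v} = 0" if "(u, v) \<in> D" "\<not> nv (u - v) \<le> 2 * r" for u v
          using r that D(2) by (intro wd_bounds(3)) auto
        then show "\<forall>i\<in>D - ?D. (case i of (u, v) \<Rightarrow> wd r (2 * r) {u, v} * T r 0 u * T (2 * r) v x) = 0"
          by (simp add: split_paired_all)
      qed (use D in auto)
      also have "\<dots> \<le> (\<Sum>(u, v)\<in>?D. b * J r * (T r 0 u * T (2 * r) x v))"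
      proof (intro sum_mono, clarify)
        fix u v assume "(u, v) \<in> D"
        then have "u \<noteq> v" using D by auto
        then have "wd r (2 * r) {u, v} \<le> b * J r" using r by (intro wd_bounds(2)) auto
        then have "wd r (2 * r) {u, v} * (T r 0 u * T (2 * r) x v) \<le> b * J r * (T r 0 u * T (2 * r) x v)"
          by (intro mult_right_mono mult_nonneg_nonneg T_nonneg)
        then show "wd r (2 * r) {u, v} * T r 0 u * T (2 * r) v x \<le> b * J r * (T r 0 u * T (2 * r) x v)"
          by (simp only: T_sym[of "2 * r" v x] mult.assoc)
      qed
      also have "\<dots> = b * J r * (\<Sum>(u, v)\<in>?D. T r 0 u * T (2 * r) x v)"
        by (simp add: sum_distrib_left case_prod_unfold)
      also have "\<dots> \<le> B" by (intro bound finite_subset[OF _ D(1)]) auto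
      finally show "(\<Sum>(u, v)\<in>D. wd r (2 * r) {u, v} * Tau (wc r) 0 u * Tau (\<lambda>e. wc r e + wd r (2 * r) e) v x) \<le> B"
        unfolding T_def wc_eq_add[of "2 * r" r, symmetric] .
    qed (rule wc_nonneg)
    then show ?thesis unfolding T_def wc_eq_add[of "2 * r" r, symmetric] .
  qed
  have JX: "b * J r * (X * (C1 * r powr \<alpha> * (C1 * (2 * r) powr \<alpha>))) \<le> X * C3 * r powr (\<alpha> - d)"
    if r: "1 \<le> r" and X: "0 \<le> X" for r X
  proof -
    have "b * J r * (X * (C1 * r powr \<alpha> * (C1 * (2 * r) powr \<alpha>))) \<le>
        b * (CJ * r powr (- d - \<alpha>)) * (X * (C1 * r powr \<alpha> * (C1 * (2 * r) powr \<alpha>)))"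
      using b_pos C1 r X by (intro mult_right_mono mult_left_mono J_upper) auto
    also have "\<dots> = X * C3 * (r powr (- d - \<alpha>) * (r powr \<alpha> * r powr \<alpha>))"
      unfolding C3_def using r by (simp add: powr_mult)
    also have "r powr (- d - \<alpha>) * (r powr \<alpha> * r powr \<alpha>) = r powr (\<alpha> - d)" by (simp flip: powr_add)
    finally show ?thesis .
  qed
  have chi0: "0 \<le> chi r" if "1 \<le> r" for r using chi_ge_1[OF that] by simp
  have prod: "chi r * chi (2 * r) \<le> C1 * r powr \<alpha> * (C1 * (2 * r) powr \<alpha>)" if "1 \<le> r" for r
    using that C1 chi0[of "2 * r"] chi0[of r] by (intro mult_mono C1) auto
  have step1: "T (2 * r) 0 x \<le> T r 0 x + C3 * r powr (\<alpha> - d)" if r: "1 \<le> r" for r x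
  proof (rule two[OF r])
    fix D :: "((int ^ 'd) \<times> (int ^ 'd)) set" assume D: "finite D"
    have "(\<Sum>(u, v)\<in>D. T r 0 u * T (2 * r) x v) \<le> chi r * chi (2 * r)"
      using r by (intro pair_sum_le_product D T_nonneg chi_upper) auto
    also note prod[OF r]
    finally have "b * J r * (\<Sum>(u, v)\<in>D. T r 0 u * T (2 * r) x v) \<le>
        b * J r * (1 * (C1 * r powr \<alpha> * (C1 * (2 * r) powr \<alpha>)))"
      using b_pos J_pos[of r] r by (intro mult_left_mono) auto
    also have "\<dots> \<le> 1 * C3 * r powr (\<alpha> - d)" by (rule JX[OF r]) simp
    finally show "b * J r * (\<Sum>(u, v)\<in>D. T r 0 u * T (2 * r) x v) \<le> C3 * r powr (\<alpha> - d)" by simp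
  qed
  have step2: "T (2 * r) 0 x \<le> T r 0 x + C4 * r powr (\<alpha> - d + p) * nv x powr (- p)"
    if r: "1 \<le> r" and x: "x \<noteq> 0" for r x
  proof (cases "6 * r \<le> nv x")
    case True
    define t where "t = nv x / (6 * r)"
    have t: "0 < t" "t powr (- p) = 6 powr p * (r powr p * nv x powr (- p))"
      unfolding t_def using r nv_pos[OF x] by (simp_all add: powr_divide powr_mult powr_minus field_simps)
    have tr: "t * r = nv x / 6" "t * (2 * r) = nv x / 3" unfolding t_def using r by auto
    \<comment> \<open>With \<open>6 * r \<le> nv x\<close> the edge covers at most a third of the
      distance, so the connection from 0 or the one to \<open>x\<close> covers another third;
      \<open>f\<close> and \<open>g\<close> are the two-point functions restricted
      accordingly.\<close>
    define f where "f = (\<lambda>u. T r 0 u * of_bool (nv x / 3 \<le> nv u))"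
    define g where "g = (\<lambda>v. T (2 * r) x v * of_bool (nv x / 3 \<le> nv (v - x)))"
    have fX: "sum f F \<le> C * t powr (- p) * chi r" if F: "finite F" for F
    proof -
      have "sum f F = (\<Sum>u\<in>{u \<in> F. nv x / 3 \<le> nv u}. T r 0 u)"
        unfolding f_def using F by (simp add: of_bool_def sum.inter_filter if_distrib cong: if_cong)
      also have "\<dots> \<le> C * t powr (- p) * chi r"
        using r t(1) F nv_pos[OF x] by (intro C(2)[rule_format]) (auto simp: tr)
      finally show ?thesis .
    qed
    have gX: "sum g F \<le> C * t powr (- p) * chi (2 * r)" if F: "finite F" for F
    proof -
      have "sum g F = (\<Sum>v\<in>{v \<in> F. nv x / 3 \<le> nv (v - x)}. T (2 * r) x v)"
        unfolding g_def using F by (simp add: of_bool_def sum.inter_filter if_distrib cong: if_cong)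
      also have "\<dots> \<le> C * t powr (- p) * chi (2 * r)"
        using r t(1) F nv_pos[OF x] by (intro C(2)[rule_format]) (auto simp: tr)
      finally show ?thesis .
    qed
    have "T (2 * r) 0 x \<le> T r 0 x + (2 * C * t powr (- p)) * C3 * r powr (\<alpha> - d)"
    proof (rule two[OF r])
      fix D :: "((int ^ 'd) \<times> (int ^ 'd)) set" assume D: "finite D" "D \<subseteq> {(a, b). nv (a - b) \<le> 2 * r}"
      have "(\<Sum>(u, v)\<in>D. T r 0 u * T (2 * r) x v) \<le> (\<Sum>(u, v)\<in>D. f u * T (2 * r) x v + T r 0 u * g v)"
      proof (intro sum_mono, clarify)
        fix u v assume "(u, v) \<in> D"
        then have "nv (u - v) \<le> nv x / 3" using D True by auto
        moreover have "nv x \<le> nv u + nv (u - v) + nv (v - x)"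
          using nv_triangle_diff[of u "u - x"] nv_triangle[of "u - v" "v - x"] by simp
        ultimately have "nv x / 3 \<le> nv u \<or> nv x / 3 \<le> nv (v - x)" by linarith
        then show "T r 0 u * T (2 * r) x v \<le> f u * T (2 * r) x v + T r 0 u * g v"
          unfolding f_def g_def by (auto simp: T_nonneg)
      qed
      also have "\<dots> = (\<Sum>(u, v)\<in>D. f u * T (2 * r) x v) + (\<Sum>(u, v)\<in>D. T r 0 u * g v)"
        by (simp add: sum.distrib case_prod_unfold)
      also have "\<dots> \<le> (C * t powr (- p) * chi r) * chi (2 * r) + chi r * (C * t powr (- p) * chi (2 * r))"
        using r by (intro add_mono pair_sum_le_product D fX gX T_nonneg chi_upper) (auto simp: f_def g_def T_nonneg)
      also have "\<dots> = (2 * C * t powr (- p)) * (chi r * chi (2 * r))" by simp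
      also have "\<dots> \<le> (2 * C * t powr (- p)) * (C1 * r powr \<alpha> * (C1 * (2 * r) powr \<alpha>))"
        using C(1) by (intro mult_left_mono prod r) auto
      finally have "b * J r * (\<Sum>(u, v)\<in>D. T r 0 u * T (2 * r) x v) \<le>
          b * J r * ((2 * C * t powr (- p)) * (C1 * r powr \<alpha> * (C1 * (2 * r) powr \<alpha>)))"
        using b_pos J_pos[of r] r by (intro mult_left_mono) auto
      also have "\<dots> \<le> (2 * C * t powr (- p)) * C3 * r powr (\<alpha> - d)" using C(1) by (intro JX r) auto
      finally show "b * J r * (\<Sum>(u, v)\<in>D. T r 0 u * T (2 * r) x v) \<le> (2 * C * t powr (- p)) * C3 * r powr (\<alpha> - d)" .
    qed
    also have "(2 * C * t powr (- p)) * C3 * r powr (\<alpha> - d) =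
        (C3 * (2 * C) * 6 powr p) * (r powr (\<alpha> - d + p) * nv x powr (- p))"
      unfolding t(2) powr_add by simp
    also have "\<dots> \<le> C4 * (r powr (\<alpha> - d + p) * nv x powr (- p))" using C4 by (intro mult_right_mono) auto
    finally show ?thesis by (simp add: mult.assoc)
  next
    case False
    \<comment> \<open>Here \<open>nv x < 6 * r\<close>, so the decay factor is bounded below and the
      first estimate is enough.\<close>
    have "1 = (nv x powr p) * nv x powr (- p)" using nv_pos[OF x] by (simp flip: powr_add)
    also have "\<dots> \<le> (6 * r) powr p * nv x powr (- p)"
      using False p by (intro mult_right_mono powr_mono2) auto
    also have "\<dots> = 6 powr p * r powr p * nv x powr (- p)" using r by (simp add: powr_mult)
    finally have "C3 * r powr (\<alpha> - d) * 1 \<le> C3 * r powr (\<alpha> - d) * (6 powr p * r powr p * nv x powr (- p))"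
      using C3 by (intro mult_left_mono) auto
    also have "\<dots> = (C3 * 6 powr p) * (r powr (\<alpha> - d + p) * nv x powr (- p))" by (simp add: powr_add)
    also have "\<dots> \<le> C4 * (r powr (\<alpha> - d + p) * nv x powr (- p))" using C4 by (intro mult_right_mono) auto
    finally show ?thesis using step1[OF r, of x] by (simp add: mult.assoc)
  qed
  have "C3 * r powr (\<alpha> - d) \<le> C4 * r powr (\<alpha> - d)" for r using C4 by (intro mult_right_mono) auto
  then have "T (2 * r) 0 x \<le> T r 0 x + C4 * r powr (\<alpha> - d)" if "1 \<le> r" for r x
    using step1[OF that, of x] by (meson add_left_mono order_trans)
  then show ?thesis using step2 C4(1) by blast
qed

text \<open>With \<open>p = q + d - \<alpha>\<close> the increments in \<open>doubling_step\<close>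
  are of order \<open>r^q * nv x^(-p)\<close>, which is the claimed bound. As \<open>q > 0\<close>,
  they grow geometrically in the scale, so the last one dominates. The starting scale is covered by
  the p-th moment.\<close>

lemma T_upper_decay:
  assumes q: "0 < q" "\<alpha> - d < q"
  shows "\<exists>B>0. \<forall>r\<ge>1. \<forall>x. x \<noteq> 0 \<longrightarrow> T r 0 x \<le> B * nv x powr (- d + \<alpha>) * (nv x / r) powr (- q)"
proof -
  define p where "p = q + d - \<alpha>"
  have p: "0 < p" "\<alpha> - d + p = q" unfolding p_def using q by auto
  obtain C where C: "0 < C" "\<And>r x. 1 \<le> r \<Longrightarrow> x \<noteq> 0 \<Longrightarrow> T (2 * r) 0 x \<le> T r 0 x + C * r powr q * nv x powr (- p)"
    using doubling_step[OF p(1)] unfolding p(2) by blast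
  obtain Cm where Cm: "0 < Cm" "\<And>r F. 1 \<le> r \<Longrightarrow> finite F \<Longrightarrow>
      (\<Sum>x\<in>F. nv x powr p * T r 0 x) \<le> Cm * r powr p * chi r"
    using moments[OF p(1)] by blast
  define B1 where "B1 = Cm * 2 powr p * chi 2"
  have B1: "0 < B1" unfolding B1_def using Cm chi_ge_1[of 2] by simp
  define z where "z = 2 powr q - 1"
  have z: "0 < z" unfolding z_def using q gr_one_powr[of 2 q] by simp
  \<comment> \<open>Adding \<open>C / z\<close> with \<open>z = 2^q - 1\<close> gives
    \<open>B + C \<le> B * 2^q\<close>, which closes the induction.\<close>
  define B where "B = B1 + C / z"
  have B: "B1 \<le> B" "0 < B" "B + C \<le> B * 2 powr q"
  proof -
    have nn: "0 \<le> C / z" using C z by simp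
    then show "B1 \<le> B" "0 < B" unfolding B_def using B1 by linarith+
    have "C = C / z * z" using z by simp
    also have "\<dots> \<le> B * z" unfolding B_def using B1 z by (intro mult_right_mono) auto
    finally show "B + C \<le> B * 2 powr q" unfolding z_def by (simp add: algebra_simps)
  qed
  have main: "T r 0 x \<le> B * r powr q * nv x powr (- p)" if x: "x \<noteq> 0" and "1 \<le> r" "r \<le> 2 ^ Suc n" for r x n
    using that(2,3)
  proof (induction n arbitrary: r)
    case 0
    have "nv x powr p * T 2 0 x \<le> B1" using Cm(2)[of 2 "{x}"] unfolding B1_def by simp
    then have "T 2 0 x \<le> B1 * nv x powr (- p)" using nv_pos[OF x] by (simp add: powr_minus field_simps)
    have "T r 0 x \<le> T 2 0 x" using 0 by (intro T_mono) auto
    also have "\<dots> \<le> B1 * nv x powr (- p)" by fact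
    also have "\<dots> \<le> (B * r powr q) * nv x powr (- p)"
    proof (intro mult_right_mono)
      have "1 \<le> r powr q" using 0 q by (intro ge_one_powr_ge_zero) auto
      then have "B1 * 1 \<le> B * r powr q" using B B1 by (intro mult_mono) auto
      then show "B1 \<le> B * r powr q" by simp
    qed simp
    finally show ?case .
  next
    case (Suc n)
    show ?case
    proof (cases "r \<le> 2 ^ Suc n")
      case True
      then show ?thesis by (rule Suc.IH[OF Suc.prems(1)])
    next
      case False
      define s where "s = r / 2"
      have "2 \<le> (2 :: real) ^ Suc n" by simp
      then have "2 \<le> r" using False by linarith
      then have s: "1 \<le> s" "s \<le> 2 ^ Suc n" "r = 2 * s" using False Suc.prems unfolding s_def by auto
      have "T r 0 x \<le> T s 0 x + C * s powr q * nv x powr (- p)" unfolding s(3) by (rule C(2)[OF s(1) x])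
      also have "\<dots> \<le> B * s powr q * nv x powr (- p) + C * s powr q * nv x powr (- p)"
        by (intro add_right_mono Suc.IH s)
      also have "\<dots> = (B + C) * (s powr q * nv x powr (- p))" by (simp add: algebra_simps)
      also have "\<dots> \<le> (B * 2 powr q) * (s powr q * nv x powr (- p))" by (intro mult_right_mono B) auto
      also have "\<dots> = B * r powr q * nv x powr (- p)" unfolding s(3) using s(1) by (simp add: powr_mult)
      finally show ?thesis .
    qed
  qed
  have "T r 0 x \<le> B * nv x powr (- d + \<alpha>) * (nv x / r) powr (- q)" if r: "1 \<le> r" and x: "x \<noteq> 0" for r x
  proof -
    obtain n where "r < 2 ^ n" using real_arch_pow[of 2 r] by auto
    also have "(2 :: real) ^ n \<le> 2 ^ Suc n" by simp
    finally have "r \<le> 2 ^ Suc n" by simp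
    then have "T r 0 x \<le> B * r powr q * nv x powr (- p)" by (rule main[OF x r])
    also have "nv x powr (- p) = nv x powr (- d + \<alpha>) * nv x powr (- q)"
      unfolding p_def powr_add[symmetric] by (simp add: algebra_simps)
    finally show ?thesis using r nv_pos[OF x] by (simp add: powr_divide powr_minus field_simps)
  qed
  then show ?thesis using B(2) by blast
qed

text \<open>For \<open>\<alpha> \<ge> d\<close> the power of the norm is bounded below on nonzero
  lattice points. Otherwise the increments \<open>r^(\<alpha> - d)\<close> decrease geometrically,
  so their sum beyond the scale of \<open>x\<close> is comparable to its first term.\<close>

lemma T_upper_bound: "\<exists>B>0. \<forall>r\<ge>1. \<forall>x. x \<noteq> 0 \<longrightarrow> T r 0 x \<le> B * nv x powr (- d + \<alpha>)"
proof (cases "d \<le> \<alpha>")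
  case True
  obtain \<eta> where \<eta>: "0 < \<eta>" "\<And>x. x \<noteq> 0 \<Longrightarrow> \<eta> \<le> nv x" using nv_bounded_below by blast
  have "T r 0 x \<le> \<eta> powr (d - \<alpha>) * nv x powr (- d + \<alpha>)" if "x \<noteq> 0" for r x
  proof -
    have "T r 0 x \<le> 1" by (rule T_le_1)
    also have "1 = \<eta> powr (d - \<alpha>) * \<eta> powr (- d + \<alpha>)" using \<eta> by (simp flip: powr_add)
    also have "\<dots> \<le> \<eta> powr (d - \<alpha>) * nv x powr (- d + \<alpha>)"
      using True \<eta>(1) \<eta>(2)[OF that] by (intro mult_left_mono powr_mono2) auto
    finally show ?thesis .
  qed
  then show ?thesis using \<eta>(1) by (intro exI[of _ "\<eta> powr (d - \<alpha>)"]) auto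
next
  case False
  obtain B where B: "0 < B" "\<And>r x. 1 \<le> r \<Longrightarrow> x \<noteq> 0 \<Longrightarrow> T r 0 x \<le> B * nv x powr (- d + \<alpha>) * (nv x / r) powr (- 1)"
    using T_upper_decay[of 1] False by auto
  obtain C where C: "0 < C" "\<And>r x. 1 \<le> r \<Longrightarrow> x \<noteq> 0 \<Longrightarrow> T (2 * r) 0 x \<le> T r 0 x + C * r powr (\<alpha> - d)"
    using doubling_step[OF zero_less_one] by blast
  define q where "q = (2 :: real) powr (\<alpha> - d)"
  have q: "0 < q" "q < 1" unfolding q_def using False by (auto intro: powr_less_one)
  define B' where "B' = B + 1 + C * (1 / (1 - q))"
  have B': "0 < B'" unfolding B'_def using B C q by (simp add: add_pos_pos)
  have "T r 0 x \<le> B' * nv x powr (- d + \<alpha>)" if r: "1 \<le> r" and x: "x \<noteq> 0" for r x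
  proof -
    \<comment> \<open>The scale of \<open>x\<close>, kept at least 1: there the ratio in
      \<open>T_upper_decay\<close> is 1, and for \<open>nv x < 1\<close> the trivial bound 1 is
      used.\<close>
    define s where "s = max 1 (nv x)"
    have s: "1 \<le> s" "nv x \<le> s" unfolding s_def by auto
    have sn: "s powr (\<alpha> - d) \<le> nv x powr (- d + \<alpha>)"
      using False s nv_pos[OF x] powr_mono2'[of "\<alpha> - d" "nv x" s] by simp
    have Ts: "T s 0 x \<le> (B + 1) * nv x powr (- d + \<alpha>)"
    proof (cases "1 \<le> nv x")
      case True
      then have "T s 0 x \<le> B * nv x powr (- d + \<alpha>)" using B(2)[OF s(1) x] unfolding s_def by (simp add: max_def split: if_splits)
      also have "\<dots> \<le> (B + 1) * nv x powr (- d + \<alpha>)" by (intro mult_right_mono) auto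
      finally show ?thesis .
    next
      case small: False
      have "T s 0 x \<le> 1" by (rule T_le_1)
      also have "1 \<le> nv x powr (- d + \<alpha>)"
        using small False nv_pos[OF x] powr_mono2'[of "- d + \<alpha>" "nv x" 1] by simp
      also have "\<dots> = 1 * nv x powr (- d + \<alpha>)" by simp
      also have "\<dots> \<le> (B + 1) * nv x powr (- d + \<alpha>)" using B(1) by (intro mult_right_mono) auto
      finally show ?thesis .
    qed
    have dy: "T (2 ^ n * s) 0 x \<le> T s 0 x + C * s powr (\<alpha> - d) * (\<Sum>j<n. q ^ j)" for n
    proof (induction n)
      case (Suc n)
      have p1: "1 \<le> 2 ^ n * s" using s(1) one_le_power[of "2::real" n] mult_mono[of 1 "2 ^ n" 1 s] by simp
      have "T (2 ^ Suc n * s) 0 x \<le> T (2 ^ n * s) 0 x + C * (2 ^ n * s) powr (\<alpha> - d)"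
        using C(2)[OF p1 x] by (simp add: mult.assoc)
      also have "(2 ^ n * s) powr (\<alpha> - d) = q ^ n * s powr (\<alpha> - d)"
      proof -
        have "(2 ^ n :: real) powr (\<alpha> - d) = (2 powr real n) powr (\<alpha> - d)" by (simp add: powr_realpow)
        also have "\<dots> = q powr real n" unfolding q_def by (simp add: powr_powr mult.commute)
        also have "\<dots> = q ^ n" using q by (simp add: powr_realpow)
        finally show ?thesis using s(1) by (simp add: powr_mult)
      qed
      finally show ?case using Suc.IH by (simp add: algebra_simps)
    qed simp
    obtain n where n: "r < 2 ^ n" using real_arch_pow[of 2 r] by auto
    have "2 ^ n * 1 \<le> 2 ^ n * s" using s(1) by (intro mult_left_mono) auto
    then have "r \<le> 2 ^ n * s" using n by linarith
    then have "T r 0 x \<le> T (2 ^ n * s) 0 x" using r by (intro T_mono) auto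
    also note dy
    also have "C * s powr (\<alpha> - d) * (\<Sum>j<n. q ^ j) \<le> C * s powr (\<alpha> - d) * (1 / (1 - q))"
      using C(1) by (intro mult_left_mono sum_geometric_le q) auto
    also have "\<dots> \<le> C * nv x powr (- d + \<alpha>) * (1 / (1 - q))"
      using C(1) q sn by (intro mult_right_mono mult_left_mono) auto
    finally show ?thesis using Ts unfolding B'_def by (simp add: algebra_simps)
  qed
  then show ?thesis using B' by blast
qed

text \<open>On finitely many edges a large cut-off \<open>r\<close> changes the weights by at most
  \<open>b * J r\<close>, so the bound uniform in the cut-off passes to the full model.\<close>

lemma Tf_upper_bound: "\<exists>B>0. \<forall>x. x \<noteq> 0 \<longrightarrow> Tf 0 x \<le> B * nv x powr (- d + \<alpha>)"
proof -
  obtain B where B: "0 < B" "\<And>r x. 1 \<le> r \<Longrightarrow> x \<noteq> 0 \<Longrightarrow> T r 0 x \<le> B * nv x powr (- d + \<alpha>)"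
    using T_upper_bound by blast
  have "Tf 0 x \<le> B * nv x powr (- d + \<alpha>)" if x: "x \<noteq> 0" for x
    unfolding Tf_def
  proof (rule Tau_le_of_approximations[OF wf_nonneg])
    fix E :: "(int ^ 'd) set set" and \<epsilon> :: real
    assume E: "finite E" "E \<subseteq> edges" and \<epsilon>: "0 < \<epsilon>"
    have lim: "((\<lambda>r. CJ * r powr (- d - \<alpha>)) \<longlongrightarrow> CJ * 0) at_top"
      using d_ge_1 alpha by (intro tendsto_intros tendsto_neg_powr filterlim_ident) auto
    have "\<forall>\<^sub>F r in at_top. CJ * r powr (- d - \<alpha>) < \<epsilon> / b"
      using order_tendstoD(2)[OF lim] \<epsilon> b_pos by simp
    moreover have "\<forall>\<^sub>F r in at_top. \<forall>e\<in>E. \<forall>u v. e = {u, v} \<longrightarrow> nv (u - v) \<le> r"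
    proof (intro eventually_ball_finite E ballI)
      fix e assume "e \<in> E"
      then obtain u v where e: "e = {u, v}" using E edge_cases by (metis subsetD)
      show "\<forall>\<^sub>F r in at_top. \<forall>u v. e = {u, v} \<longrightarrow> nv (u - v) \<le> r"
        using eventually_ge_at_top[of "nv (u - v)"]
        by eventually_elim (auto simp: e doubleton_eq_iff nv_commute)
    qed
    moreover have "\<forall>\<^sub>F r in at_top. (1 :: real) \<le> r" by (rule eventually_ge_at_top)
    ultimately have "\<forall>\<^sub>F r in at_top. CJ * r powr (- d - \<alpha>) < \<epsilon> / b \<and>
        (\<forall>e\<in>E. \<forall>u v. e = {u, v} \<longrightarrow> nv (u - v) \<le> r) \<and> 1 \<le> r"
      by (simp add: eventually_conj_iff)
    from eventually_happens[OF this] obtain r where r: "CJ * r powr (- d - \<alpha>) < \<epsilon> / b"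
      "\<And>e u v. e \<in> E \<Longrightarrow> e = {u, v} \<Longrightarrow> nv (u - v) \<le> r" "1 \<le> r" by auto
    have "wf e \<le> wc r e + \<epsilon>" if e: "e \<in> E" for e
    proof -
      have "e \<in> edges" using e E by auto
      then obtain u v where uv: "u \<noteq> v" "e = {u, v}" by (rule edge_cases)
      have "b * J r \<le> b * (CJ * r powr (- d - \<alpha>))" using b by (intro mult_left_mono J_upper r) auto
      also have "\<dots> \<le> b * (\<epsilon> / b)" using b r(1) by (intro mult_left_mono) auto
      also have "\<dots> = \<epsilon>" using b_pos by simp
      finally have "b * J r \<le> \<epsilon>" .
      moreover have "nv (u - v) \<le> r" using r(2)[OF e uv(2)] .
      ultimately show ?thesis using uv by (simp add: wf_pair wc_pair Kf_def Kc_def algebra_simps)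
    qed
    then show "\<exists>w'. (\<forall>e. 0 \<le> w' e \<and> w' e \<le> wf e) \<and> (\<forall>e\<in>E. wf e \<le> w' e + \<epsilon>) \<and>
        Tau w' 0 x \<le> B * nv x powr (- d + \<alpha>)"
      using B(2)[OF r(3) x] wc_nonneg wc_le_wf r(3)
      by (intro exI[of _ "wc r"]) (auto simp: T_def)
  qed
  then show ?thesis using B(1) by blast
qed

text \<open>\<open>T_upper_decay\<close> has a constant depending on the exponent, so a single
  profile is obtained as a supremum of normalised two-point functions, to which each of these bounds
  applies.\<close>

lemma cutoff_profile:
  "\<exists>h. (\<forall>t>0. 0 < h t \<and> h t \<le> (1 :: real)) \<and> antimono_on {0<..} h \<and>
     (\<forall>p>0. h \<in> o[at_top](\<lambda>t. t powr (- p))) \<and>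
     (\<exists>A>0. \<forall>r\<ge>1. \<forall>x. x \<noteq> 0 \<longrightarrow> T r 0 x \<le> A * nv x powr (- d + \<alpha>) * h (nv x / r))"
proof -
  obtain B where B: "0 < B" "\<And>r x. 1 \<le> r \<Longrightarrow> x \<noteq> 0 \<Longrightarrow> T r 0 x \<le> B * nv x powr (- d + \<alpha>)"
    using T_upper_bound by blast
  define G where "G = (\<lambda>r x. T r 0 x / (B * nv x powr (- d + \<alpha>)))"
  \<comment> \<open>The element \<open>exp (- t)\<close> keeps the supremum positive even beyond all
    distances where the two-point function contributes, and decays faster than any power. The sets
    shrink as \<open>t\<close> grows, apart from this element, which decreases.\<close>
  define S where "S = (\<lambda>t. insert (exp (- t)) {G r x | r x. 1 \<le> r \<and> x \<noteq> 0 \<and> t \<le> nv x / r})"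
  define h where "h = (\<lambda>t. Sup (S t))"
  have pos: "0 < B * nv x powr (- d + \<alpha>)" if "x \<noteq> 0" for x using B(1) nv_pos[OF that] by simp
  have G1: "G r x \<le> 1" if "1 \<le> r" "x \<noteq> 0" for r x
    unfolding G_def using B(2)[OF that] pos[OF that(2)] by simp
  have S1: "y \<le> 1" if "y \<in> S t" "0 < t" for y t
    using that G1 unfolding S_def by auto
  have bdd: "bdd_above (S t)" if "0 < t" for t by (rule bdd_aboveI[of _ 1]) (rule S1[OF _ that])
  have ne: "S t \<noteq> {}" for t unfolding S_def by simp
  have h_ge: "exp (- t) \<le> h t" if "0 < t" for t
    unfolding h_def by (rule cSup_upper[OF _ bdd[OF that]]) (simp add: S_def)
  have h_le: "h t \<le> y" if "\<And>s. s \<in> S t \<Longrightarrow> s \<le> y" for t y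
    unfolding h_def using that by (rule cSup_least[OF ne])
  have h01: "0 < h t" "h t \<le> 1" if t: "0 < t" for t
  proof -
    show "0 < h t" using h_ge[OF t] exp_gt_zero[of "- t"] by linarith
    show "h t \<le> 1" by (rule h_le) (rule S1[OF _ t])
  qed
  have anti: "h t \<le> h s" if s: "0 < s" "s \<le> t" for s t
  proof (rule h_le)
    fix y assume "y \<in> S t"
    then consider "y = exp (- t)" | "y \<in> S s" using s(2) unfolding S_def by force
    then show "y \<le> h s"
    proof cases
      case 1
      have "exp (- t) \<le> exp (- s)" using s by simp
      then show ?thesis using h_ge[OF s(1)] 1 by linarith
    next
      case 2
      then show ?thesis unfolding h_def by (rule cSup_upper[OF _ bdd[OF s(1)]])
    qed
  qed
  have decay: "h \<in> o[at_top](\<lambda>t. t powr (- p))" if p: "0 < p" for p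
  proof -
    define q where "q = p + 1 + \<bar>\<alpha> - d\<bar>"
    have q: "0 < q" "\<alpha> - d < q" "p < q" unfolding q_def using p by auto
    obtain D where D: "0 < D" "\<And>r x. 1 \<le> r \<Longrightarrow> x \<noteq> 0 \<Longrightarrow>
        T r 0 x \<le> D * nv x powr (- d + \<alpha>) * (nv x / r) powr (- q)"
      using T_upper_decay[OF q(1,2)] by blast
    have h_up: "h t \<le> exp (- t) + D / B * t powr (- q)" if t: "0 < t" for t
    proof (rule h_le)
      fix y assume "y \<in> S t"
      then consider "y = exp (- t)" | r x where "1 \<le> r" "x \<noteq> 0" "t \<le> nv x / r" "y = G r x"
        unfolding S_def by auto
      then show "y \<le> exp (- t) + D / B * t powr (- q)"
      proof cases
        case 1
        then show ?thesis using D B by simp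
      next
        case 2
        have "y \<le> D * nv x powr (- d + \<alpha>) * (nv x / r) powr (- q) / (B * nv x powr (- d + \<alpha>))"
          unfolding 2(4) G_def using D(2)[OF 2(1,2)] pos[OF 2(2)] by (intro divide_right_mono) auto
        also have "\<dots> = D / B * (nv x / r) powr (- q)" using nv_pos[OF 2(2)] by simp
        also have "\<dots> \<le> D / B * t powr (- q)" using D B 2(3) t q by (intro mult_left_mono powr_mono2') auto
        also have "\<dots> \<le> exp (- t) + D / B * t powr (- q)" by simp
        finally show ?thesis .
      qed
    qed
    define n where "n = nat \<lceil>p\<rceil>"
    have n: "p \<le> real n" unfolding n_def by linarith
    have lim: "((\<lambda>t. t ^ n / exp t + D / B * t powr (p - q)) \<longlongrightarrow> 0 + D / B * 0) at_top"
      using q by (intro tendsto_intros tendsto_power_div_exp_0 tendsto_neg_powr filterlim_ident) auto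
    have "((\<lambda>t. h t / t powr (- p)) \<longlongrightarrow> 0) at_top"
    proof (rule tendsto_sandwich[OF _ _ tendsto_const])
      show "\<forall>\<^sub>F t in at_top. 0 \<le> h t / t powr (- p)"
        using eventually_ge_at_top[of 1] by eventually_elim (use h01 in \<open>auto intro!: divide_nonneg_nonneg less_imp_le\<close>)
      show "\<forall>\<^sub>F t in at_top. h t / t powr (- p) \<le> t ^ n / exp t + D / B * t powr (p - q)"
        using eventually_ge_at_top[of 1]
      proof eventually_elim
        case (elim t)
        have "h t / t powr (- p) = h t * t powr p" by (simp add: powr_minus divide_inverse)
        also have "\<dots> \<le> (exp (- t) + D / B * t powr (- q)) * t powr p"
          using h_up[of t] elim by (intro mult_right_mono) auto
        also have "\<dots> = exp (- t) * t powr p + D / B * t powr (p - q)"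
          by (simp add: algebra_simps powr_diff powr_minus divide_inverse)
        also have "exp (- t) * t powr p \<le> exp (- t) * t powr real n"
          using elim n by (intro mult_left_mono powr_mono) auto
        also have "exp (- t) * t powr real n = t ^ n / exp t"
          using elim by (simp add: powr_realpow exp_minus divide_inverse)
        finally show ?case by simp
      qed
      show "((\<lambda>t. t ^ n / exp t + D / B * t powr (p - q)) \<longlongrightarrow> 0) at_top" using lim by simp
    qed
    then show ?thesis
      by (rule smalloI_tendsto) (auto intro!: eventually_mono[OF eventually_gt_at_top[of 0]])
  qed
  have "T r 0 x \<le> B * nv x powr (- d + \<alpha>) * h (nv x / r)" if r: "1 \<le> r" and x: "x \<noteq> 0" for r x
  proof -
    have t: "0 < nv x / r" using r nv_pos[OF x] by simp
    have "G r x \<le> h (nv x / r)" unfolding h_def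
      by (rule cSup_upper[OF _ bdd[OF t]]) (use r x in \<open>auto simp: S_def\<close>)
    then show ?thesis unfolding G_def using pos[OF x] by (simp add: pos_divide_le_eq mult.commute)
  qed
  then show ?thesis
    using B(1) h01 anti decay by (intro exI[of _ h]) (auto simp: monotone_on_def)
qed

end

section \<open>Criticality\<close>

lemma ber_zero: "finite I \<Longrightarrow> ber (\<lambda>_. 0) I g = g {}"
  by (induction I rule: finite_induct) (simp_all add: ber_insert)

lemma Tau_zero:
  assumes "\<And>e. w e = 0" "x \<noteq> y"
  shows "Tau w x y = 0"
proof -
  have p: "pw w = (\<lambda>_. 0)" by (auto simp: pw_def assms)
  have "y \<notin> conn {} x" using conn_isolated[of x "{}"] assms(2) by auto
  then have "Tau w x y \<le> 0"
    unfolding Tau_def using assms(1) by (intro expec_le) (auto simp: p ber_zero)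
  moreover have "0 \<le> Tau w x y" using assms(1) by (intro Tau_nonneg) simp
  ultimately show ?thesis by simp
qed

context lr_model
begin

lemma T_sum_origin: "(\<Sum>x\<in>F. T r u x) = (\<Sum>x\<in>(\<lambda>x. x - u) ` F. T r 0 x)"
  by (subst sum.reindex) (auto simp: inj_on_def T_origin[of r u])

text \<open>\<open>W1\<close> bounds the total weight at a vertex. The second sum is what cutting
  off at \<open>r\<close> removes: about \<open>r^d\<close> short pairs lose \<open>J r\<close>
  each, and the longer pairs lose everything; both parts are of order
  \<open>r^(-\<alpha>)\<close>.\<close>

lemma kernel_sums:
  "\<exists>W1>0. \<exists>W2>0. (\<forall>F a. finite F \<longrightarrow> a \<notin> F \<longrightarrow> (\<Sum>y\<in>F. J (nv (a - y))) \<le> W1) \<and>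
    (\<forall>r\<ge>1. \<forall>F a. finite F \<longrightarrow> a \<notin> F \<longrightarrow>
       (\<Sum>y\<in>F. if nv (a - y) \<le> r then J r else J (nv (a - y))) \<le> W2 * r powr (- \<alpha>))"
proof -
  obtain K where K: "0 < K" "\<And>R. 1 \<le> R \<Longrightarrow> card (lball R) \<le> K * R powr d" using lball_upper by blast
  obtain K2 where K2: "0 < K2" "\<forall>r\<ge>1. \<forall>F. finite F \<longrightarrow> F \<inter> lball r = {} \<longrightarrow>
      (\<Sum>x\<in>F. nv x powr (- d - \<alpha>)) \<le> K2 * r powr (- \<alpha>)"
    using tail_sum[OF alpha] by (elim exE conjE) (rule that)
  obtain \<eta> where \<eta>: "0 < \<eta>" "\<And>x. x \<noteq> 0 \<Longrightarrow> \<eta> \<le> nv x" using nv_bounded_below by blast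
  define W2 where "W2 = K * CJ + CJ * K2"
  have W2: "0 < W2" unfolding W2_def using K K2 CJ by (simp add: add_pos_pos)
  define W1 where "W1 = K * J \<eta> + W2"
  have W1: "0 < W1" unfolding W1_def using K W2 J_pos[OF \<eta>(1)] by (simp add: add_pos_pos)
  have shift: "(\<Sum>y\<in>F. f (nv (a - y))) = (\<Sum>x\<in>(\<lambda>y. y - a) ` F. f (nv x))" for f :: "real \<Rightarrow> real" and F a
    by (subst sum.reindex) (auto simp: inj_on_def nv_commute[of a])
  have card_le: "real (card (F \<inter> lball r)) \<le> K * r powr d" if "1 \<le> r" for F r
    using K(2)[OF that] card_mono[of "lball r" "F \<inter> lball r"] by force
  have tail: "(\<Sum>x\<in>F - lball r. J (nv x)) \<le> CJ * K2 * r powr (- \<alpha>)" if "1 \<le> r" "finite F" for r F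
  proof -
    have "(\<Sum>x\<in>F - lball r. J (nv x)) \<le> (\<Sum>x\<in>F - lball r. CJ * nv x powr (- d - \<alpha>))"
      using that by (intro sum_mono J_upper) (auto simp: lball_def)
    also have "\<dots> = CJ * (\<Sum>x\<in>F - lball r. nv x powr (- d - \<alpha>))" by (simp add: sum_distrib_left)
    also have "\<dots> \<le> CJ * (K2 * r powr (- \<alpha>))"
      using CJ that by (intro mult_left_mono K2(2)[rule_format]) auto
    finally show ?thesis by simp
  qed
  have B2: "(\<Sum>x\<in>F. if nv x \<le> r then J r else J (nv x)) \<le> W2 * r powr (- \<alpha>)" if r: "1 \<le> r" and F: "finite F" for r F
  proof -
    have "(\<Sum>x\<in>F. if nv x \<le> r then J r else J (nv x)) =
        (\<Sum>x\<in>F \<inter> lball r. J r) + (\<Sum>x\<in>F - lball r. J (nv x))"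
      unfolding sum.Int_Diff[OF F, of _ "lball r"] by (intro arg_cong2[where f = "(+)"] sum.cong) (auto simp: lball_def)
    also have "(\<Sum>x\<in>F \<inter> lball r. J r) \<le> K * r powr d * (CJ * r powr (- d - \<alpha>))"
      using card_le[OF r, of F] J_upper[OF r] J_pos[of r] r K by (simp add: mult_mono)
    also have "K * r powr d * (CJ * r powr (- d - \<alpha>)) = K * CJ * r powr (- \<alpha>)"
      by (simp flip: powr_add)
    finally show ?thesis using tail[OF r F] unfolding W2_def by (simp add: algebra_simps)
  qed
  have B1: "(\<Sum>x\<in>F. J (nv x)) \<le> W1" if F: "finite F" "0 \<notin> F" for F
  proof -
    have "(\<Sum>x\<in>F. J (nv x)) = (\<Sum>x\<in>F \<inter> lball 1. J (nv x)) + (\<Sum>x\<in>F - lball 1. J (nv x))"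
      using F by (intro sum.Int_Diff)
    also have "(\<Sum>x\<in>F \<inter> lball 1. J (nv x)) \<le> (\<Sum>x\<in>F \<inter> lball 1. J \<eta>)"
    proof (intro sum_mono J_antimono \<eta>(1))
      fix x assume "x \<in> F \<inter> lball 1"
      then have "x \<noteq> 0" using F by auto
      then show "\<eta> \<le> nv x" by (rule \<eta>(2))
    qed
    also have "\<dots> \<le> K * J \<eta>" using card_le[of 1 F] J_pos[OF \<eta>(1)] by (simp add: mult_right_mono)
    also have "(\<Sum>x\<in>F - lball 1. J (nv x)) \<le> W2" using tail[of 1 F] F mult_pos_pos[OF K(1) CJ] unfolding W2_def by simp
    finally show ?thesis unfolding W1_def by simp
  qed
  have "(\<Sum>y\<in>F. J (nv (a - y))) \<le> W1" if "finite F" "a \<notin> F" for F a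
    unfolding shift using that by (intro B1) auto
  moreover have "(\<Sum>y\<in>F. if nv (a - y) \<le> r then J r else J (nv (a - y))) \<le> W2 * r powr (- \<alpha>)"
    if "1 \<le> r" "finite F" for F a r
    using shift[of "\<lambda>s. if s \<le> r then J r else J s" a F] that B2[of r "(\<lambda>y. y - a) ` F"] by simp
  ultimately show ?thesis using W1 W2 by blast
qed

text \<open>At criticality, adding the long edges to the cut-off model must make the susceptibility
  infinite, so the stability estimate gives a lower bound on the cut-off susceptibility.\<close>

lemma critical_lower_bound:
  assumes super: "\<And>\<epsilon>. 0 < \<epsilon> \<Longrightarrow> \<exists>\<beta>\<ge>b. \<beta> < b + \<epsilon> \<and>
      \<not> (\<exists>B. \<forall>F. finite F \<longrightarrow> (\<Sum>x\<in>F. Tau (kernel_weight Kf \<beta>) 0 x) \<le> B)"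
  shows "0 < b \<and> (\<exists>c>0. \<forall>r\<ge>1. \<forall>X. (\<forall>F. finite F \<longrightarrow> (\<Sum>x\<in>F. T r 0 x) \<le> X) \<longrightarrow> c * r powr \<alpha> \<le> X)"
proof -
  obtain W1 W2 where W: "0 < W1" "0 < W2" "\<And>F a. finite F \<Longrightarrow> a \<notin> F \<Longrightarrow> (\<Sum>y\<in>F. J (nv (a - y))) \<le> W1"
    "\<And>r F a. 1 \<le> r \<Longrightarrow> finite F \<Longrightarrow> a \<notin> F \<Longrightarrow>
       (\<Sum>y\<in>F. if nv (a - y) \<le> r then J r else J (nv (a - y))) \<le> W2 * r powr (- \<alpha>)"
    using kernel_sums by auto
  have main: "1 \<le> X * (b * W2 * r powr (- \<alpha>))"
    if r: "1 \<le> r" and X: "\<And>F. finite F \<Longrightarrow> (\<Sum>x\<in>F. T r 0 x) \<le> X" for r X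
  proof (rule field_le_epsilon)
    fix e :: real assume e: "0 < e"
    have X0: "1 \<le> X" using X[of "{0}"] by simp
    \<comment> \<open>The excess \<open>\<beta> - b\<close> then contributes at most
      \<open>X * W1 * \<epsilon> = e\<close>.\<close>
    define \<epsilon> where "\<epsilon> = e / (X * W1)"
    have \<epsilon>: "0 < \<epsilon>" unfolding \<epsilon>_def using e X0 W by simp
    obtain \<beta> where \<beta>: "b \<le> \<beta>" "\<beta> < b + \<epsilon>"
      "\<not> (\<exists>B. \<forall>F. finite F \<longrightarrow> (\<Sum>x\<in>F. Tau (kernel_weight Kf \<beta>) 0 x) \<le> B)"
      using super[OF \<epsilon>] by blast
    have \<beta>0: "0 \<le> \<beta>" using \<beta> b by simp
    interpret F: percolation_kernel Kf \<beta>
      using percolation_kernel_Kf \<beta>0 by (simp add: percolation_kernel_def)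
    \<comment> \<open>The layer leading from the cut-off model at \<open>b\<close> to the full model
      at the slightly larger \<open>\<beta>\<close>.\<close>
    define v where "v = (\<lambda>e. kernel_weight Kf \<beta> e - wc r e)"
    have v_pair: "v {x, y} = (\<beta> - b) * J (nv (x - y)) + b * (if nv (x - y) \<le> r then J r else J (nv (x - y)))"
      if "x \<noteq> y" for x y
      unfolding v_def using that by (simp add: F.weight_pair wc_pair Kf_def Kc_def algebra_simps)
    have v0: "0 \<le> v e" for e
    proof (cases "e \<in> edges")
      case True
      obtain x y where xy: "x \<noteq> y" "e = {x, y}" using edge_cases[OF True] by blast
      have "0 \<le> J (nv (x - y))" "0 \<le> J r" using J_pos[OF nv_diff_pos[OF xy(1)]] J_pos[of r] r by auto
      then show ?thesis using \<beta>(1) b unfolding xy(2) v_pair[OF xy(1)] by auto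
    qed (simp add: v_def wc_outside kernel_weight_def)
    have eq: "kernel_weight Kf \<beta> = (\<lambda>e. wc r e + v e)" by (auto simp: v_def)
    let ?V = "(\<beta> - b) * W1 + b * (W2 * r powr (- \<alpha>))"
    have "\<not> X * ?V < 1"
    proof
      assume less: "X * ?V < 1"
      have "(\<Sum>x\<in>F. Tau (\<lambda>e. wc r e + v e) 0 x) \<le> X / (1 - X * ?V)" if F: "finite F" for F
      proof (rule susceptibility_stable[OF wc_nonneg v0 _ _ less F])
        show "(\<Sum>x\<in>F. Tau (wc r) u x) \<le> X" if "finite F" for u F
          using X[of "(\<lambda>x. x - u) ` F"] that T_sum_origin[of r u F] unfolding T_def by simp
        show "(\<Sum>y\<in>F. v {a, y}) \<le> ?V" if F: "finite F" "a \<notin> F" for a F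
        proof -
          have "(\<Sum>y\<in>F. v {a, y}) =
             (\<Sum>y\<in>F. (\<beta> - b) * J (nv (a - y)) + b * (if nv (a - y) \<le> r then J r else J (nv (a - y))))"
            using F by (intro sum.cong v_pair) auto
          also have "\<dots> = (\<beta> - b) * (\<Sum>y\<in>F. J (nv (a - y))) +
              b * (\<Sum>y\<in>F. if nv (a - y) \<le> r then J r else J (nv (a - y)))"
            by (simp add: sum.distrib sum_distrib_left)
          also have "\<dots> \<le> ?V" using \<beta>(1) b r F by (intro add_mono mult_left_mono W) auto
          finally show ?thesis .
        qed
      qed
      then show False using \<beta>(3) unfolding eq by blast
    qed
    then have "1 \<le> X * ?V" by simp
    also have "\<dots> = X * W1 * (\<beta> - b) + X * (b * W2 * r powr (- \<alpha>))" by (simp add: algebra_simps)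
    also have "X * W1 * (\<beta> - b) \<le> X * W1 * \<epsilon>" using \<beta>(2) X0 W by (intro mult_left_mono) auto
    also have "X * W1 * \<epsilon> = e" unfolding \<epsilon>_def using X0 W by simp
    finally show "1 \<le> X * (b * W2 * r powr (- \<alpha>)) + e" by simp
  qed
  \<comment> \<open>At \<open>b = 0\<close> the susceptibility is 1, and \<open>main\<close> would
    read \<open>1 \<le> 0\<close>.\<close>
  have b0: "0 < b"
  proof (rule ccontr)
    assume "\<not> 0 < b"
    then have bz: "b = 0" using b by simp
    have "wc 1 e = 0" for e unfolding wc_def kernel_weight_def using bz by simp
    then have T0: "T 1 0 x = (if x = 0 then 1 else 0)" for x
      using Tau_zero[of "wc 1" 0 x] by (auto simp: T_def Tau_self[OF wc_nonneg])
    have "(\<Sum>x\<in>F. T 1 0 x) \<le> 1" if "finite F" for F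
      unfolding T0 using that by simp
    from main[OF order_refl this] show False using bz by simp
  qed
  have "1 / (b * W2) * r powr \<alpha> \<le> X"
    if r: "1 \<le> r" and X: "\<forall>F. finite F \<longrightarrow> (\<Sum>x\<in>F. T r 0 x) \<le> X" for r X
  proof -
    have "1 * r powr \<alpha> \<le> X * (b * W2 * r powr (- \<alpha>)) * r powr \<alpha>"
      using main[OF r, of X] X by (intro mult_right_mono) auto
    also have "\<dots> = X * (b * W2) * (r powr (- \<alpha>) * r powr \<alpha>)" by simp
    also have "\<dots> = X * (b * W2)" using r by (simp flip: powr_add)
    finally show ?thesis using b0 W by (simp add: pos_divide_le_eq)
  qed
  moreover have "0 < 1 / (b * W2)" using b0 W by simp
  ultimately show ?thesis using b0 by blast
qed

text \<open>A higher moment \<open>q\<close> is of order \<open>r^(q + \<alpha>)\<close>: the ball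
  of radius \<open>r\<close> uses \<open>h \<le> 1\<close>, its complement the decay of
  \<open>h\<close>. The p-th moment follows from \<open>u^p \<le> 1 + u^q\<close> with
  \<open>u = nv x / r\<close>, and \<open>r^\<alpha> \<le> X / c\<close> turns the scale into the
  susceptibility.\<close>

lemma moments_of_profile:
  assumes c: "0 < c" "\<And>r X. 1 \<le> r \<Longrightarrow> (\<And>F. finite F \<Longrightarrow> (\<Sum>x\<in>F. T r 0 x) \<le> X) \<Longrightarrow> c * r powr \<alpha> \<le> X"
    and h: "\<And>t. 0 < t \<Longrightarrow> 0 < h t \<and> h t \<le> 1" "\<And>p. 0 < p \<Longrightarrow> h \<in> o[at_top](\<lambda>t. t powr (- p))"
    and A: "0 < A" "\<And>r x. 1 \<le> r \<Longrightarrow> x \<noteq> 0 \<Longrightarrow> T r 0 x \<le> A * nv x powr (- d + \<alpha>) * h (nv x / r)"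
    and p: "0 < p"
  shows "\<exists>C>0. \<forall>r\<ge>1. (\<exists>B. \<forall>F. finite F \<longrightarrow> (\<Sum>x\<in>F. T r 0 x) \<le> B) \<and>
     (\<forall>X F. (\<forall>F. finite F \<longrightarrow> (\<Sum>x\<in>F. T r 0 x) \<le> X) \<longrightarrow> finite F \<longrightarrow>
        (\<Sum>x\<in>F. nv x powr p * T r 0 x) \<le> C * r powr p * X)"
proof -
  \<comment> \<open>\<open>p - d + \<alpha>\<close> may be negative, while
    \<open>q - d + \<alpha>\<close> is not; so \<open>nv x^(q - d + \<alpha>)\<close> is largest at
    the boundary of the ball.\<close>
  define q where "q = p + d"
  have q: "0 < q" "p \<le> q" "0 \<le> q - d + \<alpha>" unfolding q_def using p d_ge_1 alpha by auto
  \<comment> \<open>This much decay of the profile leaves \<open>nv x^(- d - 1)\<close> outside the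
    ball, which is summable.\<close>
  define s where "s = q + \<alpha> + 1"
  have s: "0 < s" "- d + \<alpha> + q - s = - d - 1" unfolding s_def using q alpha by auto
  obtain H where H: "0 < H" "\<And>t. 1 \<le> t \<Longrightarrow> h t \<le> H * t powr (- s)"
  proof -
    from landau_o.smallD[OF h(2)[OF s(1)], of 1] obtain t0 where t0: "\<And>t. t0 \<le> t \<Longrightarrow> \<bar>h t\<bar> \<le> \<bar>t powr (- s)\<bar>"
      by (auto simp: eventually_at_top_linorder)
    define t1 where "t1 = max 1 t0"
    have t1: "1 \<le> t1" "t0 \<le> t1" unfolding t1_def by auto
    have t1s: "1 \<le> t1 powr s" using t1 s by (intro ge_one_powr_ge_zero) auto
    have "h t \<le> t1 powr s * t powr (- s)" if t: "1 \<le> t" for t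
    proof (cases "t1 \<le> t")
      case True
      then have "h t \<le> 1 * t powr (- s)" using t0[of t] t1 h(1)[of t] t by simp
      also have "\<dots> \<le> t1 powr s * t powr (- s)" using t1s by (intro mult_right_mono) auto
      finally show ?thesis .
    next
      case False
      have "h t \<le> 1" using h(1)[of t] t by simp
      also have "1 = t powr s * t powr (- s)" using t by (simp flip: powr_add)
      also have "\<dots> \<le> t1 powr s * t powr (- s)" using False t s by (intro mult_right_mono powr_mono2) auto
      finally show ?thesis .
    qed
    then show ?thesis using t1s by (intro that[of "t1 powr s"]) auto
  qed
  obtain K where K: "0 < K" "\<And>R. 1 \<le> R \<Longrightarrow> card (lball R) \<le> K * R powr d" using lball_upper by blast
  obtain K2 where K2: "0 < K2" "\<forall>r\<ge>1. \<forall>F. finite F \<longrightarrow> F \<inter> lball r = {} \<longrightarrow>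
      (\<Sum>x\<in>F. nv x powr (- d - 1)) \<le> K2 * r powr (- 1)"
    using tail_sum[OF zero_less_one] by (elim exE conjE) (rule that)
  define C where "C = A * K + A * H * K2"
  have C: "0 < C" unfolding C_def using A K H K2 by (simp add: add_pos_pos)
  have near: "(\<Sum>x\<in>F \<inter> lball r. nv x powr q * T r 0 x) \<le> A * K * r powr (q + \<alpha>)" if r: "1 \<le> r" and F: "finite F" for r F
  proof -
    have pt: "nv x powr q * T r 0 x \<le> A * r powr (q - d + \<alpha>)" if x: "x \<in> lball r" for x
    proof (cases "x = 0")
      case False
      have xr: "nv x \<le> r" using x by (simp add: lball_def)
      have "T r 0 x \<le> A * nv x powr (- d + \<alpha>) * 1"
        using A(2)[OF r False] h(1)[of "nv x / r"] A(1) r nv_pos[OF False]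
        by (intro order_trans[OF A(2)[OF r False]] mult_left_mono) auto
      then have "nv x powr q * T r 0 x \<le> nv x powr q * (A * nv x powr (- d + \<alpha>))"
        by (intro mult_left_mono) auto
      also have "\<dots> = A * (nv x powr q * nv x powr (- d + \<alpha>))" by simp
      also have "nv x powr q * nv x powr (- d + \<alpha>) = nv x powr (q - d + \<alpha>)"
          unfolding powr_add[symmetric] by (simp add: algebra_simps)
      also have "A * nv x powr (q - d + \<alpha>) \<le> A * r powr (q - d + \<alpha>)"
        using A(1) xr q by (intro mult_left_mono powr_mono2) auto
      finally show ?thesis .
    qed (use A in auto)
    have "(\<Sum>x\<in>F \<inter> lball r. nv x powr q * T r 0 x) \<le> (\<Sum>x\<in>F \<inter> lball r. A * r powr (q - d + \<alpha>))"
      by (intro sum_mono pt) auto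
    also have "\<dots> = card (F \<inter> lball r) * (A * r powr (q - d + \<alpha>))" by simp
    also have "\<dots> \<le> (K * r powr d) * (A * r powr (q - d + \<alpha>))"
    proof (intro mult_right_mono)
      have "real (card (F \<inter> lball r)) \<le> card (lball r)" by (intro of_nat_mono card_mono) auto
      then show "real (card (F \<inter> lball r)) \<le> K * r powr d" using K(2)[OF r] by linarith
    qed (use A in auto)
    also have "\<dots> = A * K * (r powr d * r powr (q - d + \<alpha>))" by simp
    also have "r powr d * r powr (q - d + \<alpha>) = r powr (q + \<alpha>)" by (simp flip: powr_add)
    finally show ?thesis .
  qed
  have far: "(\<Sum>x\<in>F - lball r. nv x powr q * T r 0 x) \<le> A * H * K2 * r powr (q + \<alpha>)" if r: "1 \<le> r" and F: "finite F" for r F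
  proof -
    have "(\<Sum>x\<in>F - lball r. nv x powr q * T r 0 x) \<le> (\<Sum>x\<in>F - lball r. A * H * r powr s * nv x powr (- d - 1))"
    proof (intro sum_mono)
      fix x assume "x \<in> F - lball r"
      then have x: "r < nv x" by (simp add: lball_def)
      then have x0: "x \<noteq> 0" using r by auto
      have "T r 0 x \<le> A * nv x powr (- d + \<alpha>) * (H * (nv x / r) powr (- s))"
        using r x A(1) by (intro order_trans[OF A(2)[OF r x0]] mult_left_mono H(2)) auto
      also have "(nv x / r) powr (- s) = nv x powr (- s) * r powr s"
        using r x by (simp add: powr_divide powr_minus field_simps)
      finally have "nv x powr q * T r 0 x \<le> nv x powr q * (A * nv x powr (- d + \<alpha>) * (H * (nv x powr (- s) * r powr s)))"
        by (intro mult_left_mono) auto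
      also have "\<dots> = A * H * r powr s * (nv x powr (- d + \<alpha>) * nv x powr q * nv x powr (- s))" by simp
      also have "nv x powr (- d + \<alpha>) * nv x powr q * nv x powr (- s) = nv x powr (- d - 1)"
        unfolding powr_add[symmetric] by (rule arg_cong[where f = "(powr) (nv x)"]) (simp add: s_def)
      finally show "nv x powr q * T r 0 x \<le> A * H * r powr s * nv x powr (- d - 1)" .
    qed
    also have "\<dots> = A * H * r powr s * (\<Sum>x\<in>F - lball r. nv x powr (- d - 1))" by (simp add: sum_distrib_left)
    also have "\<dots> \<le> A * H * r powr s * (K2 * r powr (- 1))"
      using A H F r by (intro mult_left_mono K2(2)[rule_format]) auto
    also have "\<dots> = A * H * K2 * (r powr s * r powr (- 1))" by simp
    also have "r powr s * r powr (- 1) = r powr (q + \<alpha>)" unfolding powr_add[symmetric] s_def by simp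
    finally show ?thesis .
  qed
  have momq: "(\<Sum>x\<in>F. nv x powr q * T r 0 x) \<le> C * r powr (q + \<alpha>)" if "1 \<le> r" "finite F" for r F
    using near[OF that] far[OF that] sum.Int_Diff[OF that(2), of "\<lambda>x. nv x powr q * T r 0 x" "lball r"]
    unfolding C_def by (simp add: algebra_simps)
  have "(\<exists>B. \<forall>F. finite F \<longrightarrow> (\<Sum>x\<in>F. T r 0 x) \<le> B)" if r: "1 \<le> r" for r
  proof (intro exI allI impI)
    fix F :: "(int ^ 'd) set" assume F: "finite F"
    have "(\<Sum>x\<in>F. T r 0 x) \<le> (\<Sum>x\<in>F. of_bool (x \<in> lball r) + nv x powr q * T r 0 x)"
    proof (intro sum_mono)
      fix x
      show "T r 0 x \<le> of_bool (x \<in> lball r) + nv x powr q * T r 0 x"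
      proof (cases "x \<in> lball r")
        case True
        then show ?thesis using T_le_1[of r 0 x] T_nonneg[of r 0 x] by (simp add: add_increasing2)
      next
        case False
        then have "1 \<le> nv x powr q" using r q by (intro ge_one_powr_ge_zero) (auto simp: lball_def)
        then show ?thesis using False T_nonneg[of r 0 x] mult_right_mono[of 1 "nv x powr q" "T r 0 x"] by simp
      qed
    qed
    also have "\<dots> = card (F \<inter> lball r) + (\<Sum>x\<in>F. nv x powr q * T r 0 x)"
      using F by (simp add: sum.distrib of_bool_def sum.If_cases)
    also have "\<dots> \<le> card (lball r) + C * r powr (q + \<alpha>)"
      using momq[OF r F] by (intro add_mono of_nat_mono card_mono) auto
    finally show "(\<Sum>x\<in>F. T r 0 x) \<le> card (lball r) + C * r powr (q + \<alpha>)" .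
  qed
  moreover have "(\<Sum>x\<in>F. nv x powr p * T r 0 x) \<le> (1 + C / c) * r powr p * X"
    if r: "1 \<le> r" and X: "\<forall>F. finite F \<longrightarrow> (\<Sum>x\<in>F. T r 0 x) \<le> X" and F: "finite F" for r X F
  proof -
    have cX: "r powr \<alpha> \<le> X / c" using c(2)[OF r, of X] X c(1) by (simp add: pos_le_divide_eq mult.commute)
    have "(\<Sum>x\<in>F. nv x powr p * T r 0 x) \<le> (\<Sum>x\<in>F. r powr p * (T r 0 x + r powr (- q) * (nv x powr q * T r 0 x)))"
    proof (intro sum_mono)
      fix x
      have "(nv x / r) powr p \<le> 1 + (nv x / r) powr q"
      proof (cases "nv x \<le> r")
        case True
        then have "(nv x / r) powr p \<le> 1" using r p by (intro powr_le1) auto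
        then show ?thesis by (simp add: add_increasing2)
      next
        case False
        then have "(nv x / r) powr p \<le> (nv x / r) powr q" using r q by (intro powr_mono) auto
        then show ?thesis by simp
      qed
      then have "r powr p * ((nv x / r) powr p * T r 0 x) \<le> r powr p * ((1 + (nv x / r) powr q) * T r 0 x)"
        by (intro mult_left_mono mult_right_mono T_nonneg) auto
      then show "nv x powr p * T r 0 x \<le> r powr p * (T r 0 x + r powr (- q) * (nv x powr q * T r 0 x))"
        using r by (simp add: powr_divide powr_minus field_simps)
    qed
    also have "\<dots> = r powr p * ((\<Sum>x\<in>F. T r 0 x) + r powr (- q) * (\<Sum>x\<in>F. nv x powr q * T r 0 x))"
      by (simp add: sum.distrib sum_distrib_left[symmetric])
    also have "\<dots> \<le> r powr p * (X + r powr (- q) * (C * r powr (q + \<alpha>)))"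
      using X F momq[OF r F] by (intro mult_left_mono add_mono) auto
    also have "r powr (- q) * (C * r powr (q + \<alpha>)) = C * r powr \<alpha>" by (simp add: mult.left_commute flip: powr_add)
    also have "r powr p * (X + C * r powr \<alpha>) \<le> r powr p * (X + C * (X / c))"
      using cX C by (intro mult_left_mono add_mono) auto
    finally show ?thesis by (simp add: algebra_simps)
  qed
  moreover have "0 < 1 + C / c" using C c by (simp add: add_pos_pos)
  ultimately show ?thesis by blast
qed

end

section \<open>Radius of gyration\<close>

context lr_model
begin

lemma two_point_Kf: "two_point Kf b x y = Tf x y"
  unfolding Tf_def wf_def by (rule percolation_kernel.two_point_eq_Tau[OF percolation_kernel_Kf])

lemma two_point_Kc: "two_point (Kc r) b x y = T r x y"
  unfolding T_def wc_def by (rule percolation_kernel.two_point_eq_Tau[OF percolation_kernel_Kc])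

lemma susceptibility_Kc: "susceptibility (Kc r) b = (\<integral>\<^sup>+ x. ennreal (T r 0 x) \<partial>count_space UNIV)"
proof -
  have "emeasure (count_space UNIV) X = (\<integral>\<^sup>+ y. 1 \<partial>count_space X)" for X :: "(int ^ 'd) set"
    by (simp add: emeasure_count_space)
  then have "susceptibility (Kc r) b =
      (\<integral>\<^sup>+ \<omega>. (\<integral>\<^sup>+ y. 1 \<partial>count_space (cluster \<omega> 0)) \<partial>percolation (Kc r) b)"
    by (simp only: susceptibility_def)
  also have "\<dots> = (\<integral>\<^sup>+ x. 1 * ennreal (T r 0 x) \<partial>count_space UNIV)"
    unfolding T_def wc_def by (rule percolation_kernel.nn_integral_cluster[OF percolation_kernel_Kc])
  finally show ?thesis by simp
qed

lemma cluster_moment_Kc: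
  "cluster_moment (Kc r) b p = (\<integral>\<^sup>+ x. ennreal (norm (real_vec x) powr p * T r 0 x) \<partial>count_space UNIV)"
proof -
  have "cluster_moment (Kc r) b p =
      (\<integral>\<^sup>+ x. ennreal (norm (real_vec x) powr p) * ennreal (T r 0 x) \<partial>count_space UNIV)"
    unfolding cluster_moment_def T_def wc_def
    by (rule percolation_kernel.nn_integral_cluster[OF percolation_kernel_Kc])
  then show ?thesis by (simp add: ennreal_mult T_nonneg)
qed

lemma susceptibility_le_iff:
  "0 \<le> B \<Longrightarrow> susceptibility (Kc r) b \<le> ennreal B \<longleftrightarrow> (\<forall>F. finite F \<longrightarrow> (\<Sum>x\<in>F. T r 0 x) \<le> B)"
  unfolding susceptibility_Kc by (intro nn_integral_count_space_le_iff T_nonneg)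

lemma cluster_moment_le_iff:
  "0 \<le> B \<Longrightarrow> cluster_moment (Kc r) b p \<le> ennreal B \<longleftrightarrow>
    (\<forall>F. finite F \<longrightarrow> (\<Sum>x\<in>F. norm (real_vec x) powr p * T r 0 x) \<le> B)"
  unfolding cluster_moment_Kc by (intro nn_integral_count_space_le_iff mult_nonneg_nonneg T_nonneg) simp

text \<open>\<open>enn2real\<close> sends an infinite susceptibility to 0, so finiteness is carried
  as a separate hypothesis.\<close>

definition chi0 :: "real \<Rightarrow> real" where
  "chi0 r = enn2real (susceptibility (Kc r) b)"

lemma chi0_upper:
  assumes "susceptibility (Kc r) b \<noteq> \<infinity>" "finite F"
  shows "(\<Sum>x\<in>F. T r 0 x) \<le> chi0 r"
proof -
  have "susceptibility (Kc r) b \<le> ennreal (chi0 r)" unfolding chi0_def using assms(1) by (simp add: less_top)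
  then show ?thesis using assms(2) susceptibility_le_iff[of "chi0 r" r] by (simp add: chi0_def)
qed

lemma chi0_least:
  assumes "\<And>F. finite F \<Longrightarrow> (\<Sum>x\<in>F. T r 0 x) \<le> B"
  shows "chi0 r \<le> B" "susceptibility (Kc r) b \<noteq> \<infinity>"
proof -
  have B: "0 \<le> B" using assms[of "{}"] by simp
  then have le: "susceptibility (Kc r) b \<le> ennreal B" using susceptibility_le_iff[of B r] assms by simp
  show "chi0 r \<le> B" unfolding chi0_def using enn2real_mono[OF le] B by simp
  show "susceptibility (Kc r) b \<noteq> \<infinity>" using le by (auto simp: top_unique)
qed

lemma chi0_ge_1: "susceptibility (Kc r) b \<noteq> \<infinity> \<Longrightarrow> 1 \<le> chi0 r"
  using chi0_upper[of r "{0}"] by simp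

text \<open>The convention that the radius is infinite when an expectation is infinite is what
  yields finiteness. \<open>max G 0\<close> appears because \<open>ennreal\<close> truncates
  negative numbers to 0.\<close>

lemma gyration_imp_moment:
  assumes gyr: "gyration_radius (Kc r) b p \<le> ennreal G" and p: "0 < p" and F: "finite F"
  shows "susceptibility (Kc r) b \<noteq> \<infinity>"
    and "(\<Sum>x\<in>F. norm (real_vec x) powr p * T r 0 x) \<le> max G 0 powr p * chi0 r"
proof -
  let ?m = "cluster_moment (Kc r) b p" and ?s = "susceptibility (Kc r) b"
  have fin: "?m \<noteq> \<infinity>" "?s \<noteq> \<infinity>"
    using gyr unfolding gyration_radius_def by (auto simp: top_unique split: if_splits)
  show "?s \<noteq> \<infinity>" by fact
  have chi: "1 \<le> chi0 r" by (rule chi0_ge_1[OF fin(2)])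
  have "ennreal ((enn2real ?m / chi0 r) powr (1 / p)) \<le> ennreal (max G 0)"
    using gyr fin unfolding gyration_radius_def chi0_def by (auto intro: order_trans ennreal_leI)
  then have "(enn2real ?m / chi0 r) powr (1 / p) \<le> max G 0" by (subst (asm) ennreal_le_iff) auto
  then have "((enn2real ?m / chi0 r) powr (1 / p)) powr p \<le> max G 0 powr p"
    using p by (intro powr_mono2) auto
  then have "enn2real ?m / chi0 r \<le> max G 0 powr p"
    using p chi by (simp add: powr_powr)
  then have "enn2real ?m \<le> max G 0 powr p * chi0 r" using chi by (simp add: pos_divide_le_eq)
  then have "?m \<le> ennreal (max G 0 powr p * chi0 r)"
    using fin(1) by (metis ennreal_enn2real ennreal_leI infinity_ennreal_def less_top)
  then show "(\<Sum>x\<in>F. norm (real_vec x) powr p * T r 0 x) \<le> max G 0 powr p * chi0 r"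
    using cluster_moment_le_iff[of "max G 0 powr p * chi0 r" r p] chi F by simp
qed

lemma moment_imp_gyration:
  assumes fin: "susceptibility (Kc r) b \<noteq> \<infinity>" and p: "0 < p" and G: "0 \<le> G"
    and mom: "\<And>F. finite F \<Longrightarrow> (\<Sum>x\<in>F. norm (real_vec x) powr p * T r 0 x) \<le> G powr p * chi0 r"
  shows "gyration_radius (Kc r) b p \<le> ennreal G"
proof -
  let ?m = "cluster_moment (Kc r) b p"
  have chi: "1 \<le> chi0 r" by (rule chi0_ge_1[OF fin])
  have B: "0 \<le> G powr p * chi0 r" using chi by simp
  have le: "?m \<le> ennreal (G powr p * chi0 r)" using cluster_moment_le_iff[OF B, of r p] mom by simp
  then have finm: "?m \<noteq> \<infinity>" by (auto simp: top_unique)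
  have "enn2real ?m \<le> G powr p * chi0 r" using enn2real_mono[OF le] B by simp
  then have "enn2real ?m / chi0 r \<le> G powr p" using chi by (simp add: pos_divide_le_eq)
  then have "(enn2real ?m / chi0 r) powr (1 / p) \<le> (G powr p) powr (1 / p)"
    using p chi by (intro powr_mono2) auto
  also have "\<dots> = G" using p G by (simp add: powr_powr)
  finally show ?thesis
    using fin finm unfolding gyration_radius_def chi0_def by (simp add: ennreal_leI)
qed

definition cl :: bool where
  "cl \<longleftrightarrow> (\<forall>p>0. \<exists>C. \<forall>r\<ge>1. gyration_radius (Kc r) b p \<le> ennreal (C * r))"

text \<open>The moments in the radius of gyration use the Euclidean norm; equivalence of norms
  converts them to \<open>N\<close>. The finite radius also makes \<open>chi0\<close> the true
  susceptibility.\<close>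

lemma cl_imp_lr_cl:
  assumes cl and b0: "0 < b" and c: "0 < c"
    and low: "\<And>r X. 1 \<le> r \<Longrightarrow> (\<And>F. finite F \<Longrightarrow> (\<Sum>x\<in>F. T r 0 x) \<le> X) \<Longrightarrow> c * r powr \<alpha> \<le> X"
  shows "lr_cl N d \<alpha> b J CJ cJ rJ chi0 c"
proof unfold_locales
  have fin: "susceptibility (Kc r) b \<noteq> \<infinity>" if r: "1 \<le> r" for r
  proof -
    obtain C where "\<And>r. 1 \<le> r \<Longrightarrow> gyration_radius (Kc r) b 1 \<le> ennreal (C * r)"
      using \<open>cl\<close> unfolding cl_def by (meson zero_less_one)
    from gyration_imp_moment(1)[OF this[OF r], of "{}"] show ?thesis by simp
  qed
  show "0 < b" "0 < c" by fact+
  show up: "(\<Sum>x\<in>F. T r 0 x) \<le> chi0 r" if "1 \<le> r" "finite F" for r F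
    using chi0_upper[OF fin[OF that(1)] that(2)] .
  show "chi0 r \<le> B" if "1 \<le> r" "\<And>F. finite F \<Longrightarrow> (\<Sum>x\<in>F. T r 0 x) \<le> B" for r B
    using chi0_least(1)[OF that(2)] .
  show "c * r powr \<alpha> \<le> chi0 r" if "1 \<le> r" for r
    using low[OF that up[OF that]] .
  show "\<exists>C>0. \<forall>r\<ge>1. \<forall>F. finite F \<longrightarrow> (\<Sum>x\<in>F. nv x powr p * T r 0 x) \<le> C * r powr p * chi0 r"
    if p: "0 < p" for p
  proof -
    obtain C where C: "\<And>r. 1 \<le> r \<Longrightarrow> gyration_radius (Kc r) b p \<le> ennreal (C * r)"
      using \<open>cl\<close> p unfolding cl_def by meson
    obtain k where k: "0 < k" "\<And>v. N v \<le> k * norm v" using N_le_norm by blast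
    define D where "D = k powr p * (max C 0 + 1) powr p"
    have D: "0 < D" unfolding D_def using k by simp
    have "(\<Sum>x\<in>F. nv x powr p * T r 0 x) \<le> D * r powr p * chi0 r" if r: "1 \<le> r" and F: "finite F" for r F
    proof -
      have chi: "1 \<le> chi0 r" by (rule chi0_ge_1[OF fin[OF r]])
      have "(\<Sum>x\<in>F. nv x powr p * T r 0 x) \<le> (\<Sum>x\<in>F. k powr p * (norm (real_vec x) powr p * T r 0 x))"
      proof (intro sum_mono)
        fix x
        have "nv x powr p \<le> (k * norm (real_vec x)) powr p"
          using k(2)[of "real_vec x"] p by (intro powr_mono2) (auto simp: nv_def[symmetric])
        also have "\<dots> = k powr p * norm (real_vec x) powr p" using k(1) by (simp add: powr_mult)
        finally show "nv x powr p * T r 0 x \<le> k powr p * (norm (real_vec x) powr p * T r 0 x)"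
          using T_nonneg[of r 0 x] by (simp add: mult_right_mono mult.assoc[symmetric])
      qed
      also have "\<dots> = k powr p * (\<Sum>x\<in>F. norm (real_vec x) powr p * T r 0 x)" by (simp add: sum_distrib_left)
      also have "\<dots> \<le> k powr p * (max (C * r) 0 powr p * chi0 r)"
        by (intro mult_left_mono gyration_imp_moment(2)[OF C[OF r] p F]) simp
      also have "\<dots> \<le> k powr p * (((max C 0 + 1) * r) powr p * chi0 r)"
      proof -
        have "C * r \<le> (max C 0 + 1) * r" using r by (intro mult_right_mono) auto
        moreover have "0 \<le> (max C 0 + 1) * r" using r by simp
        ultimately have "max (C * r) 0 powr p \<le> ((max C 0 + 1) * r) powr p" using p by (intro powr_mono2) auto
        then show ?thesis using chi by (intro mult_left_mono mult_right_mono) auto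
      qed
      also have "\<dots> = D * r powr p * chi0 r" unfolding D_def using r by (simp add: powr_mult)
      finally show ?thesis .
    qed
    then show ?thesis using D by blast
  qed
qed

lemma profile_imp_cl:
  assumes c: "0 < c" "\<And>r X. 1 \<le> r \<Longrightarrow> (\<And>F. finite F \<Longrightarrow> (\<Sum>x\<in>F. T r 0 x) \<le> X) \<Longrightarrow> c * r powr \<alpha> \<le> X"
    and h: "\<And>t. 0 < t \<Longrightarrow> 0 < h t \<and> h t \<le> 1" "\<And>p. 0 < p \<Longrightarrow> h \<in> o[at_top](\<lambda>t. t powr (- p))"
    and A: "0 < A" "\<And>r x. 1 \<le> r \<Longrightarrow> x \<noteq> 0 \<Longrightarrow> T r 0 x \<le> A * nv x powr (- d + \<alpha>) * h (nv x / r)"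
  shows cl
  unfolding cl_def
proof (intro allI impI)
  fix p :: real assume p: "0 < p"
  obtain C where C: "0 < C" "\<forall>r\<ge>1. (\<exists>B. \<forall>F. finite F \<longrightarrow> (\<Sum>x\<in>F. T r 0 x) \<le> B) \<and>
     (\<forall>X F. (\<forall>F. finite F \<longrightarrow> (\<Sum>x\<in>F. T r 0 x) \<le> X) \<longrightarrow> finite F \<longrightarrow>
        (\<Sum>x\<in>F. nv x powr p * T r 0 x) \<le> C * r powr p * X)"
  proof -
    have "\<exists>C>0. \<forall>r\<ge>1. (\<exists>B. \<forall>F. finite F \<longrightarrow> (\<Sum>x\<in>F. T r 0 x) \<le> B) \<and>
     (\<forall>X F. (\<forall>F. finite F \<longrightarrow> (\<Sum>x\<in>F. T r 0 x) \<le> X) \<longrightarrow> finite F \<longrightarrow>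
        (\<Sum>x\<in>F. nv x powr p * T r 0 x) \<le> C * r powr p * X)"
      by (rule moments_of_profile[where c = c and h = h and A = A]) (fact c h A p)+
    then show ?thesis by (elim exE conjE) (rule that)
  qed
  obtain k where k: "0 < k" "\<And>v. norm v \<le> k * N v" using norm_le_N by blast
  define D where "D = k * C powr (1 / p)"
  have D: "0 \<le> D" unfolding D_def using k by simp
  have "gyration_radius (Kc r) b p \<le> ennreal (D * r)" if r: "1 \<le> r" for r
  proof (rule moment_imp_gyration[OF _ p])
    obtain B where "\<forall>F. finite F \<longrightarrow> (\<Sum>x\<in>F. T r 0 x) \<le> B" using C(2) r by blast
    then show fin: "susceptibility (Kc r) b \<noteq> \<infinity>" by (intro chi0_least(2)[of r B]) auto
    show "0 \<le> D * r" using D r by simp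
    fix F :: "(int ^ 'd) set" assume F: "finite F"
    have "(\<Sum>x\<in>F. norm (real_vec x) powr p * T r 0 x) \<le> (\<Sum>x\<in>F. k powr p * (nv x powr p * T r 0 x))"
    proof (intro sum_mono)
      fix x
      have "norm (real_vec x) powr p \<le> (k * nv x) powr p"
        using k(2)[of "real_vec x"] p by (intro powr_mono2) (auto simp: nv_def[symmetric])
      also have "\<dots> = k powr p * nv x powr p" using k(1) by (simp add: powr_mult)
      finally show "norm (real_vec x) powr p * T r 0 x \<le> k powr p * (nv x powr p * T r 0 x)"
        using T_nonneg[of r 0 x] by (simp add: mult_right_mono mult.assoc[symmetric])
    qed
    also have "\<dots> = k powr p * (\<Sum>x\<in>F. nv x powr p * T r 0 x)" by (simp add: sum_distrib_left)
    also have "\<dots> \<le> k powr p * (C * r powr p * chi0 r)"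
      using C(2)[rule_format, OF r] chi0_upper[OF fin] F by (intro mult_left_mono) auto
    also have "\<dots> = (D * r) powr p * chi0 r"
      unfolding D_def using k C(1) r p by (simp add: powr_mult powr_powr)
    finally show "(\<Sum>x\<in>F. norm (real_vec x) powr p * T r 0 x) \<le> (D * r) powr p * chi0 r" .
  qed
  then show "\<exists>C. \<forall>r\<ge>1. gyration_radius (Kc r) b p \<le> ennreal (C * r)" by blast
qed

end

section \<open>The radial kernel\<close>

locale radial_kernel =
  fixes d \<alpha> C :: real and J \<delta> :: "real \<Rightarrow> real"
  assumes d: "1 \<le> d" and \<alpha>: "0 < \<alpha>" and C: "0 < C"
    and J_pos: "\<And>r. 0 < r \<Longrightarrow> 0 < J r"
    and J_antimono: "antimono_on {0<..} J"
    and J_diff: "\<And>r. 0 < r \<Longrightarrow> J differentiable (at r)"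
    and J_lim: "(J \<longlongrightarrow> 0) at_top"
    and J_deriv: "\<And>r. 0 < r \<Longrightarrow> \<bar>deriv J r\<bar> = C * (1 + \<delta> r) * r powr (- d - \<alpha> - 1)"
    and \<delta>_meas: "set_borel_measurable lborel {0<..} \<delta>"
    and \<delta>_lim: "(\<delta> \<longlongrightarrow> 0) at_top"
begin

lemma J_le: "0 < r \<Longrightarrow> r \<le> s \<Longrightarrow> J s \<le> J r"
  using J_antimono by (auto simp: monotone_on_def)

lemma DERIV_J: "0 < r \<Longrightarrow> DERIV J r :> deriv J r"
  using J_diff by (simp add: DERIV_deriv_iff_real_differentiable)

lemma abs_deriv_J: "0 < r \<Longrightarrow> \<bar>deriv J r\<bar> = - deriv J r"
proof -
  assume r: "0 < r"
  have "deriv J r \<le> 0"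
  proof (rule ccontr)
    assume "\<not> ?thesis"
    then obtain e where e: "0 < e" "\<And>h. 0 < h \<Longrightarrow> h < e \<Longrightarrow> J r < J (r + h)"
      using DERIV_pos_inc_right[OF DERIV_J[OF r]] by auto
    have "J r < J (r + e / 2)" using e(1) by (intro e(2)) auto
    moreover have "J (r + e / 2) \<le> J r" using r e(1) by (intro J_le) auto
    ultimately show False by simp
  qed
  then show ?thesis by simp
qed

text \<open>\<open>deriv J\<close> need not be continuous. The fundamental theorem for nonnegative
  measurable derivatives applies, with measurability read off from the formula in terms of
  \<delta>.\<close>

lemma integral_abs_deriv:
  assumes "0 < a" "a \<le> r"
  shows "(LINT s:{a..r}|lborel. \<bar>deriv J s\<bar>) = J a - J r"
proof -
  define f where "f = (\<lambda>s. indicator {0<..} s * (C * (1 + indicator {0<..} s *\<^sub>R \<delta> s) * s powr (- d - \<alpha> - 1)))"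
  have meas: "f \<in> borel_measurable borel"
    using \<delta>_meas unfolding f_def set_borel_measurable_def by simp
  have f: "f s = \<bar>deriv J s\<bar>" if "0 < s" for s using that J_deriv[OF that] by (simp add: f_def)
  have "(LINT s:{a..r}|lborel. \<bar>deriv J s\<bar>) = (\<integral>s. f s * indicator {a..r} s \<partial>lborel)"
    unfolding set_lebesgue_integral_def using assms f
    by (intro Bochner_Integration.integral_cong) (auto simp: indicator_def)
  also have "\<dots> = (- J r) - (- J a)"
  proof (rule integral_FTC_Icc_nonneg[where F = "\<lambda>s. - J s", OF meas _ _ assms(2)])
    fix s assume "s \<in> {a..r}"
    then have s: "0 < s" using assms by simp
    show "0 \<le> f s" using f[OF s] by simp
    have "DERIV (\<lambda>s. - J s) s :> - deriv J s" by (rule DERIV_minus[OF DERIV_J[OF s]])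
    then show "DERIV (\<lambda>s. - J s) s :> f s" using f[OF s] abs_deriv_J[OF s] by simp
  qed
  finally show ?thesis by simp
qed

text \<open>Beyond \<open>r1\<close> the factor \<open>1 + \<delta> r\<close> lies between 1/2 and
  2, so \<open>- deriv J\<close> is comparable to the pure power. The upper bound integrates this
  from infinity, the lower bound is the mean value theorem on \<open>[R / 2, R]\<close>.\<close>

lemma J_bounds:
  "\<exists>CJ>0. \<exists>cJ>0. \<exists>rJ\<ge>1. (\<forall>r\<ge>1. J r \<le> CJ * r powr (- d - \<alpha>)) \<and>
     (\<forall>R\<ge>rJ. cJ * R powr (- d - \<alpha>) \<le> J (R / 2) - J R)"
proof -
  have "\<forall>\<^sub>F r in at_top. \<bar>\<delta> r\<bar> < 1 / 2"
    using tendstoD[OF \<delta>_lim, of "1 / 2"] by (simp add: dist_real_def)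
  then obtain r0 where r0: "\<And>r. r0 \<le> r \<Longrightarrow> \<bar>\<delta> r\<bar> < 1 / 2" by (auto simp: eventually_at_top_linorder)
  define r1 where "r1 = max 1 r0"
  have r1: "1 \<le> r1" "\<And>r. r1 \<le> r \<Longrightarrow> \<bar>\<delta> r\<bar> < 1 / 2" unfolding r1_def using r0 by auto
  have der: "C / 2 * r powr (- d - \<alpha> - 1) \<le> - deriv J r" "- deriv J r \<le> 2 * C * r powr (- d - \<alpha> - 1)"
    if r: "r1 \<le> r" for r
  proof -
    have rp: "0 < r" using r r1(1) by simp
    have eq: "- deriv J r = C * (1 + \<delta> r) * r powr (- d - \<alpha> - 1)" using abs_deriv_J[OF rp] J_deriv[OF rp] by simp
    have "C / 2 \<le> C * (1 + \<delta> r)" "C * (1 + \<delta> r) \<le> 2 * C"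
      using r1(2)[OF r] C mult_left_mono[of "1 / 2" "1 + \<delta> r" C] mult_left_mono[of "1 + \<delta> r" 2 C] by auto
    note le = this
    show "C / 2 * r powr (- d - \<alpha> - 1) \<le> - deriv J r" unfolding eq by (rule mult_right_mono[OF le(1)]) simp
    show "- deriv J r \<le> 2 * C * r powr (- d - \<alpha> - 1)" unfolding eq by (rule mult_right_mono[OF le(2)]) simp
  qed
  define K where "K = 2 * C / (d + \<alpha>)"
  have da: "0 < d + \<alpha>" using d \<alpha> by simp
  have K: "0 < K" unfolding K_def using C da by simp
  have upper: "J r \<le> K * r powr (- d - \<alpha>)" if r: "r1 \<le> r" for r
  proof -
    \<comment> \<open>\<open>K\<close> is chosen so that the derivative of the power compensates the
      upper bound on \<open>- deriv J\<close>. The difference is nondecreasing with limit 0, hence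
      nonpositive.\<close>
    define \<psi> where "\<psi> = (\<lambda>s. J s - K * s powr (- d - \<alpha>))"
    have mono: "\<psi> r \<le> \<psi> s" if "r \<le> s" for s
    proof (rule DERIV_nonneg_imp_nondecreasing[OF that])
      fix x assume x: "r \<le> x" "x \<le> s"
      then have x0: "0 < x" "r1 \<le> x" using r r1(1) by auto
      have "DERIV \<psi> x :> deriv J x - K * ((- d - \<alpha>) * x powr (- d - \<alpha> - 1))"
        unfolding \<psi>_def using x0 by (auto intro!: derivative_eq_intros DERIV_J)
      moreover have "K * ((- d - \<alpha>) * x powr (- d - \<alpha> - 1)) = - (2 * C * x powr (- d - \<alpha> - 1))"
        unfolding K_def using da by (simp add: field_simps)
      ultimately show "\<exists>y. DERIV \<psi> x :> y \<and> 0 \<le> y" using der(2)[OF x0(2)] by (intro exI conjI) auto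
    qed
    have "(\<psi> \<longlongrightarrow> 0 - K * 0) at_top"
      unfolding \<psi>_def using da by (intro tendsto_intros J_lim tendsto_neg_powr filterlim_ident) auto
    then have "\<psi> r \<le> 0 - K * 0"
      by (rule tendsto_lowerbound) (use mono in \<open>auto intro: eventually_mono[OF eventually_ge_at_top[of r]]\<close>)
    then show ?thesis unfolding \<psi>_def by simp
  qed
  \<comment> \<open>The extra summand covers the interval from 1 to \<open>r1\<close>, where
    \<open>J\<close> is at most \<open>J 1\<close>.\<close>
  define CJ where "CJ = K + J 1 * r1 powr (d + \<alpha>)"
  have J1: "0 < J 1" by (rule J_pos) simp
  have CJ: "0 < CJ" "K \<le> CJ" "J 1 * r1 powr (d + \<alpha>) \<le> CJ"
    unfolding CJ_def using K J1 by (auto intro: add_pos_nonneg)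
  have up: "J r \<le> CJ * r powr (- d - \<alpha>)" if r: "1 \<le> r" for r
  proof (cases "r1 \<le> r")
    case True
    show ?thesis using upper[OF True] mult_right_mono[OF CJ(2), of "r powr (- d - \<alpha>)"] by simp
  next
    case False
    have "J r \<le> J 1" using r by (intro J_le) auto
    also have "\<dots> = J 1 * (r powr (d + \<alpha>) * r powr (- d - \<alpha>))" using r by (simp flip: powr_add)
    also have "\<dots> \<le> J 1 * (r1 powr (d + \<alpha>) * r powr (- d - \<alpha>))"
      using J1 False r da by (intro mult_left_mono mult_right_mono powr_mono2) auto
    also have "\<dots> \<le> CJ * r powr (- d - \<alpha>)"
      using mult_right_mono[OF CJ(3), of "r powr (- d - \<alpha>)"] by (simp add: mult.assoc)
    finally show ?thesis .
  qed
  have low: "C / 4 * R powr (- d - \<alpha>) \<le> J (R / 2) - J R" if R: "2 * r1 \<le> R" for R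
  proof -
    have R0: "0 < R" "r1 \<le> R / 2" "R / 2 < R" using R r1(1) by auto
    have "\<exists>z. R / 2 < z \<and> z < R \<and> J R - J (R / 2) = (R - R / 2) * deriv J z"
      using R0 by (intro MVT2 DERIV_J) auto
    then obtain z where z: "R / 2 < z" "z < R" "J R - J (R / 2) = (R - R / 2) * deriv J z" by auto
    have "C / 4 * R powr (- d - \<alpha>) = (R / 2) * (C / 2 * R powr (- d - \<alpha> - 1))"
      using R0 powr_add[of R "- d - \<alpha> - 1" 1] by simp
    also have "\<dots> \<le> (R / 2) * (C / 2 * z powr (- d - \<alpha> - 1))"
      using R0 z C da by (intro mult_left_mono powr_mono2') auto
    also have "\<dots> \<le> (R / 2) * (- deriv J z)" using R0 z by (intro mult_left_mono der) auto
    also have "\<dots> = J (R / 2) - J R" using z(3) by (simp add: field_simps)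
    finally show ?thesis .
  qed
  show ?thesis
    using CJ(1) up low C r1(1)
    by (intro exI[of _ CJ] conjI exI[of _ "C / 4"] exI[of _ "2 * r1"]) auto
qed

end

section \<open>The critical parameter and the conclusion\<close>

lemma critical_point_nonneg: "0 \<le> critical_point K"
  unfolding critical_point_def by (rule Inf_greatest) auto

text \<open>An infimum has elements of the set in every right neighbourhood; \<open>\<beta>\<close>
  may be the critical value itself.\<close>

lemma near_critical:
  assumes "critical_point K < \<infinity>" "0 < \<epsilon>"
  shows "0 \<le> real_of_ereal (critical_point K)"
    and "\<exists>\<beta>\<ge>real_of_ereal (critical_point K). \<beta> < real_of_ereal (critical_point K) + \<epsilon> \<and>
       \<P>(\<omega> in percolation K \<beta>. \<exists>x. infinite (cluster \<omega> x)) > 0"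
proof -
  let ?b = "real_of_ereal (critical_point K)"
  show "0 \<le> ?b" using critical_point_nonneg[of K] by (rule real_of_ereal_pos)
  have b: "critical_point K = ereal ?b"
    using assms(1) critical_point_nonneg[of K] by (cases "critical_point K") auto
  let ?S = "{\<beta>. 0 \<le> \<beta> \<and> \<P>(\<omega> in percolation K \<beta>. \<exists>x. infinite (cluster \<omega> x)) > 0}"
  have "critical_point K < ereal (?b + \<epsilon>)"
    by (subst b) (use assms(2) in simp)
  then have "Inf (ereal ` ?S) < ereal (?b + \<epsilon>)" by (simp only: critical_point_def)
  then obtain \<beta> where \<beta>: "\<beta> \<in> ?S" "\<beta> < ?b + \<epsilon>" by (auto simp: Inf_less_iff)
  have "critical_point K \<le> ereal \<beta>" unfolding critical_point_def using \<beta>(1) by (intro Inf_lower) auto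
  then have "ereal ?b \<le> ereal \<beta>" by (simp only: b[symmetric])
  then have "?b \<le> \<beta>" by simp
  then show "\<exists>\<beta>\<ge>?b. \<beta> < ?b + \<epsilon> \<and> \<P>(\<omega> in percolation K \<beta>. \<exists>x. infinite (cluster \<omega> x)) > 0"
    using \<beta> by (intro exI[of _ \<beta>]) auto
qed

theorem mainTheorem5:
  fixes N :: "real ^ 'd \<Rightarrow> real"
    and \<alpha> C :: real
    and J \<delta> :: "real \<Rightarrow> real"
  assumes "is_norm N"
    and "\<alpha> > 0"
    and "\<And>r. r > 0 \<Longrightarrow> J r > 0"
    and "antimono_on {0<..} J"
    and "\<And>r. r > 0 \<Longrightarrow> J differentiable (at r)"
    and "(J \<longlongrightarrow> 0) at_top"
    and "C > 0"
    and "\<And>r. r > 0 \<Longrightarrow>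
           \<bar>deriv J r\<bar> = C * (1 + \<delta> r) * r powr (- real CARD('d) - \<alpha> - 1)"
    and "set_borel_measurable lborel {0<..} \<delta>"
    and "(\<delta> \<longlongrightarrow> 0) at_top"
    and "\<exists>r0>0. set_integrable lborel {r0..} (\<lambda>r. \<bar>\<delta> r\<bar> / r)"
  shows
    "(correlation_length_condition N J \<longrightarrow>
       (\<exists>a>0. \<exists>A>0. \<forall>x y :: int ^ 'd. x \<noteq> y \<longrightarrow>
          a * N (real_vec (x - y)) powr (- real CARD('d) + \<alpha>)
            \<le> two_point (lr_kernel N J) (beta_c N J) x y \<and>
          two_point (lr_kernel N J) (beta_c N J) x y
            \<le> A * N (real_vec (x - y)) powr (- real CARD('d) + \<alpha>)))
     \<and>
     (correlation_length_condition N J \<longleftrightarrow>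
       critical_point (lr_kernel N J) < \<infinity> \<and>
       (\<exists>h :: real \<Rightarrow> real.
          (\<forall>t>0. 0 < h t \<and> h t \<le> 1) \<and>
          antimono_on {0<..} h \<and>
          (\<forall>p>0. h \<in> o[at_top](\<lambda>t. t powr (- p))) \<and>
          (\<exists>A>0. \<forall>r\<ge>1. \<forall>x y :: int ^ 'd. x \<noteq> y \<longrightarrow>
             two_point (cutoff_kernel N J r) (beta_c N J) x y
               \<le> A * N (real_vec (x - y)) powr (- real CARD('d) + \<alpha>)
                   * h (N (real_vec (x - y)) / r))))"
proof (cases "critical_point (lr_kernel N J) < \<infinity>")
  case False
  \<comment> \<open>Both sides of the equivalence are false and the implication is vacuous.\<close>
  then have "\<not> correlation_length_condition N J"
    unfolding correlation_length_condition_def by blast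
  with False show ?thesis by (simp only: simp_thms)
next
  case True
  define d where "d = real CARD('d)"
  interpret lattice_norm N d by standard (use assms(1) d_def in auto)
  interpret R: radial_kernel d \<alpha> C J \<delta>
    by standard (use assms d_ge_1 in \<open>auto simp: d_def\<close>)
  obtain CJ cJ rJ where J: "0 < CJ" "0 < cJ" "1 \<le> rJ" "\<And>r. 1 \<le> r \<Longrightarrow> J r \<le> CJ * r powr (- d - \<alpha>)"
    "\<And>R. rJ \<le> R \<Longrightarrow> cJ * R powr (- d - \<alpha>) \<le> J (R / 2) - J R"
    using R.J_bounds by blast
  define b where "b = beta_c N J"
  interpret lr_model N d \<alpha> b J CJ cJ rJ
    by standard (use J assms(2,3) R.J_le near_critical(1)[OF True zero_less_one] in \<open>auto simp: b_def beta_c_def\<close>)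
  have Kf: "lr_kernel N J = Kf"
    by (intro ext) (simp add: lr_kernel_def Kf_def nv_def del: real_vec_simps)
  have Kc: "cutoff_kernel N J r = Kc r" if "1 \<le> r" for r
  proof (intro ext)
    fix x y
    show "cutoff_kernel N J r x y = Kc r x y"
      using nv_diff_pos[of x y] R.integral_abs_deriv[of "nv (x - y)" r]
      by (simp add: cutoff_kernel_def Kc_def nv_def del: real_vec_simps)
  qed
  \<comment> \<open>A bound on the partial sums at the origin holds at every vertex by translation,
    and \<open>no_infinite_cluster\<close> would then exclude infinite clusters.\<close>
  have super: "\<exists>\<beta>\<ge>b. \<beta> < b + \<epsilon> \<and> \<not> (\<exists>B. \<forall>F. finite F \<longrightarrow> (\<Sum>x\<in>F. Tau (kernel_weight Kf \<beta>) 0 x) \<le> B)"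
    if \<epsilon>: "0 < \<epsilon>" for \<epsilon>
  proof -
    obtain \<beta> where \<beta>: "b \<le> \<beta>" "\<beta> < b + \<epsilon>" "\<P>(\<omega> in percolation Kf \<beta>. \<exists>x. infinite (cluster \<omega> x)) > 0"
      using near_critical(2)[OF True \<epsilon>] unfolding Kf b_def beta_c_def by blast
    interpret F: percolation_kernel Kf \<beta>
      using percolation_kernel_Kf \<beta>(1) b by (simp add: percolation_kernel_def)
    have trans: "Tau F.W (u + 0) (u + x) = Tau F.W 0 x" for u x
      by (rule Tau_image(1)[where w = F.W and f = "(+) u"])
        (auto intro!: F.weight_nonneg bij_translate weight_translate[OF _ F.percolation_kernel_axioms] simp: Kf_def)
    have "\<not> (\<exists>B. \<forall>F. finite F \<longrightarrow> (\<Sum>x\<in>F. Tau F.W 0 x) \<le> B)"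
    proof
      assume "\<exists>B. \<forall>F. finite F \<longrightarrow> (\<Sum>x\<in>F. Tau F.W 0 x) \<le> B"
      then obtain B where B: "\<And>F. finite F \<Longrightarrow> (\<Sum>x\<in>F. Tau F.W 0 x) \<le> B" by blast
      have "(\<Sum>y\<in>F. Tau F.W u y) \<le> B" if "finite F" for u F
      proof -
        have "(\<Sum>y\<in>F. Tau F.W u y) = (\<Sum>x\<in>(\<lambda>y. y - u) ` F. Tau F.W 0 x)"
          using trans[of u "y - u" for y] by (subst sum.reindex) (auto simp: inj_on_def)
        also have "\<dots> \<le> B" using that by (intro B) auto
        finally show ?thesis .
      qed
      from F.no_infinite_cluster[OF this] show False using \<beta>(3) by simp
    qed
    then show ?thesis using \<beta> by blast
  qed
  obtain c where c: "0 < b" "0 < c"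
    "\<And>r X. 1 \<le> r \<Longrightarrow> (\<And>F. finite F \<Longrightarrow> (\<Sum>x\<in>F. T r 0 x) \<le> X) \<Longrightarrow> c * r powr \<alpha> \<le> X"
  proof -
    have "0 < b \<and> (\<exists>c>0. \<forall>r\<ge>1. \<forall>X. (\<forall>F. finite F \<longrightarrow> (\<Sum>x\<in>F. T r 0 x) \<le> X) \<longrightarrow> c * r powr \<alpha> \<le> X)"
      by (rule critical_lower_bound) (fact super)
    then show ?thesis using that by blast
  qed
  have CL: "correlation_length_condition N J \<longleftrightarrow> cl"
    unfolding correlation_length_condition_def cl_def b_def[symmetric] using True Kc by simp
  have diff: "N (real_vec (x - y)) = nv (y - x)" "Tf x y = Tf 0 (y - x)" "T r x y = T r 0 (y - x)" for x y r
    using nv_commute[of x y] Tf_origin[of x y] T_origin[of r x y] by (simp_all add: nv_def del: real_vec_simps)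
  show ?thesis
  proof (intro conjI impI iffI)
    assume "correlation_length_condition N J"
    then have cl unfolding CL .
    have lr: "lr_cl N d \<alpha> b J CJ cJ rJ chi0 c"
    proof (rule cl_imp_lr_cl)
      show cl by fact
      show "0 < b" by (rule c(1))
      show "0 < c" by (rule c(2))
      show "c * r powr \<alpha> \<le> X" if "1 \<le> r" "\<And>F. finite F \<Longrightarrow> (\<Sum>x\<in>F. T r 0 x) \<le> X" for r X
        using that by (rule c(3))
    qed
    have lo: "\<exists>a>0. \<forall>x. x \<noteq> 0 \<longrightarrow> a * nv x powr (- d + \<alpha>) \<le> Tf 0 x"
      by (rule lr_cl.Tf_lower_bound[OF lr])
    have up: "\<exists>A>0. \<forall>x. x \<noteq> 0 \<longrightarrow> Tf 0 x \<le> A * nv x powr (- d + \<alpha>)"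
      by (rule lr_cl.Tf_upper_bound[OF lr])
    obtain a where a: "0 < a" "\<And>x. x \<noteq> 0 \<Longrightarrow> a * nv x powr (- d + \<alpha>) \<le> Tf 0 x"
      using lo by blast
    obtain A where A: "0 < A" "\<And>x. x \<noteq> 0 \<Longrightarrow> Tf 0 x \<le> A * nv x powr (- d + \<alpha>)"
      using up by blast
    show "\<exists>a>0. \<exists>A>0. \<forall>x y. x \<noteq> y \<longrightarrow>
          a * N (real_vec (x - y)) powr (- real CARD('d) + \<alpha>)
            \<le> two_point (lr_kernel N J) (beta_c N J) x y \<and>
          two_point (lr_kernel N J) (beta_c N J) x y
            \<le> A * N (real_vec (x - y)) powr (- real CARD('d) + \<alpha>)"
    proof (rule exI[of _ a], rule conjI[OF a(1)], rule exI[of _ A], intro conjI allI impI A(1))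
      fix x y :: "int ^ 'd" assume "x \<noteq> y"
      then have nz: "y - x \<noteq> 0" by simp
      show "a * N (real_vec (x - y)) powr (- real CARD('d) + \<alpha>) \<le> two_point (lr_kernel N J) (beta_c N J) x y"
        "two_point (lr_kernel N J) (beta_c N J) x y \<le> A * N (real_vec (x - y)) powr (- real CARD('d) + \<alpha>)"
        unfolding Kf b_def[symmetric] two_point_Kf d_def[symmetric] diff(1)[of x y] diff(2)[of x y]
        by (rule a(2)[OF nz], rule A(2)[OF nz])
    qed
    show "critical_point (lr_kernel N J) < \<infinity>" by (rule True)
    show "\<exists>h :: real \<Rightarrow> real.
          (\<forall>t>0. 0 < h t \<and> h t \<le> 1) \<and>
          antimono_on {0<..} h \<and>
          (\<forall>p>0. h \<in> o[at_top](\<lambda>t. t powr (- p))) \<and>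
          (\<exists>A>0. \<forall>r\<ge>1. \<forall>x y :: int ^ 'd. x \<noteq> y \<longrightarrow>
             two_point (cutoff_kernel N J r) (beta_c N J) x y
               \<le> A * N (real_vec (x - y)) powr (- real CARD('d) + \<alpha>)
                   * h (N (real_vec (x - y)) / r))"
    proof -
      obtain h A where h: "\<forall>t>0. 0 < h t \<and> h t \<le> (1 :: real)" "antimono_on {0<..} h"
        "\<forall>p>0. h \<in> o[at_top](\<lambda>t. t powr (- p))" "0 < A"
        "\<And>r x. 1 \<le> r \<Longrightarrow> x \<noteq> 0 \<Longrightarrow> T r 0 x \<le> A * nv x powr (- d + \<alpha>) * h (nv x / r)"
        using lr_cl.cutoff_profile[OF lr] by blast
      have "two_point (cutoff_kernel N J r) (beta_c N J) x y
               \<le> A * N (real_vec (x - y)) powr (- real CARD('d) + \<alpha>)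
                   * h (N (real_vec (x - y)) / r)" if "1 \<le> r" "x \<noteq> y" for r x y
        unfolding Kc[OF that(1)] b_def[symmetric] two_point_Kc d_def[symmetric] diff(1)[of x y] diff(3)[of r x y]
        using that by (intro h) auto
      then show ?thesis using h(1-4) by blast
    qed
  next
    assume "critical_point (lr_kernel N J) < \<infinity> \<and> (\<exists>h :: real \<Rightarrow> real.
          (\<forall>t>0. 0 < h t \<and> h t \<le> 1) \<and>
          antimono_on {0<..} h \<and>
          (\<forall>p>0. h \<in> o[at_top](\<lambda>t. t powr (- p))) \<and>
          (\<exists>A>0. \<forall>r\<ge>1. \<forall>x y :: int ^ 'd. x \<noteq> y \<longrightarrow>
             two_point (cutoff_kernel N J r) (beta_c N J) x y
               \<le> A * N (real_vec (x - y)) powr (- real CARD('d) + \<alpha>)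
                   * h (N (real_vec (x - y)) / r)))"
    then obtain h A where h: "\<And>t. 0 < t \<Longrightarrow> 0 < h t \<and> h t \<le> (1 :: real)"
      "\<And>p. 0 < p \<Longrightarrow> h \<in> o[at_top](\<lambda>t. t powr (- p))" "0 < A"
      and le: "\<And>r (x :: int ^ 'd) y. 1 \<le> r \<Longrightarrow> x \<noteq> y \<Longrightarrow> two_point (cutoff_kernel N J r) (beta_c N J) x y
               \<le> A * N (real_vec (x - y)) powr (- real CARD('d) + \<alpha>)
                   * h (N (real_vec (x - y)) / r)" by blast
    have "T r 0 x \<le> A * nv x powr (- d + \<alpha>) * h (nv x / r)" if "1 \<le> r" "x \<noteq> 0" for r x
      using le[OF that(1), of 0 x] that
      unfolding Kc[OF that(1)] b_def[symmetric] two_point_Kc d_def[symmetric] diff(1)[of 0 x] by simp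
    note T_le = this
    have cl by (rule profile_imp_cl[where c = c and h = h and A = A]) (fact c h T_le)+
    then show "correlation_length_condition N J" unfolding CL .
  qed
qed

end
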